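(* Let $q \geq 5$ be an odd prime power, and let $G$ be a finite group with a minimal normal subgroup $N = \mathrm{PSL}_2(q)\times\cdots\times\mathrm{PSL}_2(q)$, a direct product of $k$ copies of $\mathrm{PSL}_2(q)$, such that $|G/N| < q^k$. Write $|G| = b(G)(b(G)+e)$. Then $e > \sqrt{b(G)}+1$, and in particular $|G| < e^4-e^3$.
   Context: $b(G)$ denotes the largest degree of a complex irreducible character of $G$. *)

theory Defs
  imports Complex_Main "HOL-Algebra.Algebra" "HOL-Computational_Algebra.Primes"
    "Jordan_Normal_Form.Matrix"
begin

text \<open>A complex representation of degree n of the group G: a homomorphism from G
  into the group of invertible n x n complex matrices (invertibility follows from
  multiplicativity and rho 1 = identity).\<close>
definition complex_rep :: "('a, 'c) monoid_scheme \<Rightarrow> nat \<Rightarrow> ('a \<Rightarrow> complex mat) \<Rightarrow> bool" where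
  "complex_rep G n \<rho> \<longleftrightarrow>
     (\<forall>g \<in> carrier G. \<rho> g \<in> carrier_mat n n) \<and>
     (\<forall>g \<in> carrier G. \<forall>h \<in> carrier G. \<rho> (g \<otimes>\<^bsub>G\<^esub> h) = \<rho> g * \<rho> h) \<and>
     \<rho> \<one>\<^bsub>G\<^esub> = 1\<^sub>m n"

definition invariant_subspace :: "('a, 'c) monoid_scheme \<Rightarrow> nat \<Rightarrow> ('a \<Rightarrow> complex mat) \<Rightarrow> complex vec set \<Rightarrow> bool" where
  "invariant_subspace G n \<rho> W \<longleftrightarrow>
     W \<subseteq> carrier_vec n \<and> 0\<^sub>v n \<in> W \<and>
     (\<forall>v \<in> W. \<forall>w \<in> W. v + w \<in> W) \<and>
     (\<forall>c. \<forall>v \<in> W. c \<cdot>\<^sub>v v \<in> W) \<and>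
     (\<forall>g \<in> carrier G. \<forall>v \<in> W. \<rho> g *\<^sub>v v \<in> W)"

definition irreducible_complex_rep :: "('a, 'c) monoid_scheme \<Rightarrow> nat \<Rightarrow> ('a \<Rightarrow> complex mat) \<Rightarrow> bool" where
  "irreducible_complex_rep G n \<rho> \<longleftrightarrow>
     n \<ge> 1 \<and> complex_rep G n \<rho> \<and>
     (\<forall>W. invariant_subspace G n \<rho> W \<longrightarrow> W = {0\<^sub>v n} \<or> W = carrier_vec n)"

text \<open>Degrees of complex irreducible characters = degrees of irreducible complex representations.\<close>
definition irr_degrees :: "('a, 'c) monoid_scheme \<Rightarrow> nat set" where
  "irr_degrees G = {n. \<exists>\<rho>. irreducible_complex_rep G n \<rho>}"

definition b_max :: "('a, 'c) monoid_scheme \<Rightarrow> nat" where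
  "b_max G = Max (irr_degrees G)"

definition SL2_mult :: "('b, 'd) ring_scheme \<Rightarrow> 'b \<times> 'b \<times> 'b \<times> 'b \<Rightarrow> 'b \<times> 'b \<times> 'b \<times> 'b \<Rightarrow> 'b \<times> 'b \<times> 'b \<times> 'b" where
  "SL2_mult R x y = (case x of (a, b, c, d) \<Rightarrow> case y of (a', b', c', d') \<Rightarrow>
                 (a \<otimes>\<^bsub>R\<^esub> a' \<oplus>\<^bsub>R\<^esub> b \<otimes>\<^bsub>R\<^esub> c', a \<otimes>\<^bsub>R\<^esub> b' \<oplus>\<^bsub>R\<^esub> b \<otimes>\<^bsub>R\<^esub> d',
                  c \<otimes>\<^bsub>R\<^esub> a' \<oplus>\<^bsub>R\<^esub> d \<otimes>\<^bsub>R\<^esub> c', c \<otimes>\<^bsub>R\<^esub> b' \<oplus>\<^bsub>R\<^esub> d \<otimes>\<^bsub>R\<^esub> d'))"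

definition SL2_carrier :: "('b, 'd) ring_scheme \<Rightarrow> ('b \<times> 'b \<times> 'b \<times> 'b) set" where
  "SL2_carrier R = {(a, b, c, d). a \<in> carrier R \<and> b \<in> carrier R \<and> c \<in> carrier R \<and> d \<in> carrier R
                  \<and> a \<otimes>\<^bsub>R\<^esub> d \<ominus>\<^bsub>R\<^esub> b \<otimes>\<^bsub>R\<^esub> c = \<one>\<^bsub>R\<^esub>}"

definition SL2 :: "('b, 'd) ring_scheme \<Rightarrow> ('b \<times> 'b \<times> 'b \<times> 'b) monoid" where
  "SL2 R = \<lparr> carrier = SL2_carrier R, monoid.mult = SL2_mult R,
             one = (\<one>\<^bsub>R\<^esub>, \<zero>\<^bsub>R\<^esub>, \<zero>\<^bsub>R\<^esub>, \<one>\<^bsub>R\<^esub>) \<rparr>"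

definition SL2_scalars :: "('b, 'd) ring_scheme \<Rightarrow> ('b \<times> 'b \<times> 'b \<times> 'b) set" where
  "SL2_scalars R = {(a, \<zero>\<^bsub>R\<^esub>, \<zero>\<^bsub>R\<^esub>, a) | a. a \<in> carrier R \<and> a \<otimes>\<^bsub>R\<^esub> a = \<one>\<^bsub>R\<^esub>}"

definition PSL2 :: "('b, 'd) ring_scheme \<Rightarrow> ('b \<times> 'b \<times> 'b \<times> 'b) set monoid" where
  "PSL2 R = SL2 R Mod SL2_scalars R"

definition minimal_normal :: "'a set \<Rightarrow> ('a, 'c) monoid_scheme \<Rightarrow> bool" where
  "minimal_normal N G \<longleftrightarrow>
     N \<lhd> G \<and> N \<noteq> {\<one>\<^bsub>G\<^esub>} \<and>
     (\<forall>M. M \<lhd> G \<and> M \<subseteq> N \<longrightarrow> M = {\<one>\<^bsub>G\<^esub>} \<or> M = N)"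

end

theory Submission
  imports "HOL-Analysis.Convex" "HOL-Library.Indicator_Function" "Jordan_Normal_Form.Spectral_Radius" Defs
begin

text \<open>
  Every irreducible degree \<open>n\<close> of \<open>G\<close> satisfies \<open>n\<^sup>2 + n\<^sup>3\<^sup>/\<^sup>2 + n < |G|\<close>, which gives both claims.
  Let \<open>h = |G/N|\<close>, let \<open>V\<close> be the representation and \<open>\<chi>\<close> its character, and let \<open>U \<le> B \<le> N\<close> be the
  \<open>k\<close>-th powers of the unipotent radical and of the Borel subgroup of \<open>PSL\<^sub>2(q)\<close>. The defect
  \<open>|G| - n\<^sup>2\<close> is the sum of \<open>|\<chi>(x)|\<^sup>2\<close> over \<open>x \<noteq> 1\<close>, so by Cauchy--Schwarz every function on \<open>N\<close> orthogonal
  to \<open>\<chi>\<close> bounds it from below.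

  If \<open>B\<close> fixes a nonzero vector, let \<open>m\<close> be the dimension of the space of fixed vectors. Frobenius
  reciprocity gives \<open>n m \<le> |G : B|\<close>, and Frattini's argument (\<open>U\<close> is a Sylow subgroup of \<open>N\<close> with normalizer \<open>B\<close>)
  gives \<open>n \<le> (q+1)\<^sup>k m\<close>, so that \<open>n\<^sup>2 \<le> h (q+1)\<^sup>2\<^sup>k\<close>.
  If not, \<open>\<chi>\<close> is orthogonal to the Steinberg character of \<open>N\<close>. If moreover \<open>U\<close> fixes a nonzero vector,
  then \<open>B\<close> has an eigenvector, hence \<open>n \<le> h (q+1)\<^sup>k\<close>, and this together with the Steinberg bound suffices.
  If \<open>U\<close> fixes no nonzero vector, then \<open>\<chi>\<close> is orthogonal to the sum of the indicators of all
  conjugates of \<open>U\<close>, and the defect is at least \<open>n\<^sup>2 / (2\<^sup>k - 1)\<close>.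
\<close>

section \<open>Schur orthogonality\<close>

text \<open>With e = |G|/b - b, the claim e > sqrt b + 1 says exactly b^2 + b^(3/2) + b < |G|. A
  test function f on N orthogonal to \<chi> yields n^2 \<le> (R - 1)(|G| - n^2), where R is the sum
  of f^2 divided by f(1)^2; if the defect were at most n^(3/2) + n, this would force sqrt n < R. For
  the conjugates of U the value of R is below 2^k, which contradicts |G| \<ge> 60^k at once. For the
  Steinberg character the available R is ((q^2 - 1)/(2q))^k, too large for that, hence the
  additional bound on n from an eigenvector. If B fixes a nonzero vector, the Steinberg character
  may occur in the restriction of \<chi>, and n m \<le> h (q+1)^k by itself leaves a factor h^2 in
  the bound on n^2; multiplying it with the Frattini bound cancels m and leaves a single h.
  Representations are handled through matrix coefficients only: the dimension m enters as a trace,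
  and sums over conjugates replace orthonormal bases.\<close>

lemma group_sum_translate_left:
  fixes G (structure)
  assumes "group G" "h \<in> carrier G"
  shows "(\<Sum>g\<in>carrier G. f (h \<otimes>\<^bsub>G\<^esub> g)) = (\<Sum>g\<in>carrier G. f g)"
proof -
  interpret group G by fact
  show ?thesis
    by (rule sum.reindex_bij_witness[where i="\<lambda>g. inv h \<otimes> g" and j="\<lambda>g. h \<otimes> g"])
       (use assms in \<open>auto simp: m_assoc[symmetric]\<close>)
qed

lemma group_sum_translate_right:
  fixes G (structure)
  assumes "group G" "h \<in> carrier G"
  shows "(\<Sum>g\<in>carrier G. f (g \<otimes>\<^bsub>G\<^esub> h)) = (\<Sum>g\<in>carrier G. f g)"
proof -
  interpret group G by fact
  show ?thesis
    by (rule sum.reindex_bij_witness[where i="\<lambda>g. g \<otimes> inv h" and j="\<lambda>g. g \<otimes> h"])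
       (use assms in \<open>auto simp: m_assoc\<close>)
qed

lemma group_sum_inverse:
  fixes G (structure)
  assumes "group G"
  shows "(\<Sum>g\<in>carrier G. f (inv\<^bsub>G\<^esub> g)) = (\<Sum>g\<in>carrier G. f g)"
proof -
  interpret group G by fact
  show ?thesis
    by (rule sum.reindex_bij_witness[where i="\<lambda>g. inv g" and j="\<lambda>g. inv g"]) auto
qed

text \<open>Schur's lemma: over the complex numbers \<open>A\<close> has an eigenvalue, and an
  eigenspace of a matrix commuting with \<rho> is an invariant subspace, hence the whole
  space.\<close>

lemma irreducible_commuting_scalar:
  assumes "irreducible_complex_rep G n \<rho>" and A: "A \<in> carrier_mat n n"
    and comm: "\<And>g. g \<in> carrier G \<Longrightarrow> \<rho> g * A = A * \<rho> g"
  shows "\<exists>c. A = c \<cdot>\<^sub>m 1\<^sub>m n"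
proof -
  have n: "n > 0" and rep: "complex_rep G n \<rho>"
    and irr: "\<And>W. invariant_subspace G n \<rho> W \<Longrightarrow> W = {0\<^sub>v n} \<or> W = carrier_vec n"
    using assms(1) unfolding irreducible_complex_rep_def by auto
  have \<rho>: "\<And>g. g \<in> carrier G \<Longrightarrow> \<rho> g \<in> carrier_mat n n"
    using rep unfolding complex_rep_def by auto
  obtain c where "eigenvalue A c"
    using spectrum_non_empty[OF A n] unfolding spectrum_def by auto
  then obtain v where v: "v \<in> carrier_vec n" "v \<noteq> 0\<^sub>v n" "A *\<^sub>v v = c \<cdot>\<^sub>v v"
    using A unfolding eigenvalue_def eigenvector_def by auto
  define W where "W = {v \<in> carrier_vec n. A *\<^sub>v v = c \<cdot>\<^sub>v v}"
  have "A *\<^sub>v (\<rho> g *\<^sub>v w) = c \<cdot>\<^sub>v (\<rho> g *\<^sub>v w)"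
    if "g \<in> carrier G" "w \<in> carrier_vec n" "A *\<^sub>v w = c \<cdot>\<^sub>v w" for g w
  proof -
    have "A *\<^sub>v (\<rho> g *\<^sub>v w) = (\<rho> g * A) *\<^sub>v w"
      using A \<rho>[OF that(1)] that comm by simp
    also have "\<dots> = \<rho> g *\<^sub>v (c \<cdot>\<^sub>v w)"
      using A \<rho>[OF that(1)] that by simp
    finally show ?thesis using \<rho>[OF that(1)] that by (simp add: mult_mat_vec)
  qed
  moreover have "A *\<^sub>v (k \<cdot>\<^sub>v w) = c \<cdot>\<^sub>v (k \<cdot>\<^sub>v w)"
    if "w \<in> carrier_vec n" "A *\<^sub>v w = c \<cdot>\<^sub>v w" for k w
    using that A by (simp add: mult_mat_vec smult_smult_assoc mult.commute)
  moreover have "\<rho> g *\<^sub>v w \<in> carrier_vec n" if "g \<in> carrier G" "w \<in> carrier_vec n" for g w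
    using \<rho>[OF that(1)] that by simp
  ultimately have "invariant_subspace G n \<rho> W"
    unfolding invariant_subspace_def W_def using A \<rho>
    by (auto simp: mult_add_distrib_mat_vec smult_add_distrib_vec)
  with v have W: "W = carrier_vec n" using irr[of W] by (auto simp: W_def)
  have "A $$ (i, j) = (c \<cdot>\<^sub>m 1\<^sub>m n) $$ (i, j)" if "i < n" "j < n" for i j
  proof -
    have "unit_vec n j \<in> W" using W by simp
    then have "(A *\<^sub>v unit_vec n j) $ i = (c \<cdot>\<^sub>v unit_vec n j) $ i" by (simp add: W_def)
    moreover have "(A *\<^sub>v unit_vec n j) $ i = A $$ (i, j)"
      using that A by (simp add: scalar_prod_right_unit)
    ultimately show ?thesis using that by simp
  qed
  then show ?thesis using A by (intro exI[of _ c]) (auto intro!: eq_matI)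
qed

text \<open>Only these identities are used from here on: vectors and matrices become functions of
  indices, and irreducibility enters through the orthogonality relation \<open>orth\<close>.\<close>

locale irreducible_coeffs = group G for G :: "('a, 'c) monoid_scheme" (structure) +
  fixes n :: nat and r :: "'a \<Rightarrow> nat \<Rightarrow> nat \<Rightarrow> complex"
  assumes fin: "finite (carrier G)" and n_pos: "n > 0"
    and r_mult: "\<lbrakk>g \<in> carrier G; h \<in> carrier G; i < n; j < n\<rbrakk> \<Longrightarrow>
      r (g \<otimes> h) i j = (\<Sum>k<n. r g i k * r h k j)"
    and r_one: "\<lbrakk>i < n; j < n\<rbrakk> \<Longrightarrow> r \<one> i j = (if i = j then 1 else 0)"
    and orth: "\<lbrakk>a < n; i < n; j < n; b < n\<rbrakk> \<Longrightarrow>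
      (\<Sum>g\<in>carrier G. r g a i * r (inv g) j b) =
        (if a = b \<and> i = j then of_nat (order G) / of_nat n else 0)"

text \<open>Averaging the conjugates of a matrix unit over the group gives a matrix commuting with
  \<rho>; Schur's lemma makes it scalar, and its trace determines the scalar.\<close>

lemma irreducible_coeffsI:
  fixes G (structure)
  assumes "group G" "finite (carrier G)" and irr: "irreducible_complex_rep G n \<rho>"
  shows "irreducible_coeffs G n (\<lambda>g i j. \<rho> g $$ (i, j))"
proof -
  interpret group G by fact
  have n: "n > 0" and rep: "complex_rep G n \<rho>"
    using irr unfolding irreducible_complex_rep_def by auto
  have \<rho>: "\<rho> g \<in> carrier_mat n n" if "g \<in> carrier G" for g
    using rep that unfolding complex_rep_def by auto
  have mult: "\<rho> (g \<otimes> h) $$ (i, j) = (\<Sum>k<n. \<rho> g $$ (i, k) * \<rho> h $$ (k, j))"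
    if "g \<in> carrier G" "h \<in> carrier G" "i < n" "j < n" for g h i j
    using rep that carrier_matD[OF \<rho>[OF that(1)]] carrier_matD[OF \<rho>[OF that(2)]]
    unfolding complex_rep_def by (simp add: scalar_prod_def atLeast0LessThan)
  have one: "\<rho> \<one> $$ (i, j) = (if i = j then 1 else 0)" if "i < n" "j < n" for i j
    using rep that unfolding complex_rep_def by simp
  have orth: "(\<Sum>g\<in>carrier G. \<rho> g $$ (a, i) * \<rho> (inv g) $$ (j, b)) =
      (if a = b \<and> i = j then of_nat (order G) / of_nat n else 0)"
    if less: "a < n" "i < n" "j < n" "b < n" for a i j b
  proof -
    \<comment> \<open>\<open>A\<close> is the sum of \<rho>(g) E \<rho>(g)^-1 over g, with E the
      matrix unit at position (i, j).\<close>
    define A where "A = mat n n (\<lambda>(a, b). \<Sum>g\<in>carrier G. \<rho> g $$ (a, i) * \<rho> (inv g) $$ (j, b))"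
    have A: "A \<in> carrier_mat n n" by (simp add: A_def)
    have "\<rho> h * A = A * \<rho> h" if h: "h \<in> carrier G" for h
    proof (rule eq_matI)
      fix a b assume "a < dim_row (A * \<rho> h)" "b < dim_col (A * \<rho> h)"
      then have ab: "a < n" "b < n" using A \<rho>[OF h] by auto
      have "(\<rho> h * A) $$ (a, b) =
          (\<Sum>c<n. \<Sum>g\<in>carrier G. \<rho> h $$ (a, c) * \<rho> g $$ (c, i) * \<rho> (inv g) $$ (j, b))"
        using ab \<rho>[OF h] A
        by (simp add: scalar_prod_def atLeast0LessThan A_def sum_distrib_left mult.assoc)
      also have "\<dots> = (\<Sum>g\<in>carrier G. \<rho> (h \<otimes> g) $$ (a, i) * \<rho> (inv g) $$ (j, b))"
        by (subst sum.swap) (use ab less h in \<open>simp add: mult sum_distrib_right\<close>)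
      \<comment> \<open>Writing g^-1 as (h g)^-1 h turns the summand into a function of h g, so that
        the sum can be translated.\<close>
      also have "\<dots> = (\<Sum>g\<in>carrier G. \<rho> (h \<otimes> g) $$ (a, i) * \<rho> (inv (h \<otimes> g) \<otimes> h) $$ (j, b))"
        using h by (intro sum.cong) (auto simp: inv_mult_group m_assoc)
      also have "\<dots> = (\<Sum>g\<in>carrier G. \<rho> g $$ (a, i) * \<rho> (inv g \<otimes> h) $$ (j, b))"
        by (rule group_sum_translate_left[OF assms(1) h, where f="\<lambda>g. \<rho> g $$ (a, i) * \<rho> (inv g \<otimes> h) $$ (j, b)"])
      also have "\<dots> = (\<Sum>c<n. \<Sum>g\<in>carrier G. \<rho> g $$ (a, i) * \<rho> (inv g) $$ (j, c) * \<rho> h $$ (c, b))"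
        by (subst sum.swap) (use ab less h in \<open>simp add: mult sum_distrib_left mult.assoc\<close>)
      also have "\<dots> = (A * \<rho> h) $$ (a, b)"
        using ab \<rho>[OF h] A
        by (simp add: scalar_prod_def atLeast0LessThan A_def sum_distrib_right)
      finally show "(\<rho> h * A) $$ (a, b) = (A * \<rho> h) $$ (a, b)" .
    qed (use A \<rho>[OF h] in auto)
    then obtain c where c: "A = c \<cdot>\<^sub>m 1\<^sub>m n"
      using irreducible_commuting_scalar[OF irr A] by blast
    \<comment> \<open>Conjugation preserves the trace of the matrix unit, which is 1 if i = j and 0
      otherwise.\<close>
    have "of_nat n * c = (\<Sum>a<n. A $$ (a, a))" by (simp add: c)
    also have "\<dots> = (\<Sum>g\<in>carrier G. \<Sum>a<n. \<rho> (inv g) $$ (j, a) * \<rho> g $$ (a, i))"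
      by (subst sum.swap) (simp add: A_def mult.commute)
    also have "\<dots> = (\<Sum>g\<in>carrier G. \<rho> \<one> $$ (j, i))"
      using less by (simp add: mult[symmetric])
    also have "\<dots> = (if i = j then of_nat (order G) else 0)"
      using less by (simp add: one order_def)
    finally have "c = (if i = j then of_nat (order G) / of_nat n else 0)"
      using n by (auto simp: field_simps)
    moreover have "A $$ (a, b) = (if a = b then c else 0)" using less by (simp add: c)
    ultimately show ?thesis using less by (simp add: A_def)
  qed
  show ?thesis
    by unfold_locales (use n mult one orth assms in auto)
qed

lemma sum_rotate:
  "(\<Sum>j\<in>A. \<Sum>k\<in>B. \<Sum>l\<in>C. f j k l) = (\<Sum>l\<in>C. \<Sum>j\<in>A. \<Sum>k\<in>B. f j k l)"
  by (simp only: sum.swap[of _ C B]) (rule sum.swap)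

section \<open>The character, the action on vectors and an invariant Hermitian form\<close>

context irreducible_coeffs
begin

definition \<chi> :: "'a \<Rightarrow> complex" where
  "\<chi> g = (\<Sum>i<n. r g i i)"

text \<open>A vector is any function on the natural numbers of which only the values below
  \<open>n\<close> count; hence equalities between vectors are asserted for indices below
  \<open>n\<close>, and congruence rules discard the rest.\<close>

definition act :: "'a \<Rightarrow> (nat \<Rightarrow> complex) \<Rightarrow> nat \<Rightarrow> complex" where
  "act g v i = (\<Sum>j<n. r g i j * v j)"

text \<open>Weyl's averaged Hermitian form.\<close>
definition ip :: "(nat \<Rightarrow> complex) \<Rightarrow> (nat \<Rightarrow> complex) \<Rightarrow> complex" where
  "ip v w = (\<Sum>g\<in>carrier G. \<Sum>i<n. cnj (act g v i) * act g w i)"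

lemma order_pos: "order G > 0"
  using fin order_gt_0_iff_finite by blast

lemma act_cong: "(\<And>j. j < n \<Longrightarrow> v j = w j) \<Longrightarrow> act g v = act g w"
  by (simp add: act_def fun_eq_iff)

lemma act_mult: "\<lbrakk>g \<in> carrier G; h \<in> carrier G; i < n\<rbrakk> \<Longrightarrow> act (g \<otimes> h) v i = act g (act h v) i"
proof -
  assume "g \<in> carrier G" "h \<in> carrier G" "i < n"
  then have "act (g \<otimes> h) v i = (\<Sum>j<n. \<Sum>k<n. r g i k * r h k j * v j)"
    by (simp add: act_def r_mult sum_distrib_right)
  also have "\<dots> = act g (act h v) i"
    by (subst sum.swap) (simp add: act_def sum_distrib_left mult.assoc)
  finally show ?thesis .
qed

lemma act_one: "i < n \<Longrightarrow> act \<one> v i = v i"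
  by (simp add: act_def r_one if_distrib[of "\<lambda>x. x * _"] cong: if_cong)

lemma act_scale: "act g (\<lambda>j. c * v j) i = c * act g v i"
  by (simp add: act_def sum_distrib_left mult_ac)

lemma act_sum: "act g (\<lambda>j. \<Sum>b\<in>S. f b * w b j) i = (\<Sum>b\<in>S. f b * act g (w b) i)"
  unfolding act_def sum_distrib_left by (subst sum.swap) (simp add: mult_ac)

lemma ip_cong:
  "(\<And>j. j < n \<Longrightarrow> v j = v' j) \<Longrightarrow> (\<And>j. j < n \<Longrightarrow> w j = w' j) \<Longrightarrow> ip v w = ip v' w'"
  using act_cong[of v v'] act_cong[of w w'] by (simp add: ip_def)

lemma ip_cnj: "cnj (ip v w) = ip w v"
  by (simp add: ip_def mult.commute)

lemma ip_sum_right: "ip v (\<lambda>j. \<Sum>b\<in>S. f b * w b j) = (\<Sum>b\<in>S. f b * ip v (w b))"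
proof -
  have "ip v (\<lambda>j. \<Sum>b\<in>S. f b * w b j) =
      (\<Sum>g\<in>carrier G. \<Sum>i<n. \<Sum>b\<in>S. f b * (cnj (act g v i) * act g (w b) i))"
    by (simp add: ip_def act_sum sum_distrib_left mult_ac)
  also have "\<dots> = (\<Sum>g\<in>carrier G. \<Sum>b\<in>S. \<Sum>i<n. f b * (cnj (act g v i) * act g (w b) i))"
    by (simp add: sum.swap[of _ S])
  also have "\<dots> = (\<Sum>b\<in>S. f b * ip v (w b))"
    by (subst sum.swap) (simp add: ip_def sum_distrib_left)
  finally show ?thesis .
qed

lemma ip_scale_right: "ip v (\<lambda>j. c * w j) = c * ip v w"
  by (simp add: ip_def act_scale sum_distrib_left mult_ac)

lemma ip_scale_left: "ip (\<lambda>j. c * v j) w = cnj c * ip v w"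
  by (simp add: ip_def act_scale sum_distrib_left mult_ac)

text \<open>Acting by h right-translates the average over the group, so every group element is
  unitary for this form.\<close>

lemma ip_act:
  assumes h: "h \<in> carrier G"
  shows "ip (act h v) (act h w) = ip v w"
proof -
  have "ip (act h v) (act h w) =
      (\<Sum>g\<in>carrier G. \<Sum>i<n. cnj (act (g \<otimes> h) v i) * act (g \<otimes> h) w i)"
    using h by (simp add: ip_def act_mult)
  also have "\<dots> = ip v w"
    unfolding ip_def
    by (rule group_sum_translate_right[OF is_group h, where f="\<lambda>g. \<Sum>i<n. cnj (act g v i) * act g w i"])
  finally show ?thesis .
qed

lemma ip_self: "ip v v = of_real (\<Sum>g\<in>carrier G. \<Sum>i<n. (cmod (act g v i))\<^sup>2)"
  by (simp add: ip_def complex_norm_square mult.commute del: of_real_power)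

lemma ip_self_cnj: "cnj (ip v v) = ip v v"
  by (rule ip_cnj)

lemma ip_self_nonneg: "0 \<le> Re (ip v v)" and ip_self_Im: "Im (ip v v) = 0"
  by (auto simp: ip_self intro!: sum_nonneg)

lemma ip_self_pos:
  assumes "i < n" "v i \<noteq> 0"
  shows "0 < Re (ip v v)"
proof -
  have "0 < (\<Sum>i<n. (cmod (act \<one> v i))\<^sup>2)"
    by (rule sum_pos2[of _ i]) (use assms in \<open>auto simp: act_one\<close>)
  then have "0 < (\<Sum>g\<in>carrier G. \<Sum>i<n. (cmod (act g v i))\<^sup>2)"
    by (intro sum_pos2[of _ \<one>]) (auto simp: fin intro: sum_nonneg)
  then show ?thesis by (simp add: ip_self)
qed

text \<open>Gives the linear functional \<open>ip v\<close> by its values on unit vectors, so that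
  the rank-one operator sending w to <v, w> v can be written as a matrix.\<close>

lemma ip_expand: "ip v w = (\<Sum>k<n. w k * ip v (\<lambda>i. if i = k then 1 else 0))"
proof -
  have "ip v w = ip v (\<lambda>j. \<Sum>k<n. w k * (if j = k then 1 else 0))"
    by (rule ip_cong) (auto simp: if_distrib[of "\<lambda>x. _ * x"] cong: if_cong)
  then show ?thesis by (simp add: ip_sum_right)
qed

text \<open>The orthogonality relation extended linearly from matrix units: averaging the conjugates
  of any matrix leaves a scalar proportional to its trace.\<close>

lemma sum_conj:
  assumes "i < n" "l < n"
  shows "(\<Sum>x\<in>carrier G. \<Sum>j<n. \<Sum>k<n. r x i j * M j k * r (inv x) k l) =
    (if i = l then of_nat (order G) / of_nat n * (\<Sum>j<n. M j j) else 0)"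
proof -
  have "(\<Sum>x\<in>carrier G. \<Sum>j<n. \<Sum>k<n. r x i j * M j k * r (inv x) k l) =
      (\<Sum>j<n. \<Sum>k<n. \<Sum>x\<in>carrier G. M j k * (r x i j * r (inv x) k l))"
    by (simp add: sum.swap[of _ _ "carrier G"] mult_ac)
  also have "\<dots> = (\<Sum>j<n. \<Sum>k<n. if k = j then (if i = l then M j j * (of_nat (order G) / of_nat n) else 0) else 0)"
    using assms by (intro sum.cong refl) (auto simp: orth sum_distrib_left[symmetric])
  also have "\<dots> = (if i = l then of_nat (order G) / of_nat n * (\<Sum>j<n. M j j) else 0)"
    by (simp add: sum_distrib_left mult_ac)
  finally show ?thesis .
qed

lemma sum_conj_act:
  assumes i: "i < n"
  shows "(\<Sum>x\<in>carrier G. \<Sum>j<n. \<Sum>k<n. r x i j * M j k * act (inv x) v k) =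
    of_nat (order G) / of_nat n * (\<Sum>j<n. M j j) * v i"
proof -
  have "(\<Sum>x\<in>carrier G. \<Sum>j<n. \<Sum>k<n. r x i j * M j k * act (inv x) v k) =
      (\<Sum>x\<in>carrier G. \<Sum>j<n. \<Sum>k<n. \<Sum>l<n. r x i j * M j k * r (inv x) k l * v l)"
    by (simp add: act_def sum_distrib_left mult_ac)
  also have "\<dots> = (\<Sum>x\<in>carrier G. \<Sum>l<n. \<Sum>j<n. \<Sum>k<n. r x i j * M j k * r (inv x) k l * v l)"
    by (intro sum.cong refl sum_rotate)
  also have "\<dots> = (\<Sum>l<n. (\<Sum>x\<in>carrier G. \<Sum>j<n. \<Sum>k<n. r x i j * M j k * r (inv x) k l) * v l)"
    by (subst sum.swap) (simp add: sum_distrib_right)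
  also have "\<dots> = of_nat (order G) / of_nat n * (\<Sum>j<n. M j j) * v i"
    using i by (simp add: sum_conj if_distrib[of "\<lambda>x. x * _"] cong: if_cong)
  finally show ?thesis .
qed

text \<open>The averaging identity with the matrix of g for \<open>M\<close>: a class sum acts by
  the central character.\<close>

lemma sum_act_conj:
  assumes i: "i < n" and g: "g \<in> carrier G"
  shows "(\<Sum>x\<in>carrier G. act (x \<otimes> g \<otimes> inv x) v i) = of_nat (order G) / of_nat n * \<chi> g * v i"
proof -
  have "act (x \<otimes> g \<otimes> inv x) v i = (\<Sum>j<n. \<Sum>k<n. r x i j * r g j k * act (inv x) v k)"
    if "x \<in> carrier G" for x
  proof -
    have "act (x \<otimes> g \<otimes> inv x) v i = act x (act g (act (inv x) v)) i"
      using that g i act_cong[of "act (g \<otimes> inv x) v" "act g (act (inv x) v)" x]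
      by (simp add: m_assoc act_mult)
    then show ?thesis
      by (simp add: act_def[of x] act_def[of g] sum_distrib_left mult_ac)
  qed
  then show ?thesis
    using sum_conj_act[OF i, of "r g" v] by (simp add: \<chi>_def)
qed

text \<open>Recovers \<chi> from the Hermitian form. Through this identity, unitarity and positivity
  pass to character values.\<close>

lemma sum_ip_conj:
  assumes g: "g \<in> carrier G"
  shows "(\<Sum>x\<in>carrier G. ip v (act (x \<otimes> g \<otimes> inv x) v)) = of_nat (order G) / of_nat n * \<chi> g * ip v v"
proof -
  have "(\<Sum>x\<in>carrier G. ip v (act (x \<otimes> g \<otimes> inv x) v)) =
      ip v (\<lambda>i. \<Sum>x\<in>carrier G. 1 * act (x \<otimes> g \<otimes> inv x) v i)"
    by (subst ip_sum_right) simp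
  also have "\<dots> = ip v (\<lambda>i. of_nat (order G) / of_nat n * \<chi> g * v i)"
    by (rule ip_cong) (use g in \<open>auto simp: sum_act_conj\<close>)
  finally show ?thesis by (simp only: ip_scale_right)
qed

lemma \<chi>_one: "\<chi> \<one> = of_nat n"
  by (simp add: \<chi>_def r_one)

lemma ip_unit_nz: "Re (ip (\<lambda>i. 1) (\<lambda>i. 1)) > 0"
  by (rule ip_self_pos[of 0]) (use n_pos in auto)

text \<open>For the invariant form, the adjoint of g is its inverse; hence the matrix coefficients
  at x g^-1 x^-1 and x g x^-1 are conjugate, and averaging over x turns them into character
  values.\<close>

lemma \<chi>_inv:
  assumes g: "g \<in> carrier G"
  shows "\<chi> (inv g) = cnj (\<chi> g)"
proof -
  define v :: "nat \<Rightarrow> complex" where "v = (\<lambda>i. 1)"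
  have nz: "ip v v \<noteq> 0" using ip_unit_nz by (auto simp: v_def)
  have "ip v (act (x \<otimes> inv g \<otimes> inv x) v) = cnj (ip v (act (x \<otimes> g \<otimes> inv x) v))"
    if x: "x \<in> carrier G" for x
  proof -
    define y where "y = x \<otimes> g \<otimes> inv x"
    have y: "y \<in> carrier G" and iy: "x \<otimes> inv g \<otimes> inv x = inv y"
      using x g by (auto simp: y_def inv_mult_group m_assoc)
    have "ip v (act (inv y) v) = ip (act y v) (act y (act (inv y) v))"
      using y by (simp add: ip_act)
    also have "\<dots> = ip (act y v) v"
      by (rule ip_cong) (use y in \<open>auto simp: act_mult[symmetric] act_one\<close>)
    finally show ?thesis unfolding iy y_def[symmetric] by (simp add: ip_cnj)
  qed
  then have "(\<Sum>x\<in>carrier G. ip v (act (x \<otimes> inv g \<otimes> inv x) v)) =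
      cnj (\<Sum>x\<in>carrier G. ip v (act (x \<otimes> g \<otimes> inv x) v))"
    unfolding cnj_sum by (intro sum.cong refl)
  then have "of_nat (order G) / of_nat n * \<chi> (inv g) * ip v v =
      cnj (of_nat (order G) / of_nat n * \<chi> g * ip v v)"
    by (simp only: sum_ip_conj g inv_closed)
  also have "\<dots> = of_nat (order G) / of_nat n * cnj (\<chi> g) * ip v v"
    by (simp only: complex_cnj_mult complex_cnj_divide complex_cnj_of_nat ip_self_cnj)
  finally show ?thesis using nz order_pos n_pos by simp
qed

text \<open>The idempotent property of \<chi> under convolution, with translations by b and c kept.
  The case b = c = 1 gives the norm of \<chi>, and b, c in a subgroup give the norm of its sum over
  cosets.\<close>

lemma sum_\<chi>_conv:
  assumes b: "b \<in> carrier G" and c: "c \<in> carrier G"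
  shows "(\<Sum>g\<in>carrier G. \<chi> (b \<otimes> g) * \<chi> (inv g \<otimes> c)) = of_nat (order G) / of_nat n * \<chi> (b \<otimes> c)"
proof -
  have 1: "\<chi> (b \<otimes> g) = (\<Sum>i<n. \<Sum>a<n. r b i a * r g a i)" if "g \<in> carrier G" for g
    using that b by (simp add: \<chi>_def r_mult)
  have 2: "\<chi> (inv g \<otimes> c) = (\<Sum>j<n. \<Sum>d<n. r (inv g) j d * r c d j)" if "g \<in> carrier G" for g
    using that c by (simp add: \<chi>_def r_mult)
  have "(\<Sum>g\<in>carrier G. \<chi> (b \<otimes> g) * \<chi> (inv g \<otimes> c)) =
      (\<Sum>g\<in>carrier G. \<Sum>i<n. \<Sum>a<n. \<Sum>j<n. \<Sum>d<n. r b i a * r c d j * (r g a i * r (inv g) j d))"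
    by (intro sum.cong refl, simp only: 1 2 sum_distrib_right, simp only: sum_distrib_left)
       (simp only: mult_ac)
  also have "\<dots> = (\<Sum>i<n. \<Sum>a<n. \<Sum>j<n. \<Sum>d<n. \<Sum>g\<in>carrier G. r b i a * r c d j * (r g a i * r (inv g) j d))"
    by (simp add: sum.swap[of _ _ "carrier G"])
  also have "\<dots> = (\<Sum>i<n. \<Sum>a<n. \<Sum>j<n. \<Sum>d<n. if d = a then (if j = i then
      r b i a * r c a i * (of_nat (order G) / of_nat n) else 0) else 0)"
    by (intro sum.cong refl) (auto simp: orth sum_distrib_left[symmetric])
  also have "\<dots> = of_nat (order G) / of_nat n * \<chi> (b \<otimes> c)"
    using b c by (simp add: \<chi>_def r_mult sum_distrib_left mult_ac)
  finally show ?thesis .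
qed

lemma sum_\<chi>_norm: "(\<Sum>g\<in>carrier G. (cmod (\<chi> g))\<^sup>2) = real (order G)"
proof -
  have "complex_of_real (\<Sum>g\<in>carrier G. (cmod (\<chi> g))\<^sup>2) = (\<Sum>g\<in>carrier G. \<chi> (\<one> \<otimes> g) * \<chi> (inv g \<otimes> \<one>))"
    by (simp add: \<chi>_inv complex_norm_square del: of_real_power)
  also have "\<dots> = of_nat (order G)"
    by (subst sum_\<chi>_conv) (use n_pos in \<open>auto simp: \<chi>_one\<close>)
  finally show ?thesis by (metis of_real_eq_iff of_real_of_nat_eq)
qed

lemma degree_square_le: "n\<^sup>2 \<le> order G"
proof -
  have "(cmod (\<chi> \<one>))\<^sup>2 \<le> real (order G)"
    unfolding sum_\<chi>_norm[symmetric] by (rule member_le_sum) (auto simp: fin)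
  then show ?thesis by (simp add: \<chi>_one flip: of_nat_power)
qed

text \<open>The identity contributes \<open>n\<^sup>2\<close> to the sum of \<open>|\<chi>(x)|\<^sup>2\<close>; Cauchy--Schwarz is applied to the other terms.\<close>
lemma degree_gap:
  assumes S: "S \<subseteq> carrier G" "\<one> \<in> S" and zero: "(\<Sum>x\<in>S. of_real (f x) * \<chi> x) = 0"
  shows "(f \<one> * real n)\<^sup>2 \<le> ((\<Sum>x\<in>S. (f x)\<^sup>2) - (f \<one>)\<^sup>2) * (real (order G) - (real n)\<^sup>2)"
proof -
  have finS: "finite S" using S fin finite_subset by blast
  have "of_real (f \<one>) * \<chi> \<one> = - (\<Sum>x\<in>S - {\<one>}. of_real (f x) * \<chi> x)"
    using zero finS S by (simp add: sum.remove[of S \<one>] eq_neg_iff_add_eq_0)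
  then have "cmod (of_real (f \<one>) * \<chi> \<one>) = cmod (\<Sum>x\<in>S - {\<one>}. of_real (f x) * \<chi> x)"
    by (simp only: norm_minus_cancel)
  then have "\<bar>f \<one> * real n\<bar> = cmod (\<Sum>x\<in>S - {\<one>}. of_real (f x) * \<chi> x)"
    by (simp add: \<chi>_one norm_mult abs_mult)
  also have "\<dots> \<le> (\<Sum>x\<in>S - {\<one>}. \<bar>f x\<bar> * cmod (\<chi> x))"
    by (rule order_trans[OF norm_sum]) (simp add: norm_mult)
  finally have "(f \<one> * real n)\<^sup>2 \<le> (\<Sum>x\<in>S - {\<one>}. \<bar>f x\<bar> * cmod (\<chi> x))\<^sup>2"
    by (metis abs_ge_zero power2_abs power_mono)
  also have "\<dots> \<le> (\<Sum>x\<in>S - {\<one>}. \<bar>f x\<bar>\<^sup>2) * (\<Sum>x\<in>S - {\<one>}. (cmod (\<chi> x))\<^sup>2)"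
    by (rule Cauchy_Schwarz_ineq_sum)
  also have "\<dots> \<le> (\<Sum>x\<in>S - {\<one>}. \<bar>f x\<bar>\<^sup>2) * (\<Sum>x\<in>carrier G - {\<one>}. (cmod (\<chi> x))\<^sup>2)"
    using S fin by (intro mult_left_mono sum_mono2 sum_nonneg) auto
  also have "\<dots> = ((\<Sum>x\<in>S. (f x)\<^sup>2) - (f \<one>)\<^sup>2) * (real (order G) - (real n)\<^sup>2)"
    using finS S fin by (simp add: sum_diff1 sum_\<chi>_norm \<chi>_one)
  finally show ?thesis .
qed

text \<open>The matrix coefficient of an eigenvector of \<open>B\<close> has constant absolute value on \<open>B\<close>.\<close>
lemma degree_le_eigenvector:
  assumes B: "B \<subseteq> carrier G" and v: "i0 < n" "v i0 \<noteq> 0"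
    and eig: "\<And>b. b \<in> B \<Longrightarrow> \<exists>c. \<forall>i<n. act b v i = c * v i"
  shows "n * card B \<le> order G"
proof -
  define s where "s = Re (ip v v)"
  have s: "s > 0" "ip v v = of_real s"
    using ip_self_pos[of i0 v] v ip_self_Im[of v] by (auto simp: s_def complex_eq_iff)
  \<comment> \<open>The matrix of the rank-one operator sending w to <v, w> v; its trace is <v,
    v>.\<close>
  define M where "M j k = v j * ip v (\<lambda>i. if i = k then 1 else 0)" for j k
  have act_M: "(\<Sum>j<n. \<Sum>k<n. r x i j * M j k * w k) = ip v w * act x v i" for x w i
    by (simp add: M_def ip_expand[of v w] act_def sum_distrib_left sum_distrib_right mult_ac)
       (rule sum.swap)
  have trM: "(\<Sum>j<n. M j j) = ip v v"
    by (simp add: M_def ip_expand[of v v])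
  \<comment> \<open>Each x \<open>M\<close> x^-1 maps v to <v, x^-1 v> x v, so averaging these
    operators at v and pairing with v evaluates the sum of squared coefficients.\<close>
  have "of_real (\<Sum>x\<in>carrier G. (cmod (ip v (act x v)))\<^sup>2) =
      (\<Sum>x\<in>carrier G. ip v (act (inv x) v) * ip v (act x v))"
  proof -
    have "ip v (act (inv x) v) = cnj (ip v (act x v))" if x: "x \<in> carrier G" for x
    proof -
      have "ip v (act (inv x) v) = ip (act x v) (act x (act (inv x) v))"
        using x by (simp add: ip_act)
      also have "\<dots> = ip (act x v) v"
        by (rule ip_cong) (use x in \<open>auto simp: act_mult[symmetric] act_one\<close>)
      finally show ?thesis by (simp add: ip_cnj)
    qed
    then show ?thesis by (simp add: complex_norm_square mult.commute del: of_real_power)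
  qed
  also have "\<dots> = ip v (\<lambda>i. \<Sum>x\<in>carrier G. ip v (act (inv x) v) * act x v i)"
    by (simp add: ip_sum_right)
  also have "\<dots> = ip v (\<lambda>i. of_nat (order G) / of_nat n * ip v v * v i)"
    by (rule ip_cong) (auto simp: sum_conj_act[where M=M, unfolded trM act_M])
  also have "\<dots> = of_real (real (order G) / real n * s\<^sup>2)"
    by (simp only: ip_scale_right) (simp add: s(2) power2_eq_square)
  finally have sum: "(\<Sum>x\<in>carrier G. (cmod (ip v (act x v)))\<^sup>2) = real (order G) / real n * s\<^sup>2"
    using of_real_eq_iff by blast
  \<comment> \<open>Invariance of the form forces the eigenvalue of b to have absolute value
    1.\<close>
  have "(cmod (ip v (act b v)))\<^sup>2 = s\<^sup>2" if b: "b \<in> B" for b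
  proof -
    obtain c where c: "\<And>i. i < n \<Longrightarrow> act b v i = c * v i" using eig[OF b] by auto
    have "ip v v = ip (act b v) (act b v)" using b B by (auto simp: ip_act)
    also have "\<dots> = ip (\<lambda>i. c * v i) (\<lambda>i. c * v i)" by (rule ip_cong) (auto simp: c)
    also have "\<dots> = of_real ((cmod c)\<^sup>2) * ip v v"
      by (simp add: ip_scale_left ip_scale_right complex_norm_square del: of_real_power)
    finally have "(cmod c)\<^sup>2 = 1" using s by (simp flip: of_real_mult of_real_power)
    moreover have "ip v (act b v) = c * ip v v"
      using ip_cong[of v v "act b v" "\<lambda>i. c * v i"] by (simp add: c ip_scale_right)
    ultimately show ?thesis by (simp add: s norm_mult power_mult_distrib)
  qed
  then have "real (card B) * s\<^sup>2 = (\<Sum>x\<in>B. (cmod (ip v (act x v)))\<^sup>2)" by simp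
  also have "\<dots> \<le> real (order G) / real n * s\<^sup>2"
    unfolding sum[symmetric] by (rule sum_mono2) (use B fin in auto)
  finally have "real (card B) \<le> real (order G) / real n"
    by (rule mult_right_le_imp_le) (use s in simp)
  then have "real (n * card B) \<le> real (order G)" using n_pos by (simp add: field_simps)
  then show ?thesis by linarith
qed

end

section \<open>Fixed vectors and eigenvectors of subgroups\<close>

context irreducible_coeffs
begin

text \<open>The trace \<open>m\<close> of the projection to the fixed vectors of \<open>B\<close> satisfies \<open>n m \<le> |G : B|\<close>
  (by orthogonality) and \<open>n |K| \<le> m |G|\<close> (the conjugates of the projection are positive
  semidefinite).\<close>
lemma degree_sq_le_fixed_vector:
  assumes B: "subgroup B G" and v: "i0 < n" "v i0 \<noteq> 0"
    and fixed: "\<And>b i. b \<in> B \<Longrightarrow> i < n \<Longrightarrow> act b v i = v i"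
    and K: "K \<subseteq> carrier G" "\<And>g b. g \<in> K \<Longrightarrow> b \<in> B \<Longrightarrow> g \<otimes> b \<otimes> inv g \<in> B"
  shows "n\<^sup>2 * (card B * card K) \<le> (order G)\<^sup>2"
proof -
  have BG: "b \<in> carrier G" if "b \<in> B" for b using subgroup.mem_carrier[OF B that] .
  have BcG: "B \<subseteq> carrier G" using BG by blast
  have finB: "finite B" using BcG fin finite_subset by blast
  have B_pos: "card B > 0" using finB subgroup.one_closed[OF B] by (auto simp: card_gt_0_iff)
  have B_inv: "inv b \<in> B" if "b \<in> B" for b using subgroup.m_inv_closed[OF B that] .
  have B_mult: "b \<otimes> c \<in> B" if "b \<in> B" "c \<in> B" for b c using subgroup.m_closed[OF B that] .
  have shift_right: "(\<Sum>b\<in>B. f (b \<otimes> c)) = (\<Sum>b\<in>B. f b)" if "c \<in> B" for c and f :: "'a \<Rightarrow> complex"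
    by (rule sum.reindex_bij_witness[where i="\<lambda>b. b \<otimes> inv c" and j="\<lambda>b. b \<otimes> c"])
       (use that BG B_inv B_mult in \<open>auto simp: m_assoc\<close>)
  have shift_left: "(\<Sum>b\<in>B. f (c \<otimes> b)) = (\<Sum>b\<in>B. f b)" if "c \<in> B" for c and f :: "'a \<Rightarrow> complex"
    by (rule sum.reindex_bij_witness[where i="\<lambda>b. inv c \<otimes> b" and j="\<lambda>b. c \<otimes> b"])
       (use that BG B_inv B_mult in \<open>auto simp: m_assoc[symmetric]\<close>)
  have invert: "(\<Sum>b\<in>B. f (inv b)) = (\<Sum>b\<in>B. f b)" for f :: "'a \<Rightarrow> complex"
    by (rule sum.reindex_bij_witness[where i="\<lambda>b. inv b" and j="\<lambda>b. inv b"])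
       (use BG B_inv in auto)
  \<comment> \<open>\<open>t\<close> is |B| m, with m the trace of the projection to the vectors
    fixed by B. The bounds below are stated for this multiple, with \<open>M\<close> its real
    part.\<close>
  define t where "t = (\<Sum>b\<in>B. \<chi> b)"
  define \<theta> where "\<theta> g = (\<Sum>b\<in>B. \<chi> (b \<otimes> g))" for g
  have "cnj t = (\<Sum>b\<in>B. \<chi> (inv b))" by (simp add: t_def BG \<chi>_inv)
  then have t_cnj: "cnj t = t" by (simp only: invert t_def)
  define M where "M = Re t"
  have tM: "t = of_real M" using t_cnj by (simp add: M_def complex_eq_iff)
  have \<theta>_B: "\<theta> c = t" if "c \<in> B" for c
    unfolding \<theta>_def t_def by (rule shift_right[OF that])
  have \<theta>_cnj: "cnj (\<theta> g) = (\<Sum>c\<in>B. \<chi> (inv g \<otimes> c))" if g: "g \<in> carrier G" for g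
  proof -
    have "cnj (\<theta> g) = (\<Sum>c\<in>B. \<chi> (inv g \<otimes> inv c))"
      unfolding \<theta>_def cnj_sum
      by (intro sum.cong refl) (use g BG in \<open>simp add: \<chi>_inv[symmetric] inv_mult_group\<close>)
    then show ?thesis by (simp only: invert[where f="\<lambda>c. \<chi> (inv g \<otimes> c)"])
  qed
  \<comment> \<open>Expanding the square leaves, for each pair b, c, a convolution of \<chi> with
    itself, equal to a multiple of \<chi>(b c).\<close>
  have "of_real (\<Sum>g\<in>carrier G. (cmod (\<theta> g))\<^sup>2) =
      (\<Sum>g\<in>carrier G. \<Sum>b\<in>B. \<Sum>c\<in>B. \<chi> (b \<otimes> g) * \<chi> (inv g \<otimes> c))"
    by (simp add: complex_norm_square \<theta>_cnj del: of_real_power) (simp add: \<theta>_def sum_product)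
  also have "\<dots> = (\<Sum>b\<in>B. \<Sum>c\<in>B. \<Sum>g\<in>carrier G. \<chi> (b \<otimes> g) * \<chi> (inv g \<otimes> c))"
    by (simp only: sum.swap[of _ _ "carrier G"])
  also have "\<dots> = (\<Sum>b\<in>B. \<Sum>c\<in>B. of_nat (order G) / of_nat n * \<chi> (b \<otimes> c))"
    by (intro sum.cong refl sum_\<chi>_conv BG)
  also have "\<dots> = (\<Sum>b\<in>B. of_nat (order G) / of_nat n * t)"
    unfolding sum_distrib_left[symmetric] t_def
    by (intro sum.cong refl arg_cong2[where f="(*)"] shift_left)
  also have "\<dots> = of_real (real (order G) / real n * M * real (card B))"
    by (simp add: tM)
  finally have sum_\<theta>: "(\<Sum>g\<in>carrier G. (cmod (\<theta> g))\<^sup>2) = real (order G) / real n * M * real (card B)"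
    using of_real_eq_iff by blast
  \<comment> \<open>\<theta> is constant on B; keeping only these terms of its norm gives n M \<le>
    |G| when M is positive.\<close>
  have "real (card B) * M\<^sup>2 = (\<Sum>g\<in>B. (cmod (\<theta> g))\<^sup>2)"
    by (simp add: \<theta>_B tM)
  also have "\<dots> \<le> (\<Sum>g\<in>carrier G. (cmod (\<theta> g))\<^sup>2)"
    by (rule sum_mono2) (use BcG fin in auto)
  finally have "real (card B) * (M\<^sup>2 * real n) \<le> real (card B) * (real (order G) * M)"
    unfolding sum_\<theta> using n_pos by (simp add: field_simps)
  then have upper: "M\<^sup>2 * real n \<le> real (order G) * M"
    using B_pos by simp

  define s where "s = Re (ip v v)"
  have s: "s > 0" "ip v v = of_real s"
    using ip_self_pos[of i0 v] v ip_self_Im[of v] by (auto simp: s_def complex_eq_iff)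
  \<comment> \<open>\<Psi>(g) is |B| times <v, g e g^-1 v>, where e is the projection to the vectors
    fixed by B.\<close>
  define \<Psi> where "\<Psi> g = (\<Sum>b\<in>B. ip v (act (g \<otimes> b \<otimes> inv g) v))" for g
  have \<Psi>_nonneg: "0 \<le> Re (\<Psi> g)" if g: "g \<in> carrier G" for g
  proof -
    define w where "w = act (inv g) v"
    define u where "u = (\<lambda>i. \<Sum>b\<in>B. 1 * act b w i)"
    have "ip v (act (g \<otimes> b \<otimes> inv g) v) = ip w (act b w)" if b: "b \<in> B" for b
    proof -
      have "ip v (act (g \<otimes> b \<otimes> inv g) v) = ip w (act (inv g) (act (g \<otimes> b \<otimes> inv g) v))"
        unfolding w_def using g by (simp add: ip_act)
      also have "\<dots> = ip w (act b w)"
        by (rule ip_cong)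
           (use g BG[OF b] in \<open>auto simp: w_def act_mult[symmetric] m_assoc[symmetric]\<close>)
      finally show ?thesis .
    qed
    then have \<Psi>g: "\<Psi> g = ip w u" unfolding \<Psi>_def u_def ip_sum_right by simp
    have cu: "act c u i = u i" if c: "c \<in> B" and i: "i < n" for c i
    proof -
      have "act c u i = (\<Sum>b\<in>B. act (c \<otimes> b) w i)"
        unfolding u_def act_sum using c i BG by (simp add: act_mult)
      also have "\<dots> = u i" unfolding u_def mult_1 by (rule shift_left[OF c])
      finally show ?thesis .
    qed
    \<comment> \<open>The projection is self-adjoint and idempotent, so pairing w with its image
      gives a positive multiple of the squared norm of that image.\<close>
    have "of_nat (card B) * ip w u = (\<Sum>c\<in>B. ip (act c w) (act c u))"
      using BG by (simp add: ip_act)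
    also have "\<dots> = (\<Sum>c\<in>B. ip (act c w) u)"
      by (intro sum.cong refl ip_cong) (auto simp: cu)
    also have "\<dots> = cnj (\<Sum>c\<in>B. 1 * ip u (act c w))"
      by (simp add: ip_cnj)
    also have "\<dots> = ip u u"
      by (simp only: ip_sum_right[symmetric] u_def[symmetric] ip_self_cnj)
    finally have "real (card B) * Re (\<Psi> g) = Re (ip u u)"
      by (simp add: \<Psi>g complex_eq_iff)
    then have "0 \<le> real (card B) * Re (\<Psi> g)" using ip_self_nonneg[of u] by simp
    then show ?thesis using B_pos by (simp add: zero_le_mult_iff)
  qed
  have \<Psi>_K: "Re (\<Psi> g) = real (card B) * s" if g: "g \<in> K" for g
  proof -
    have "ip v (act (g \<otimes> b \<otimes> inv g) v) = ip v v" if b: "b \<in> B" for b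
      by (rule ip_cong) (use fixed K(2)[OF g b] in auto)
    then show ?thesis by (simp add: \<Psi>_def s)
  qed
  have "(\<Sum>g\<in>carrier G. \<Psi> g) = (\<Sum>b\<in>B. of_nat (order G) / of_nat n * \<chi> b * ip v v)"
    unfolding \<Psi>_def by (subst sum.swap) (intro sum.cong refl sum_ip_conj BG)
  also have "\<dots> = of_real (real (order G) / real n * M * s)"
    unfolding sum_distrib_left[symmetric] sum_distrib_right[symmetric] t_def[symmetric]
    by (simp add: s tM)
  finally have "real (order G) / real n * M * s = (\<Sum>g\<in>carrier G. Re (\<Psi> g))"
    by (metis Re_complex_of_real Re_sum)
  moreover have "(\<Sum>g\<in>K. Re (\<Psi> g)) \<le> (\<Sum>g\<in>carrier G. Re (\<Psi> g))"
    by (rule sum_mono2) (use K fin \<Psi>_nonneg in auto)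
  moreover have "(\<Sum>g\<in>K. Re (\<Psi> g)) = real (card K) * real (card B) * s"
    by (simp add: \<Psi>_K)
  ultimately have "(real (card K) * real (card B)) * s \<le> (real (order G) / real n * M) * s"
    by linarith
  then have "real (card K) * real (card B) \<le> real (order G) / real n * M"
    by (rule mult_right_le_imp_le) (use s in simp)
  then have lower: "real n * (real (card B) * real (card K)) \<le> real (order G) * M"
    using n_pos by (simp add: pos_le_divide_eq mult_ac)
  have "(real n)\<^sup>2 * (real (card B) * real (card K)) \<le> (real (order G))\<^sup>2"
  \<comment> \<open>Cancelling M in \<open>upper\<close> needs M > 0; otherwise \<open>lower\<close>
    makes the left-hand side at most 0.\<close>
  proof (cases "M > 0")
    case True
    have nM: "M * real n \<le> real (order G)"
    proof (rule mult_left_le_imp_le)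
      show "M * (M * real n) \<le> M * real (order G)"
        using upper by (simp add: power2_eq_square mult_ac)
    qed fact
    have "real n * (real n * (real (card B) * real (card K))) \<le> real n * (real (order G) * M)"
      using lower by (intro mult_left_mono) auto
    also have "\<dots> \<le> real (order G) * real (order G)"
      using mult_left_mono[OF nM, of "real (order G)"] by (simp add: mult_ac)
    finally show ?thesis by (simp add: power2_eq_square mult_ac)
  next
    case False
    then have "real (order G) * M \<le> 0" by (simp add: mult_nonneg_nonpos)
    then have "real n * (real (card B) * real (card K)) \<le> 0" using lower by linarith
    then have "real (card B) * real (card K) \<le> 0" using n_pos by (simp add: mult_le_0_iff)
    then have "(real n)\<^sup>2 * (real (card B) * real (card K)) \<le> 0"
      by (rule mult_nonneg_nonpos[rotated]) simp
    then show ?thesis by (rule order_trans) simp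
  qed
  then have "real (n\<^sup>2 * (card B * card K)) \<le> real ((order G)\<^sup>2)" by simp
  then show ?thesis using of_nat_le_iff by blast
qed

text \<open>For 0 < k < m this is a geometric sum whose ratio is an m-th root of unity other than 1.
  It serves to isolate the term of index 0 in a discrete Fourier transform.\<close>

lemma root_of_unity_power_sum:
  assumes "k < m"
  shows "(\<Sum>j<m. cis (2 * pi * real j / real m) ^ k) = (if k = 0 then of_nat m else 0)"
proof (cases "k = 0")
  case False
  define z where "z j = cis (2 * pi * real j / real m)" for j
  have inj: "inj_on z {..<m}"
    using bij_betw_roots_unity[of m] assms by (auto simp: bij_betw_def z_def[abs_def])
  have "z k \<noteq> z 0" using inj_onD[OF inj, of k 0] assms False by auto
  then have "z k \<noteq> 1" by (simp add: z_def)
  moreover have "z k ^ m = 1" using assms by (simp add: z_def DeMoivre cis_multiple_2pi)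
  moreover have "z j ^ k = z k ^ j" for j by (simp add: z_def DeMoivre mult_ac)
  ultimately show ?thesis using False by (simp add: z_def[symmetric] geometric_sum)
qed simp

text \<open>Commutators of B lie in U, so B acts on the vectors fixed by U through commuting
  operators of finite order. Elements of B are adjoined one at a time, and a common eigenvector is
  projected to an eigencomponent of the new element.\<close>

lemma eigenvector_exists:
  assumes B: "subgroup B G" and U: "U \<subseteq> B"
    and comm: "\<And>a b. a \<in> B \<Longrightarrow> b \<in> B \<Longrightarrow> inv a \<otimes> inv b \<otimes> a \<otimes> b \<in> U"
    and v: "i0 < n" "v i0 \<noteq> 0"
    and fixed: "\<And>u i. u \<in> U \<Longrightarrow> i < n \<Longrightarrow> act u v i = v i"
  shows "\<exists>w i1. i1 < n \<and> w i1 \<noteq> 0 \<and> (\<forall>b\<in>B. \<exists>c. \<forall>i<n. act b w i = c * w i)"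
proof -
  have BG: "b \<in> carrier G" if "b \<in> B" for b using subgroup.mem_carrier[OF B that] .
  have finB: "finite B" using BG fin finite_subset[of B "carrier G"] by blast
  define Q where "Q S \<gamma> w \<longleftrightarrow> (\<forall>u\<in>U. \<forall>i<n. act u w i = w i) \<and> (\<forall>s\<in>S. \<forall>i<n. act s w i = \<gamma> s * w i)"
    for S :: "'a set" and \<gamma> :: "'a \<Rightarrow> complex" and w
  \<comment> \<open>a b equals b a u with u in U, and u fixes w.\<close>
  have swap: "act a (act b w) i = act b (act a w) i"
    if "a \<in> B" "b \<in> B" "Q S \<gamma> w" "i < n" for a b w i S \<gamma>
  proof -
    define u where "u = inv a \<otimes> inv b \<otimes> a \<otimes> b"
    have u: "u \<in> U" "u \<in> carrier G" using that comm U BG by (auto simp: u_def)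
    have ab: "a \<in> carrier G" "b \<in> carrier G" using that BG by auto
    have "b \<otimes> a \<otimes> u = b \<otimes> (a \<otimes> inv a) \<otimes> inv b \<otimes> (a \<otimes> b)"
      using ab by (simp only: u_def m_assoc inv_closed m_closed)
    also have "\<dots> = a \<otimes> b" using ab by simp
    finally have "act a (act b w) i = act (b \<otimes> a \<otimes> u) w i"
      using ab that by (simp add: act_mult)
    also have "\<dots> = act (b \<otimes> a) (act u w) i"
      using ab u that by (simp add: act_mult)
    also have "\<dots> = act (b \<otimes> a) w i"
      using act_cong[of "act u w" w "b \<otimes> a"] u that(3) by (simp add: Q_def)
    finally show ?thesis using ab that by (simp add: act_mult)
  qed
  have Q_act: "Q S \<gamma> (act b w)" if "b \<in> B" "S \<subseteq> B" "Q S \<gamma> w" for b S \<gamma> w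
    unfolding Q_def
  proof (intro conjI ballI allI impI)
    fix u i assume u: "u \<in> U" and i: "i < n"
    have "act u (act b w) i = act b (act u w) i" using swap u U that i by blast
    also have "\<dots> = act b w i"
      using act_cong[of "act u w" w b] u that(3) by (simp add: Q_def)
    finally show "act u (act b w) i = act b w i" .
  next
    fix s i assume s: "s \<in> S" and i: "i < n"
    have "act s (act b w) i = act b (act s w) i" using swap s that i by blast
    also have "\<dots> = act b (\<lambda>j. \<gamma> s * w j) i"
      using act_cong[of "act s w" "\<lambda>j. \<gamma> s * w j" b] s that(3) by (simp add: Q_def)
    finally show "act s (act b w) i = \<gamma> s * act b w i" by (simp add: act_scale)
  qed
  have "\<exists>w i1 \<gamma>. i1 < n \<and> w i1 \<noteq> 0 \<and> Q S \<gamma> w" if "S \<subseteq> B" "finite S" for S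
    using that(2,1)
  proof (induction S rule: finite_induct)
    case empty
    then show ?case using v fixed by (intro exI[of _ v] exI[of _ i0]) (auto simp: Q_def)
  next
    case (insert b S)
    then obtain w i1 \<gamma> where w: "i1 < n" "w i1 \<noteq> 0" "Q S \<gamma> w" by auto
    have b: "b \<in> B" "b \<in> carrier G" and S: "S \<subseteq> B" using insert.prems BG by auto
    define m where "m = order G"
    have m: "m > 0" "b [^] m = \<one>" using order_pos b pow_order_eq_1 by (auto simp: m_def)
    define w' where "w' k = act (b [^] k) w" for k :: nat
    have bk: "b [^] k \<in> B" for k :: nat
      using b subgroup.m_closed[OF B] subgroup.one_closed[OF B] by (induction k) auto
    have bk_comm: "b \<otimes> b [^] k = b [^] k \<otimes> b" for k :: nat
      using nat_pow_Suc2[OF b(2), of k] by simp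
    have Qk: "Q S \<gamma> (w' k)" for k unfolding w'_def by (rule Q_act[OF bk S w(3)])
    define z where "z j = cis (2 * pi * real j / real m)" for j
    \<comment> \<open>Up to the factor m, \<open>y j\<close> is the component of w on which b acts
      as the inverse of \<open>z j\<close>.\<close>
    define y where "y j = (\<lambda>i. \<Sum>k<m. z j ^ k * w' k i)" for j
    \<comment> \<open>The components add up to m w, so one of them is nonzero at
      \<open>i1\<close>.\<close>
    have "(\<Sum>j<m. y j i1) = (\<Sum>k<m. (\<Sum>j<m. z j ^ k) * w' k i1)"
      unfolding y_def by (subst sum.swap) (simp add: sum_distrib_right)
    also have "\<dots> = (\<Sum>k<m. if k = 0 then of_nat m * w' 0 i1 else 0)"
      by (intro sum.cong refl) (simp add: z_def root_of_unity_power_sum)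
    also have "\<dots> = of_nat m * w i1" using m w by (simp add: w'_def act_one)
    finally have "(\<Sum>j<m. y j i1) \<noteq> 0" using m w by simp
    then obtain j where j: "y j i1 \<noteq> 0" by (meson sum.neutral)
    have z1: "z j ^ m = 1" using m by (simp add: z_def DeMoivre cis_multiple_2pi)
    then have z0: "z j \<noteq> 0" using m by (auto simp: power_0_left)
    have "Q S \<gamma> (y j)"
      using Qk unfolding Q_def y_def act_sum by (simp add: sum_distrib_left mult_ac)
    moreover have "act b (y j) i = inverse (z j) * y j i" if i: "i < n" for i
    proof -
      have "z j * act b (y j) i = (\<Sum>k<m. z j ^ Suc k * w' (Suc k) i)"
        unfolding y_def act_sum sum_distrib_left using b i
        by (intro sum.cong refl) (simp add: w'_def act_mult[symmetric] bk_comm mult_ac)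
      \<comment> \<open>The shift trades the term k = 0 for k = m, and both equal w because b and
        \<open>z j\<close> have m-th power 1.\<close>
      also have "\<dots> = (\<Sum>k<Suc m. z j ^ k * w' k i) - w' 0 i"
        by (subst sum.lessThan_Suc_shift) simp
      also have "\<dots> = y j i" using m z1 i by (simp add: y_def w'_def act_one)
      finally show ?thesis using z0 by (simp add: field_simps)
    qed
    ultimately have "Q (insert b S) (\<gamma>(b := inverse (z j))) (y j)"
      using insert.hyps by (auto simp: Q_def)
    then show ?case using j w(1) by blast
  qed
  from this[OF order_refl finB] show ?thesis unfolding Q_def by blast
qed

end

section \<open>Borel subgroups in direct powers\<close>

lemma (in group) inv_cancel_left:
  assumes "x \<in> carrier G" "y \<in> carrier G"
  shows "y \<otimes> (inv y \<otimes> x) = x" "inv y \<otimes> (y \<otimes> x) = x"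
  using assms by (simp_all add: m_assoc[symmetric])

text \<open>The facts about PSL_2(q) on which the character argument rests, with B a Borel subgroup
  and U its unipotent radical. Orders are doubled to avoid halving natural numbers.
  \<open>B_meet\<close> reflects that two Borel subgroups share a torus of order (q-1)/2, and
  \<open>U_meet\<close> that distinct conjugates of U meet trivially.\<close>

locale borel_pair = group P for P :: "('b, 'd) monoid_scheme" (structure) +
  fixes B U :: "'b set" and q :: nat
  assumes finite_P: "finite (carrier P)" and q_ge: "q \<ge> 5"
    and B_sub: "subgroup B P" and U_sub: "subgroup U P" and U_B: "U \<subseteq> B"
    and card_U: "card U = q" and card_B: "2 * card B = q * (q - 1)"
    and card_P: "2 * card (carrier P) = q * (q - 1) * (q + 1)"
    and comm: "\<lbrakk>a \<in> B; b \<in> B\<rbrakk> \<Longrightarrow> inv a \<otimes> inv b \<otimes> a \<otimes> b \<in> U"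
    and B_meet: "\<lbrakk>x \<in> carrier P; x \<notin> B\<rbrakk> \<Longrightarrow> 2 * card {b \<in> B. inv x \<otimes> b \<otimes> x \<in> B} \<le> q - 1"
    and U_meet: "\<lbrakk>x \<in> carrier P; x \<notin> B; u \<in> U; inv x \<otimes> u \<otimes> x \<in> U\<rbrakk> \<Longrightarrow> u = \<one>"
begin

text \<open>For a subgroup H this is |H| times the permutation character on the cosets of H.\<close>

definition conj_count :: "'b set \<Rightarrow> 'b \<Rightarrow> real" where
  "conj_count H x = real (card {y \<in> carrier P. inv y \<otimes> x \<otimes> y \<in> H})"

lemma conj_count_sum: "conj_count H x = (\<Sum>y\<in>carrier P. indicator H (inv y \<otimes> x \<otimes> y))"
  using finite_P by (simp add: conj_count_def indicator_def Int_def sum.If_cases)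

text \<open>For fixed y, the substitution x = y b y^-1 runs over H. The weight \<open>f\<close>
  allows one identity to serve for both the first and the second moment of
  \<open>conj_count\<close>.\<close>

lemma sum_conj_count_weighted:
  assumes H: "H \<subseteq> carrier P"
  shows "(\<Sum>x\<in>carrier P. \<Sum>y\<in>carrier P. indicator H (inv y \<otimes> x \<otimes> y) * f x y) =
    (\<Sum>y\<in>carrier P. \<Sum>b\<in>H. (f (y \<otimes> b \<otimes> inv y) y :: real))"
proof -
  have "(\<Sum>x\<in>carrier P. indicator H (inv y \<otimes> x \<otimes> y) * f x y) = (\<Sum>b\<in>H. f (y \<otimes> b \<otimes> inv y) y)"
    if y: "y \<in> carrier P" for y
  proof -
    have "(\<Sum>x\<in>carrier P. indicator H (inv y \<otimes> x \<otimes> y) * f x y) =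
        (\<Sum>x\<in>{x \<in> carrier P. inv y \<otimes> x \<otimes> y \<in> H}. f x y)"
      using finite_P by (intro sum.mono_neutral_cong_right) (auto simp: indicator_def)
    also have "\<dots> = (\<Sum>b\<in>H. f (y \<otimes> b \<otimes> inv y) y)"
      by (rule sum.reindex_bij_witness[where i="\<lambda>b. y \<otimes> b \<otimes> inv y" and j="\<lambda>x. inv y \<otimes> x \<otimes> y"])
         (use y H in \<open>auto simp: m_assoc inv_cancel_left subset_iff\<close>)
    finally show ?thesis .
  qed
  then show ?thesis by (subst sum.swap) simp
qed

lemma sum_conj_count:
  assumes "H \<subseteq> carrier P"
  shows "(\<Sum>x\<in>carrier P. conj_count H x) = real (card (carrier P)) * real (card H)"
  using sum_conj_count_weighted[OF assms, of "\<lambda>_ _. 1"] by (simp add: conj_count_sum)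

text \<open>One factor is expanded, and the other is constant on conjugacy classes and may be
  evaluated at b in H. What remains counts intersections of H with its conjugates, as in Mackey's
  formula.\<close>

lemma sum_conj_count_sq:
  assumes H: "H \<subseteq> carrier P"
  shows "(\<Sum>x\<in>carrier P. (conj_count H x)\<^sup>2) =
    real (card (carrier P)) * (\<Sum>w\<in>carrier P. real (card {b \<in> H. inv w \<otimes> b \<otimes> w \<in> H}))"
proof -
  have finH: "finite H" using H finite_P finite_subset by blast
  have "(\<Sum>x\<in>carrier P. (conj_count H x)\<^sup>2) =
      (\<Sum>x\<in>carrier P. \<Sum>y\<in>carrier P. indicator H (inv y \<otimes> x \<otimes> y) * conj_count H x)"
    by (simp add: power2_eq_square conj_count_sum sum_distrib_right)
  also have "\<dots> = (\<Sum>y\<in>carrier P. \<Sum>b\<in>H. conj_count H (y \<otimes> b \<otimes> inv y))"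
    by (rule sum_conj_count_weighted[OF H])
  also have "\<dots> = (\<Sum>y\<in>carrier P. \<Sum>b\<in>H. conj_count H b)"
  proof (intro sum.cong refl)
    fix y b assume y: "y \<in> carrier P" and "b \<in> H"
    then have b: "b \<in> carrier P" using H by blast
    have "conj_count H (y \<otimes> b \<otimes> inv y) =
        (\<Sum>z\<in>carrier P. indicator H (inv (inv y \<otimes> z) \<otimes> b \<otimes> (inv y \<otimes> z)))"
      unfolding conj_count_sum
      by (intro sum.cong refl) (use y b in \<open>simp add: inv_mult_group m_assoc\<close>)
    also have "\<dots> = conj_count H b"
      unfolding conj_count_sum
      by (rule group_sum_translate_left[OF is_group, where f="\<lambda>z. indicator H (inv z \<otimes> b \<otimes> z)"])
         (use y in simp)
    finally show "conj_count H (y \<otimes> b \<otimes> inv y) = conj_count H b" .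
  qed
  also have "(\<Sum>b\<in>H. conj_count H b) = (\<Sum>w\<in>carrier P. real (card {b \<in> H. inv w \<otimes> b \<otimes> w \<in> H}))"
    unfolding conj_count_sum
    by (subst sum.swap) (use finH in \<open>simp add: indicator_def Int_def sum.If_cases\<close>)
  finally show ?thesis by simp
qed

lemma B_carrier: "B \<subseteq> carrier P"
  using subgroup.subset[OF B_sub] .

lemma U_carrier: "U \<subseteq> carrier P"
  using subgroup.subset[OF U_sub] .

lemma finite_B: "finite B"
  using B_carrier finite_P finite_subset by blast

lemma finite_U: "finite U"
  using U_carrier finite_P finite_subset by blast

lemma real_card_B: "real (card B) = real q * (real q - 1) / 2"
proof -
  have "real (2 * card B) = real (q * (q - 1))" by (simp only: card_B)
  then show ?thesis using q_ge by (simp add: of_nat_diff)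
qed

lemma card_B_pos: "real (card B) > 0"
  using q_ge by (simp add: real_card_B)

lemma real_card_P: "real (card (carrier P)) = real (card B) * (real q + 1)"
proof -
  have "real (2 * card (carrier P)) = real (q * (q - 1) * (q + 1))" by (simp only: card_P)
  then show ?thesis using q_ge by (simp add: of_nat_diff real_card_B algebra_simps)
qed

text \<open>The Steinberg character: one less than the number of Borel subgroups containing \<open>x\<close>.\<close>
definition st :: "'b \<Rightarrow> real" where
  "st x = conj_count B x / real (card B) - 1"

text \<open>The number of conjugates of \<open>U\<close> that contain \<open>x\<close>: each is counted \<open>card B\<close> times in \<open>conj_count\<close>.\<close>
definition unip :: "'b \<Rightarrow> real" where
  "unip x = conj_count U x / real (card B)"

lemma conj_count_one: "subgroup H P \<Longrightarrow> conj_count H \<one> = real (card (carrier P))"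
proof -
  assume "subgroup H P"
  then have "{y \<in> carrier P. inv y \<otimes> \<one> \<otimes> y \<in> H} = carrier P"
    using subgroup.one_closed by auto
  then show ?thesis by (simp add: conj_count_def)
qed

lemma st_one: "st \<one> = real q"
  using card_B_pos by (simp add: st_def conj_count_one[OF B_sub] real_card_P)

lemma unip_one: "unip \<one> = real q + 1"
  using card_B_pos by (simp add: unip_def conj_count_one[OF U_sub] real_card_P)

lemma sum_split_B:
  "(\<Sum>w\<in>carrier P. f w) = (\<Sum>w\<in>B. f w) + (\<Sum>w\<in>carrier P - B. f w :: real)"
  using sum.subset_diff[OF B_carrier finite_P, of f] by simp

lemma card_P_minus_B: "real (card (carrier P - B)) = real (card B) * real q"
proof -
  have "card B \<le> card (carrier P)" by (rule card_mono[OF finite_P B_carrier])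
  then show ?thesis
    by (simp add: card_Diff_subset[OF finite_B B_carrier] of_nat_diff real_card_P algebra_simps)
qed

text \<open>The permutation character on Borel subgroups has norm at most 2, one for each of B and
  its complement, and subtracting the trivial character lowers the norm by 1.\<close>

lemma sum_st_sq: "(\<Sum>x\<in>carrier P. (st x)\<^sup>2) \<le> real (card (carrier P))"
proof -
  let ?b = "real (card B)" and ?p = "real (card (carrier P))"
  have "(\<Sum>w\<in>B. real (card {b \<in> B. inv w \<otimes> b \<otimes> w \<in> B})) \<le> (\<Sum>w\<in>B. ?b)"
    by (intro sum_mono) (use finite_B in \<open>auto intro!: card_mono\<close>)
  moreover have "(\<Sum>w\<in>carrier P - B. real (card {b \<in> B. inv w \<otimes> b \<otimes> w \<in> B})) \<le>
      (\<Sum>w\<in>carrier P - B. (real q - 1) / 2)"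
  proof (intro sum_mono)
    fix w assume "w \<in> carrier P - B"
    then have "2 * card {b \<in> B. inv w \<otimes> b \<otimes> w \<in> B} \<le> q - 1" by (intro B_meet) auto
    then have "real (2 * card {b \<in> B. inv w \<otimes> b \<otimes> w \<in> B}) \<le> real (q - 1)"
      by (simp only: of_nat_le_iff)
    then show "real (card {b \<in> B. inv w \<otimes> b \<otimes> w \<in> B}) \<le> (real q - 1) / 2"
      using q_ge by (simp add: of_nat_diff)
  qed
  ultimately have "(\<Sum>w\<in>carrier P. real (card {b \<in> B. inv w \<otimes> b \<otimes> w \<in> B})) \<le>
      ?b * ?b + ?b * real q * ((real q - 1) / 2)"
    unfolding sum_split_B[of "\<lambda>w. real (card {b \<in> B. inv w \<otimes> b \<otimes> w \<in> B})"]
    by (simp add: card_P_minus_B)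
  \<comment> \<open>As |B| = q(q-1)/2, the two pieces contribute equally.\<close>
  also have "?b * ?b + ?b * real q * ((real q - 1) / 2) = 2 * ?b\<^sup>2"
    by (simp add: power2_eq_square real_card_B)
  finally have "(\<Sum>x\<in>carrier P. (conj_count B x)\<^sup>2) \<le> ?p * (2 * ?b\<^sup>2)"
    unfolding sum_conj_count_sq[OF B_carrier] by (intro mult_left_mono) auto
  moreover have "(\<Sum>x\<in>carrier P. (st x)\<^sup>2) =
      (\<Sum>x\<in>carrier P. (conj_count B x)\<^sup>2) / ?b\<^sup>2 - 2 * (\<Sum>x\<in>carrier P. conj_count B x) / ?b + ?p"
    by (simp add: st_def power2_diff power_divide sum.distrib sum_subtractf
        sum_divide_distrib[symmetric] sum_distrib_left[symmetric])
  ultimately show ?thesis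
    using card_B_pos by (simp add: sum_conj_count[OF B_carrier] divide_le_eq)
qed

text \<open>Elements of B contribute at most |U| = q each, the q |B| elements outside B at most 1
  each: both pieces give q |B|.\<close>

lemma sum_unip_sq: "(\<Sum>x\<in>carrier P. (unip x)\<^sup>2) \<le> 2 * real q * (real q + 1)"
proof -
  let ?b = "real (card B)" and ?p = "real (card (carrier P))"
  have "(\<Sum>w\<in>B. real (card {b \<in> U. inv w \<otimes> b \<otimes> w \<in> U})) \<le> (\<Sum>w\<in>B. real q)"
    unfolding card_U[symmetric] by (intro sum_mono) (use finite_U in \<open>auto intro!: card_mono\<close>)
  moreover have "(\<Sum>w\<in>carrier P - B. real (card {b \<in> U. inv w \<otimes> b \<otimes> w \<in> U})) \<le>
      (\<Sum>w\<in>carrier P - B. 1)"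
  proof (intro sum_mono)
    fix w assume "w \<in> carrier P - B"
    then have "{b \<in> U. inv w \<otimes> b \<otimes> w \<in> U} \<subseteq> {\<one>}" using U_meet by blast
    then have "card {b \<in> U. inv w \<otimes> b \<otimes> w \<in> U} \<le> card {\<one>}" by (intro card_mono) auto
    then show "real (card {b \<in> U. inv w \<otimes> b \<otimes> w \<in> U}) \<le> 1" by simp
  qed
  ultimately have "(\<Sum>w\<in>carrier P. real (card {b \<in> U. inv w \<otimes> b \<otimes> w \<in> U})) \<le> 2 * real q * ?b"
    unfolding sum_split_B[of "\<lambda>w. real (card {b \<in> U. inv w \<otimes> b \<otimes> w \<in> U})"]
    by (simp add: card_P_minus_B algebra_simps)
  then have "(\<Sum>x\<in>carrier P. (conj_count U x)\<^sup>2) \<le> ?p * (2 * real q * ?b)"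
    unfolding sum_conj_count_sq[OF U_carrier] by (intro mult_left_mono) auto
  then have "(\<Sum>x\<in>carrier P. (unip x)\<^sup>2) \<le> ?p * (2 * real q * ?b) / ?b\<^sup>2"
    unfolding unip_def power_divide sum_divide_distrib[symmetric] by (rule divide_right_mono) simp
  also have "\<dots> = 2 * real q * (real q + 1)"
    using card_B_pos by (simp add: real_card_P power2_eq_square)
  finally show ?thesis .
qed

text \<open>A weighted sum of indicators of two-sided translates of U, the form in which test
  functions enter the product bound.\<close>

lemma unip_expand:
  "unip x = (\<Sum>y\<in>carrier P. 1 / real (card B) * indicator U (inv y \<otimes> x \<otimes> y))"
  by (simp add: unip_def conj_count_sum sum_divide_distrib)

text \<open>The constant 1 is written as an average of indicators of left cosets of \<open>B\<close>.\<close>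
lemma st_expand:
  assumes x: "x \<in> carrier P"
  shows "st x = (\<Sum>(y, s)\<in>carrier P \<times> {True, False}.
    (if s then 1 else -1) / real (card B) * indicator B (inv y \<otimes> x \<otimes> (if s then y else \<one>)))"
proof -
  have "(\<Sum>y\<in>carrier P. indicator B (inv y \<otimes> x)) = (\<Sum>y\<in>carrier P. indicator B (inv (inv x \<otimes> y)))"
    by (intro sum.cong refl) (use x in \<open>simp add: inv_mult_group\<close>)
  also have "\<dots> = (\<Sum>y\<in>carrier P. indicator B (inv y))"
    by (rule group_sum_translate_left[OF is_group, where f="\<lambda>y. indicator B (inv y)"]) (use x in simp)
  also have "\<dots> = (\<Sum>y\<in>carrier P. indicator B y)"
    by (rule group_sum_inverse[OF is_group])
  also have "\<dots> = real (card B)"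
    using finite_P B_carrier by (simp add: indicator_def sum.If_cases Int_absorb1)
  finally have "(\<Sum>y\<in>carrier P. indicator B (inv y \<otimes> x)) = real (card B)" .
  then show ?thesis
    using card_B_pos x
    by (simp add: sum.cartesian_product[symmetric] sum.distrib sum_negf st_def conj_count_sum
        sum_divide_distrib[symmetric] sum_subtractf diff_divide_distrib)
qed

end

text \<open>The test function on the k-th power is the product of \<open>f\<close> over the
  coordinates. It expands into indicators of two-sided translates of H^k, and \<chi> sums to zero
  over each of them because H^k fixes no nonzero vector.\<close>

lemma (in irreducible_coeffs) degree_gap_product:
  fixes P :: "('b, 'd) monoid_scheme" and k :: nat and f :: "'b \<Rightarrow> real"
  defines "M \<equiv> product_group {..<k} (\<lambda>_. P)"
  assumes P: "group P" "finite (carrier P)" and H: "subgroup H P"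
    and \<iota>: "\<iota> \<in> hom M G" "inj_on \<iota> (carrier M)"
    and J: "finite J" "\<And>j. j \<in> J \<Longrightarrow> a j \<in> carrier P" "\<And>j. j \<in> J \<Longrightarrow> c j \<in> carrier P"
    and f: "\<And>x. x \<in> carrier P \<Longrightarrow> f x = (\<Sum>j\<in>J. w j * indicator H (a j \<otimes>\<^bsub>P\<^esub> x \<otimes>\<^bsub>P\<^esub> c j))"
    and no_fixed: "\<And>v i. (\<And>h i. h \<in> (\<Pi>\<^sub>E i\<in>{..<k}. H) \<Longrightarrow> i < n \<Longrightarrow> act (\<iota> h) v i = v i) \<Longrightarrow> i < n \<Longrightarrow> v i = 0"
  shows "(f \<one>\<^bsub>P\<^esub> ^ k * real n)\<^sup>2 \<le>
    ((\<Sum>x\<in>carrier P. (f x)\<^sup>2) ^ k - (f \<one>\<^bsub>P\<^esub> ^ k)\<^sup>2) * (real (order G) - (real n)\<^sup>2)"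
proof -
  interpret P: group P by fact
  interpret M: group M unfolding M_def using P by simp
  have carM: "carrier M = (\<Pi>\<^sub>E i\<in>{..<k}. carrier P)" by (simp add: M_def)
  interpret \<iota>: group_hom M G \<iota> by unfold_locales fact
  define Hk where "Hk = (\<Pi>\<^sub>E i\<in>{..<k}. H)"
  have H_car: "H \<subseteq> carrier P" using subgroup.subset[OF H] .
  have Hk_car: "Hk \<subseteq> carrier M" unfolding Hk_def carM using H_car by (intro PiE_mono) auto
  have Hk_mult: "h \<otimes>\<^bsub>M\<^esub> h' \<in> Hk" "inv\<^bsub>M\<^esub> h \<in> Hk" if "h \<in> Hk" "h' \<in> Hk" for h h'
    using that Hk_car subgroup.m_closed[OF H] subgroup.m_inv_closed[OF H] P
    by (auto simp: M_def Hk_def PiE_iff extensional_def subset_iff)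
  have finHk: "finite Hk"
    unfolding Hk_def using H_car P finite_subset by (intro finite_PiE) auto
  \<comment> \<open>Each column of the sum of the matrices of H^k is a vector fixed by H^k, hence
    zero.\<close>
  have sum_r: "(\<Sum>h\<in>Hk. r (\<iota> h) i j) = 0" if i: "i < n" and j: "j < n" for i j
  proof -
    define v where "v i = (\<Sum>h\<in>Hk. r (\<iota> h) i j)" for i
    have "act (\<iota> h) v i = v i" if h: "h \<in> Hk" and i: "i < n" for h i
    proof -
      have "act (\<iota> h) v i = (\<Sum>h'\<in>Hk. \<Sum>l<n. r (\<iota> h) i l * r (\<iota> h') l j)"
        by (subst sum.swap) (simp add: act_def v_def sum_distrib_left)
      also have "\<dots> = (\<Sum>h'\<in>Hk. r (\<iota> (h \<otimes>\<^bsub>M\<^esub> h')) i j)"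
      proof (intro sum.cong refl)
        fix h' assume "h' \<in> Hk"
        then have "h \<in> carrier M" "h' \<in> carrier M" using h Hk_car by auto
        then show "(\<Sum>l<n. r (\<iota> h) i l * r (\<iota> h') l j) = r (\<iota> (h \<otimes>\<^bsub>M\<^esub> h')) i j"
          using i j by (simp add: r_mult)
      qed
      also have "\<dots> = v i"
        unfolding v_def
      proof (rule sum.reindex_bij_witness[where i="\<lambda>h'. inv\<^bsub>M\<^esub> h \<otimes>\<^bsub>M\<^esub> h'" and j="\<lambda>h'. h \<otimes>\<^bsub>M\<^esub> h'"])
        fix h' assume h': "h' \<in> Hk"
        have *: "h \<in> carrier M" "h' \<in> carrier M" using h h' Hk_car by auto
        show "inv\<^bsub>M\<^esub> h \<otimes>\<^bsub>M\<^esub> (h \<otimes>\<^bsub>M\<^esub> h') = h'" "h \<otimes>\<^bsub>M\<^esub> (inv\<^bsub>M\<^esub> h \<otimes>\<^bsub>M\<^esub> h') = h'"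
          using * by (simp_all add: M.m_assoc[symmetric])
        show "h \<otimes>\<^bsub>M\<^esub> h' \<in> Hk" "inv\<^bsub>M\<^esub> h \<otimes>\<^bsub>M\<^esub> h' \<in> Hk"
          using Hk_mult h h' by auto
      qed simp
      finally show ?thesis .
    qed
    from no_fixed[of v, OF this[unfolded Hk_def] i] show ?thesis by (simp add: v_def)
  qed
  \<comment> \<open>This is the trace of a product whose middle factor is the zero matrix from
    \<open>sum_r\<close>.\<close>
  have coset: "(\<Sum>h\<in>Hk. \<chi> (\<iota> (y \<otimes>\<^bsub>M\<^esub> h \<otimes>\<^bsub>M\<^esub> z))) = 0"
    if y: "y \<in> carrier M" and z: "z \<in> carrier M" for y z
  proof -
    have "(\<Sum>h\<in>Hk. \<chi> (\<iota> (y \<otimes>\<^bsub>M\<^esub> h \<otimes>\<^bsub>M\<^esub> z))) =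
        (\<Sum>h\<in>Hk. \<Sum>i<n. \<Sum>j<n. \<Sum>l<n. r (\<iota> y) i l * r (\<iota> z) j i * r (\<iota> h) l j)"
      using y z Hk_car
      by (intro sum.cong refl) (auto simp: \<chi>_def r_mult sum_distrib_right sum_distrib_left subset_iff mult_ac)
    also have "\<dots> = (\<Sum>i<n. \<Sum>j<n. \<Sum>l<n. \<Sum>h\<in>Hk. r (\<iota> y) i l * r (\<iota> z) j i * r (\<iota> h) l j)"
      by (simp only: sum.swap[of _ _ Hk])
    also have "\<dots> = 0"
      unfolding sum_distrib_left[symmetric] by (intro sum.neutral ballI) (simp add: sum_r)
    finally show ?thesis .
  qed
  \<comment> \<open>Distributing the product over the sums: \<open>g\<close> chooses one index of
    \<open>J\<close> in every coordinate.\<close>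
  have "(\<Sum>x\<in>carrier M. of_real (\<Prod>i<k. f (x i)) * \<chi> (\<iota> x)) =
      (\<Sum>x\<in>carrier M. \<Sum>g\<in>{..<k} \<rightarrow>\<^sub>E J.
        of_real (\<Prod>i<k. w (g i) * indicator H (a (g i) \<otimes>\<^bsub>P\<^esub> x i \<otimes>\<^bsub>P\<^esub> c (g i))) * \<chi> (\<iota> x))"
  proof (intro sum.cong refl)
    fix x assume x: "x \<in> carrier M"
    have "(\<Prod>i<k. f (x i)) = (\<Prod>i<k. \<Sum>j\<in>J. w j * indicator H (a j \<otimes>\<^bsub>P\<^esub> x i \<otimes>\<^bsub>P\<^esub> c j))"
      by (intro prod.cong refl f) (use x carM in auto)
    then show "of_real (\<Prod>i<k. f (x i)) * \<chi> (\<iota> x) = (\<Sum>g\<in>{..<k} \<rightarrow>\<^sub>E J.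
        of_real (\<Prod>i<k. w (g i) * indicator H (a (g i) \<otimes>\<^bsub>P\<^esub> x i \<otimes>\<^bsub>P\<^esub> c (g i))) * \<chi> (\<iota> x))"
      using J(1) by (simp add: prod_sum_PiE sum_distrib_right)
  qed
  also have "\<dots> = (\<Sum>g\<in>{..<k} \<rightarrow>\<^sub>E J. of_real (\<Prod>i<k. w (g i)) *
      (\<Sum>x\<in>carrier M. (\<Prod>i<k. indicator H (a (g i) \<otimes>\<^bsub>P\<^esub> x i \<otimes>\<^bsub>P\<^esub> c (g i))) * \<chi> (\<iota> x)))"
    by (subst sum.swap) (simp add: prod.distrib sum_distrib_left mult_ac of_real_indicator)
  also have "\<dots> = 0"
  proof (intro sum.neutral ballI)
    fix g assume g: "g \<in> {..<k} \<rightarrow>\<^sub>E J"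
    \<comment> \<open>Inverses are taken so that the product of indicators becomes membership of x
      in the translate y H^k z.\<close>
    define y where "y = (\<lambda>i\<in>{..<k}. inv\<^bsub>P\<^esub> a (g i))"
    define z where "z = (\<lambda>i\<in>{..<k}. inv\<^bsub>P\<^esub> c (g i))"
    have ag: "a (g i) \<in> carrier P" "c (g i) \<in> carrier P" if "i < k" for i
      using g that J by auto
    have y: "y \<in> carrier M" and z: "z \<in> carrier M" using ag by (auto simp: y_def z_def carM)
    have ind: "(\<Prod>i<k. indicator H (a (g i) \<otimes>\<^bsub>P\<^esub> x i \<otimes>\<^bsub>P\<^esub> c (g i))) =
        (if inv\<^bsub>M\<^esub> y \<otimes>\<^bsub>M\<^esub> x \<otimes>\<^bsub>M\<^esub> inv\<^bsub>M\<^esub> z \<in> Hk then 1 else (0::complex))" if x: "x \<in> carrier M" for x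
    proof -
      have "inv\<^bsub>M\<^esub> y \<otimes>\<^bsub>M\<^esub> x \<otimes>\<^bsub>M\<^esub> inv\<^bsub>M\<^esub> z = (\<lambda>i\<in>{..<k}. a (g i) \<otimes>\<^bsub>P\<^esub> x i \<otimes>\<^bsub>P\<^esub> c (g i))"
        unfolding M_def
        using y z x ag P by (auto simp: carM y_def z_def fun_eq_iff)
      then have "inv\<^bsub>M\<^esub> y \<otimes>\<^bsub>M\<^esub> x \<otimes>\<^bsub>M\<^esub> inv\<^bsub>M\<^esub> z \<in> Hk \<longleftrightarrow> (\<forall>i<k. a (g i) \<otimes>\<^bsub>P\<^esub> x i \<otimes>\<^bsub>P\<^esub> c (g i) \<in> H)"
        by (auto simp: Hk_def PiE_iff)
      then show ?thesis by (auto simp: indicator_def prod_zero_iff)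
    qed
    have finM: "finite (carrier M)" unfolding carM using P by (intro finite_PiE) auto
    have "(\<Sum>x\<in>carrier M. (\<Prod>i<k. indicator H (a (g i) \<otimes>\<^bsub>P\<^esub> x i \<otimes>\<^bsub>P\<^esub> c (g i))) * \<chi> (\<iota> x)) =
        (\<Sum>x\<in>{x \<in> carrier M. inv\<^bsub>M\<^esub> y \<otimes>\<^bsub>M\<^esub> x \<otimes>\<^bsub>M\<^esub> inv\<^bsub>M\<^esub> z \<in> Hk}. \<chi> (\<iota> x))"
      using finM by (intro sum.mono_neutral_cong_right) (auto simp: ind)
    also have "\<dots> = (\<Sum>h\<in>Hk. \<chi> (\<iota> (y \<otimes>\<^bsub>M\<^esub> h \<otimes>\<^bsub>M\<^esub> z)))"
      by (rule sum.reindex_bij_witness[where i="\<lambda>h. y \<otimes>\<^bsub>M\<^esub> h \<otimes>\<^bsub>M\<^esub> z"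
            and j="\<lambda>x. inv\<^bsub>M\<^esub> y \<otimes>\<^bsub>M\<^esub> x \<otimes>\<^bsub>M\<^esub> inv\<^bsub>M\<^esub> z"])
         (use y z Hk_car in \<open>auto simp: M.m_assoc M.inv_cancel_left subset_iff\<close>)
    finally show "of_real (\<Prod>i<k. w (g i)) *
        (\<Sum>x\<in>carrier M. (\<Prod>i<k. indicator H (a (g i) \<otimes>\<^bsub>P\<^esub> x i \<otimes>\<^bsub>P\<^esub> c (g i))) * \<chi> (\<iota> x)) = 0"
      using coset[OF y z] by simp
  qed
  finally have zero: "(\<Sum>x\<in>carrier M. of_real (\<Prod>i<k. f (x i)) * \<chi> (\<iota> x)) = 0" .
  \<comment> \<open>The product function transported to the image of \<iota>; only its values there
    are summed.\<close>
  define F where "F g = (\<Prod>i<k. f (inv_into (carrier M) \<iota> g i))" for g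
  have F: "F (\<iota> x) = (\<Prod>i<k. f (x i))" if "x \<in> carrier M" for x
    using that \<iota>(2) by (simp add: F_def)
  have one: "F \<one> = f \<one>\<^bsub>P\<^esub> ^ k"
  proof -
    have "F \<one> = F (\<iota> \<one>\<^bsub>M\<^esub>)" by simp
    also have "\<dots> = (\<Prod>i<k. f (\<one>\<^bsub>M\<^esub> i))" by (rule F) simp
    finally show ?thesis by (simp add: M_def)
  qed
  have "(\<Sum>x\<in>\<iota> ` carrier M. (F x)\<^sup>2) = (\<Sum>x\<in>carrier M. \<Prod>i<k. (f (x i))\<^sup>2)"
    using \<iota>(2) by (simp add: sum.reindex F prod_power_distrib)
  also have "\<dots> = (\<Prod>i<k. \<Sum>x\<in>carrier P. (f x)\<^sup>2)"
    unfolding carM by (rule prod_sum_PiE[symmetric]) (use P in auto)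
  finally have sq: "(\<Sum>x\<in>\<iota> ` carrier M. (F x)\<^sup>2) = (\<Sum>x\<in>carrier P. (f x)\<^sup>2) ^ k" by simp
  have "(F \<one> * real n)\<^sup>2 \<le> ((\<Sum>x\<in>\<iota> ` carrier M. (F x)\<^sup>2) - (F \<one>)\<^sup>2) * (real (order G) - (real n)\<^sup>2)"
  proof (rule degree_gap)
    show "\<one> \<in> \<iota> ` carrier M" using \<iota>.hom_one M.one_closed by (metis image_eqI)
    show "(\<Sum>x\<in>\<iota> ` carrier M. of_real (F x) * \<chi> x) = 0"
      using \<iota>(2) zero by (simp add: sum.reindex F)
  qed auto
  then show ?thesis by (simp only: one sq)
qed

section \<open>Frattini's argument\<close>

text \<open>Orbit lengths are powers of p; without a fixed point all of them are divisible by p, and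
  so is their sum.\<close>

lemma (in group_action) p_group_fixed_point:
  assumes E: "finite E" and card: "order G = p ^ a" and p: "Factorial_Ring.prime (p::nat)"
    and ndvd: "\<not> p dvd card E"
  shows "\<exists>x\<in>E. \<forall>g\<in>carrier G. \<phi> g x = x"
proof (rule ccontr)
  assume none: "\<not> ?thesis"
  have "p dvd card orb" if orb: "orb \<in> orbits G E \<phi>" for orb
  proof -
    obtain x where x: "x \<in> E" "orb = orbit G \<phi> x" using orb by (auto simp: orbits_def)
    have "card orb dvd p ^ a"
      using orbit_stabilizer_theorem[OF x(1)] card x(2) by (metis dvd_triv_left)
    then obtain j where j: "card orb = p ^ j" using p by (metis divides_primepow_nat)
    have "j \<noteq> 0"
    proof
      assume "j = 0"
      then obtain y where y: "orb = {y}" using j by (auto simp: card_1_singleton_iff)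
      have "x \<in> orb" using orbit_refl[OF x(1)] x(2) by simp
      then have "\<phi> g x = x" if "g \<in> carrier G" for g
        using that y x(2) by (auto simp: orbit_def)
      then show False using none x(1) by blast
    qed
    then show ?thesis using j by simp
  qed
  then have "p dvd (\<Sum>orb\<in>orbits G E \<phi>. card orb)" by (rule dvd_sum)
  then show False using ndvd disjoint_sum[OF E, of "\<lambda>_. 1::nat"] by simp
qed

text \<open>The containment half of Sylow's theorem: V permutes the cosets of H, and a fixed coset H
  y means that y V y^-1 lies in H.\<close>

lemma (in group) p_subgroup_fixed_coset:
  assumes fin: "finite (carrier G)" and V: "subgroup V G" "card V = p ^ a"
    and p: "Factorial_Ring.prime (p::nat)" and H: "subgroup H G" and ndvd: "\<not> p dvd card (rcosets H)"
  shows "\<exists>y\<in>carrier G. \<forall>u\<in>V. y \<otimes> u \<otimes> inv y \<in> H"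
proof -
  define E where "E = rcosets H"
  \<comment> \<open>The inverse turns right multiplication into a left action; the map is restricted
    to \<open>E\<close> because elements of \<open>BijGroup\<close> are extensional.\<close>
  define \<phi> where "\<phi> u = (\<lambda>C\<in>E. C #> inv u)" for u
  have Hc: "H \<subseteq> carrier G" using subgroup.subset[OF H] .
  have V_car: "u \<in> carrier G" if "u \<in> V" for u using subgroup.mem_carrier[OF V(1) that] .
  have E_car: "C \<subseteq> carrier G" if "C \<in> E" for C
    using that Hc by (auto simp: E_def RCOSETS_def r_coset_def)
  have E_shift: "C #> x \<in> E" if "C \<in> E" "x \<in> carrier G" for C x
    using that Hc by (auto simp: E_def RCOSETS_def coset_mult_assoc)
  have \<phi>_Bij: "\<phi> u \<in> Bij E" if u: "u \<in> V" for u
  proof -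
    have "bij_betw (\<lambda>C. C #> inv u) E E"
      by (rule bij_betw_byWitness[where f'="\<lambda>C. C #> u"])
         (use V_car[OF u] E_car E_shift in \<open>auto simp: coset_mult_assoc\<close>)
    then have "bij_betw (\<phi> u) E E" by (simp add: \<phi>_def cong: bij_betw_cong)
    then show ?thesis by (simp add: Bij_def \<phi>_def)
  qed
  have "group_action (G\<lparr>carrier := V\<rparr>) E \<phi>"
  proof (unfold group_action_def, rule group_hom.intro[OF _ _ group_hom_axioms.intro])
    show "group (G\<lparr>carrier := V\<rparr>)" using V(1) is_group by (rule subgroup.subgroup_is_group)
    show "group (BijGroup E)" by (rule group_BijGroup)
    show "\<phi> \<in> hom (G\<lparr>carrier := V\<rparr>) (BijGroup E)"
    proof (rule homI)
      show "\<phi> u \<in> carrier (BijGroup E)" if "u \<in> carrier (G\<lparr>carrier := V\<rparr>)" for u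
        using that \<phi>_Bij by (simp add: BijGroup_def)
      fix u w assume "u \<in> carrier (G\<lparr>carrier := V\<rparr>)" "w \<in> carrier (G\<lparr>carrier := V\<rparr>)"
      then have uw: "u \<in> V" "w \<in> V" by auto
      show "\<phi> (u \<otimes>\<^bsub>G\<lparr>carrier := V\<rparr>\<^esub> w) = \<phi> u \<otimes>\<^bsub>BijGroup E\<^esub> \<phi> w"
        using \<phi>_Bij[OF uw(1)] \<phi>_Bij[OF uw(2)] V_car[OF uw(1)] V_car[OF uw(2)]
        by (auto simp: BijGroup_def compose_def \<phi>_def fun_eq_iff E_shift E_car
            coset_mult_assoc inv_mult_group)
    qed
  qed
  then interpret A: group_action "G\<lparr>carrier := V\<rparr>" E \<phi> .
  have finE: "finite E"
    unfolding E_def RCOSETS_def using fin by simp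
  obtain C where C: "C \<in> E" "\<And>u. u \<in> V \<Longrightarrow> \<phi> u C = C"
    using A.p_group_fixed_point[OF finE _ p, of a] V(2) ndvd by (auto simp: order_def E_def)
  obtain y where y: "y \<in> carrier G" "C = H #> y" using C(1) by (auto simp: E_def RCOSETS_def)
  have "y \<otimes> u \<otimes> inv y \<in> H" if u: "u \<in> V" for u
  proof (rule coset_join1[OF _ _ H])
    have iu: "inv u \<in> V" using subgroup.m_inv_closed[OF V(1) u] .
    have "H #> y = H #> (y \<otimes> u)"
      using C(2)[OF iu] C(1) y Hc V_car[OF u] by (simp add: \<phi>_def coset_mult_assoc)
    then show "H #> (y \<otimes> u \<otimes> inv y) = H"
      using y V_car[OF u] Hc by (simp add: coset_mult_inv2)
  qed (use y V_car[OF u] in simp)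
  then show ?thesis using y by blast
qed

text \<open>Frattini's argument, with \<open>U\<close> a Sylow subgroup of \<open>N\<close> whose normalizer in \<open>N\<close> is \<open>B\<close>.\<close>
lemma (in group) frattini_count:
  fixes p :: nat
  assumes fin: "finite (carrier G)" and N: "N \<lhd> G"
    and B: "subgroup B G" and U: "subgroup U G" and sub: "U \<subseteq> B" "B \<subseteq> N"
    and p: "Factorial_Ring.prime p" "card U = p ^ a" and index: "card N = card B * c" "\<not> p dvd c"
    and p_elements: "\<And>b. b \<in> B \<Longrightarrow> b [^] (p ^ a) = \<one> \<Longrightarrow> b \<in> U"
    and normalizer: "\<And>x. x \<in> N \<Longrightarrow> x \<in> B \<longleftrightarrow> (\<forall>u\<in>U. x \<otimes> u \<otimes> inv x \<in> U)"
  shows "card (carrier G) * card B \<le> card N * card {g \<in> carrier G. \<forall>b\<in>B. g \<otimes> b \<otimes> inv g \<in> B}"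
proof -
  define K where "K = {g \<in> carrier G. \<forall>b\<in>B. g \<otimes> b \<otimes> inv g \<in> B}"
  have N_sub: "subgroup N G" using N by (simp add: normal_def)
  have N_conj: "g \<otimes> x \<otimes> inv g \<in> N" if "g \<in> carrier G" "x \<in> N" for g x
    using N that by (simp add: normal_inv_iff)
  have N_car: "x \<in> carrier G" if "x \<in> N" for x using subgroup.mem_carrier[OF N_sub that] .
  have B_car: "x \<in> carrier G" if "x \<in> B" for x using subgroup.mem_carrier[OF B that] .
  have U_car: "x \<in> carrier G" if "x \<in> U" for x using subgroup.mem_carrier[OF U that] .
  have finU: "finite U" "finite B" "finite N"
    using U_car B_car N_car fin finite_subset[of _ "carrier G"] by blast+
  have conj_mult: "(g \<otimes> x \<otimes> inv g) \<otimes> (g \<otimes> y \<otimes> inv g) = g \<otimes> (x \<otimes> y) \<otimes> inv g"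
    if "g \<in> carrier G" "x \<in> carrier G" "y \<in> carrier G" for g x y
    using that by (simp add: m_assoc inv_cancel_left)
  have conj_pow: "(g \<otimes> x \<otimes> inv g) [^] (m::nat) = g \<otimes> (x [^] m) \<otimes> inv g"
    if "g \<in> carrier G" "x \<in> carrier G" for g x m
    using that by (induction m) (simp_all add: conj_mult)
  have conj_conj: "g \<otimes> (h \<otimes> x \<otimes> inv h) \<otimes> inv g = (g \<otimes> h) \<otimes> x \<otimes> inv (g \<otimes> h)"
    if "g \<in> carrier G" "x \<in> carrier G" "h \<in> carrier G" for g x h
    using that by (simp add: m_assoc inv_mult_group)
  have conj_inj: "inj_on (\<lambda>x. g \<otimes> x \<otimes> inv g) (carrier G)" if "g \<in> carrier G" for g
    using that by (auto simp: inj_on_def)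
  have U_pow: "u [^] (p ^ a) = \<one>" if u: "u \<in> U" for u
  proof -
    interpret UG: group "G\<lparr>carrier := U\<rparr>" using U is_group by (rule subgroup.subgroup_is_group)
    have "u [^]\<^bsub>G\<lparr>carrier := U\<rparr>\<^esub> order (G\<lparr>carrier := U\<rparr>) = \<one>\<^bsub>G\<lparr>carrier := U\<rparr>\<^esub>"
      using u by (intro UG.pow_order_eq_1) simp
    then show ?thesis using p(2) by (simp add: order_def flip: nat_pow_consistent)
  qed
  \<comment> \<open>The conjugate of U by g is moved into B by some y in N; there it consists of
    elements killed by p^a, which lie in U. Hence \<kappa> = y g normalizes U, and therefore
    B.\<close>
  have ex: "\<exists>y\<in>N. \<exists>\<kappa>\<in>K. g = y \<otimes> \<kappa>" if g: "g \<in> carrier G" for g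
  proof -
    interpret NG: group "G\<lparr>carrier := N\<rparr>" using N_sub is_group by (rule subgroup.subgroup_is_group)
    define V where "V = (\<lambda>u. g \<otimes> u \<otimes> inv g) ` U"
    have V_N: "V \<subseteq> N" using g sub N_conj by (auto simp: V_def)
    have V_sub: "subgroup V G"
    proof (rule subgroupI)
      show "V \<subseteq> carrier G" using V_N N_car by auto
      show "V \<noteq> {}" using subgroup.one_closed[OF U] by (auto simp: V_def)
    next
      fix x assume "x \<in> V"
      then obtain u where u: "u \<in> U" "x = g \<otimes> u \<otimes> inv g" by (auto simp: V_def)
      then have "inv x = g \<otimes> inv u \<otimes> inv g"
        using g U_car[OF u(1)] by (simp add: inv_mult_group m_assoc)
      then show "inv x \<in> V" using subgroup.m_inv_closed[OF U u(1)] by (auto simp: V_def)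
    next
      fix x y assume "x \<in> V" "y \<in> V"
      then obtain u w where u: "u \<in> U" "x = g \<otimes> u \<otimes> inv g" "w \<in> U" "y = g \<otimes> w \<otimes> inv g"
        by (auto simp: V_def)
      then have "x \<otimes> y = g \<otimes> (u \<otimes> w) \<otimes> inv g" using g U_car by (simp add: conj_mult)
      then show "x \<otimes> y \<in> V" using subgroup.m_closed[OF U u(1,3)] by (auto simp: V_def)
    qed
    have cardV: "card V = p ^ a"
      unfolding V_def p(2)[symmetric]
      by (rule card_image) (use conj_inj[OF g] U_car in \<open>auto intro: inj_on_subset\<close>)
    have B_in_N: "subgroup B (G\<lparr>carrier := N\<rparr>)" and V_in_N: "subgroup V (G\<lparr>carrier := N\<rparr>)"
      using B V_sub sub V_N N_sub by (auto intro: subgroup_incl)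
    have "card (rcosets\<^bsub>G\<lparr>carrier := N\<rparr>\<^esub> B) * card B = card N"
      using NG.lagrange[OF B_in_N] by (simp add: order_def)
    moreover have "card B > 0" using finU subgroup.one_closed[OF B] by (auto simp: card_gt_0_iff)
    ultimately have "card (rcosets\<^bsub>G\<lparr>carrier := N\<rparr>\<^esub> B) = c" using index(1) by simp
    then obtain y where y: "y \<in> N" "\<And>v. v \<in> V \<Longrightarrow> y \<otimes> v \<otimes> inv y \<in> B"
      using NG.p_subgroup_fixed_coset[OF _ V_in_N cardV p(1) B_in_N] finU index(2) N_sub
      by (auto simp: m_inv_consistent)
    have yc: "y \<in> carrier G" using N_car y(1) .
    define \<kappa> where "\<kappa> = y \<otimes> g"
    have \<kappa>: "\<kappa> \<in> carrier G" using yc g by (simp add: \<kappa>_def)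
    have \<kappa>_U: "\<kappa> \<otimes> u \<otimes> inv \<kappa> \<in> U" if u: "u \<in> U" for u
    proof (rule p_elements)
      show "\<kappa> \<otimes> u \<otimes> inv \<kappa> \<in> B"
        using y(2)[of "g \<otimes> u \<otimes> inv g"] u g yc U_car[OF u] by (simp add: V_def \<kappa>_def conj_conj)
      show "(\<kappa> \<otimes> u \<otimes> inv \<kappa>) [^] (p ^ a) = \<one>"
        using \<kappa> U_car[OF u] by (simp add: conj_pow U_pow[OF u])
    qed
    \<comment> \<open>Finiteness turns stability of U under \<kappa> into stability under its
      inverse.\<close>
    have "(\<lambda>u. \<kappa> \<otimes> u \<otimes> inv \<kappa>) ` U = U"
      by (rule endo_inj_surj[OF finU(1)])
         (use \<kappa>_U conj_inj[OF \<kappa>] U_car in \<open>auto intro: inj_on_subset\<close>)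
    then have \<kappa>_U': "inv \<kappa> \<otimes> u \<otimes> \<kappa> \<in> U" if u: "u \<in> U" for u
    proof -
      obtain w where w: "w \<in> U" "u = \<kappa> \<otimes> w \<otimes> inv \<kappa>"
        using u \<open>(\<lambda>u. \<kappa> \<otimes> u \<otimes> inv \<kappa>) ` U = U\<close> by blast
      then have "inv \<kappa> \<otimes> u \<otimes> \<kappa> = w" using \<kappa> U_car[OF w(1)] by (simp add: m_assoc inv_cancel_left)
      then show ?thesis using w by simp
    qed
    \<comment> \<open>As B is the normalizer of U in N, an element normalizing both U and N
      normalizes B.\<close>
    have "\<kappa> \<otimes> b \<otimes> inv \<kappa> \<in> B" if b: "b \<in> B" for b
    proof -
      have bN: "b \<in> N" "b \<in> carrier G" using b sub B_car by auto
      define d where "d = \<kappa> \<otimes> b \<otimes> inv \<kappa>"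
      have d: "d \<in> N" "d \<in> carrier G" unfolding d_def using N_conj[OF \<kappa> bN(1)] N_car by auto
      have "d \<otimes> u \<otimes> inv d \<in> U" if u: "u \<in> U" for u
      proof -
        have "b \<otimes> (inv \<kappa> \<otimes> u \<otimes> \<kappa>) \<otimes> inv b \<in> U"
          using normalizer[OF bN(1)] b \<kappa>_U'[OF u] by blast
        then have "\<kappa> \<otimes> (b \<otimes> (inv \<kappa> \<otimes> u \<otimes> \<kappa>) \<otimes> inv b) \<otimes> inv \<kappa> \<in> U" by (rule \<kappa>_U)
        moreover have "\<kappa> \<otimes> (b \<otimes> (inv \<kappa> \<otimes> u \<otimes> \<kappa>) \<otimes> inv b) \<otimes> inv \<kappa> = d \<otimes> u \<otimes> inv d"
          using \<kappa> bN(2) U_car[OF u] by (simp add: d_def m_assoc inv_mult_group)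
        ultimately show ?thesis by simp
      qed
      then show ?thesis using normalizer[OF d(1)] by (auto simp: d_def)
    qed
    then have "\<kappa> \<in> K" using \<kappa> by (simp add: K_def)
    moreover have "g = inv y \<otimes> \<kappa>" using yc g by (simp add: \<kappa>_def inv_cancel_left)
    moreover have "inv y \<in> N" using subgroup.m_inv_closed[OF N_sub y(1)] .
    ultimately show ?thesis by blast
  qed
  have B_K: "b \<otimes> \<kappa> \<in> K" if b: "b \<in> B" and \<kappa>: "\<kappa> \<in> K" for b \<kappa>
  proof -
    have k: "\<kappa> \<in> carrier G" using \<kappa> by (simp add: K_def)
    have "(b \<otimes> \<kappa>) \<otimes> x \<otimes> inv (b \<otimes> \<kappa>) \<in> B" if x: "x \<in> B" for x
    proof -
      have "\<kappa> \<otimes> x \<otimes> inv \<kappa> \<in> B" using \<kappa> x by (simp add: K_def)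
      then have "b \<otimes> (\<kappa> \<otimes> x \<otimes> inv \<kappa>) \<otimes> inv b \<in> B"
        using b subgroup.m_closed[OF B] subgroup.m_inv_closed[OF B] by blast
      then show ?thesis using k B_car[OF b] B_car[OF x] by (simp add: conj_conj)
    qed
    then show ?thesis using k B_car[OF b] by (simp add: K_def)
  qed
  have finK: "finite K" using fin by (simp add: K_def)
  obtain y \<kappa> where y\<kappa>: "\<And>g. g \<in> carrier G \<Longrightarrow> y g \<in> N \<and> \<kappa> g \<in> K \<and> g = y g \<otimes> \<kappa> g"
    using ex by metis
  \<comment> \<open>A factorization g = y \<kappa> can be shifted by every b in B, and the product
    of the two components still recovers g; injectivity of this map is the desired count.\<close>
  define \<psi> where "\<psi> = (\<lambda>(g, b). (y g \<otimes> b, inv b \<otimes> \<kappa> g))"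
  have prod: "y g \<otimes> b \<otimes> (inv b \<otimes> \<kappa> g) = g" if "g \<in> carrier G" "b \<in> B" for g b
    using y\<kappa>[OF that(1)] N_car[of "y g"] B_car[OF that(2)]
    by (simp add: m_assoc inv_cancel_left K_def)
  have "inj_on \<psi> (carrier G \<times> B)"
  proof (rule inj_onI, clarify)
    fix g b g' b' assume gb: "g \<in> carrier G" "b \<in> B" "g' \<in> carrier G" "b' \<in> B"
      and eq: "\<psi> (g, b) = \<psi> (g', b')"
    have "g = g'" using eq prod[OF gb(1,2)] prod[OF gb(3,4)] by (simp add: \<psi>_def)
    moreover from this have "b = b'"
      using eq y\<kappa>[OF gb(1)] N_car[of "y g"] B_car gb by (simp add: \<psi>_def)
    ultimately show "g = g' \<and> b = b'" by simp
  qed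
  moreover have "\<psi> ` (carrier G \<times> B) \<subseteq> N \<times> K"
    using y\<kappa> sub subgroup.m_closed[OF N_sub] B_K subgroup.m_inv_closed[OF B] by (auto simp: \<psi>_def)
  ultimately have "card (carrier G \<times> B) \<le> card (N \<times> K)"
    by (rule card_inj_on_le) (use finU finK in simp)
  then show ?thesis by (simp add: K_def card_cartesian_product)
qed

section \<open>The group \<open>PSL\<^sub>2(q)\<close>\<close>

text \<open>A set closed under left multiplication by H is a disjoint union of cosets. With H the
  scalars, this transfers counts from SL(2) to PSL(2).\<close>

lemma (in normal) card_image_cosets:
  assumes fin: "finite (carrier G)" and A: "A \<subseteq> carrier G"
    and sat: "\<And>h a. h \<in> H \<Longrightarrow> a \<in> A \<Longrightarrow> h \<otimes> a \<in> A"
  shows "card H * card ((\<lambda>a. H #> a) ` A) = card A"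
proof -
  have "a \<in> H #> a" if "a \<in> A" for a
    using rcos_self[OF _ subgroup_axioms] A that by blast
  moreover have "H #> a \<subseteq> A" if "a \<in> A" for a
    using sat that by (auto simp: r_coset_def)
  ultimately have Un: "\<Union>((\<lambda>a. H #> a) ` A) = A" by blast
  have finA: "finite A" using A fin finite_subset by blast
  have "card H * card ((\<lambda>a. H #> a) ` A) = card (\<Union>((\<lambda>a. H #> a) ` A))"
  proof (rule card_partition)
    show "finite ((\<lambda>a. H #> a) ` A)" using finA by simp
    show "finite (\<Union>((\<lambda>a. H #> a) ` A))" using Un finA by simp
    show "card c = card H" if "c \<in> (\<lambda>a. H #> a) ` A" for c
    proof -
      from that obtain a where a: "a \<in> A" "c = H #> a" by (rule imageE)
      then have "c \<in> rcosets H" using A by (auto intro: rcosetsI[OF subset])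
      then show ?thesis by (rule card_rcosets_equal[OF _ subset, symmetric])
    qed
    show "c \<inter> c' = {}" if c: "c \<in> (\<lambda>a. H #> a) ` A" "c' \<in> (\<lambda>a. H #> a) ` A" "c \<noteq> c'" for c c'
    proof (rule ccontr)
      assume "c \<inter> c' \<noteq> {}"
      then obtain x where x: "x \<in> c" "x \<in> c'" by blast
      from c(1) obtain a where a: "a \<in> A" "c = H #> a" by (rule imageE)
      from c(2) obtain a' where a': "a' \<in> A" "c' = H #> a'" by (rule imageE)
      have "c = H #> x"
        using repr_independence[OF _ _ subgroup_axioms, of x a] x(1) a A by auto
      moreover have "c' = H #> x"
        using repr_independence[OF _ _ subgroup_axioms, of x a'] x(2) a' A by auto
      ultimately have "c = c'" by simp
      then show False using c(3) by simp
    qed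
  qed
  then show ?thesis using Un by simp
qed

lemma (in normal) coset_image_mem_iff:
  assumes A: "A \<subseteq> carrier G" and sat: "\<And>h a. h \<in> H \<Longrightarrow> a \<in> A \<Longrightarrow> h \<otimes> a \<in> A"
    and x: "x \<in> carrier G"
  shows "H #> x \<in> (\<lambda>a. H #> a) ` A \<longleftrightarrow> x \<in> A"
proof
  assume "H #> x \<in> (\<lambda>a. H #> a) ` A"
  then obtain a where a: "a \<in> A" "H #> x = H #> a" by auto
  then have "x \<in> H #> a" using rcos_self[OF x subgroup_axioms] by simp
  then show "x \<in> A" using sat a(1) by (auto simp: r_coset_def)
qed auto

section \<open>The group SL(2) over a field, its Borel subgroup and its unipotent elements up to
  sign\<close>

context field
begin

lemma SL2_det_mult:
  assumes "a \<in> carrier R" "b \<in> carrier R" "c \<in> carrier R" "d \<in> carrier R"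
    "a' \<in> carrier R" "b' \<in> carrier R" "c' \<in> carrier R" "d' \<in> carrier R"
  shows "(a \<otimes> a' \<oplus> b \<otimes> c') \<otimes> (c \<otimes> b' \<oplus> d \<otimes> d') \<ominus> (a \<otimes> b' \<oplus> b \<otimes> d') \<otimes> (c \<otimes> a' \<oplus> d \<otimes> c') =
    (a \<otimes> d \<ominus> b \<otimes> c) \<otimes> (a' \<otimes> d' \<ominus> b' \<otimes> c')"
  using assms by algebra

lemma mem_SL2: "(a, b, c, d) \<in> carrier (SL2 R) \<longleftrightarrow>
    a \<in> carrier R \<and> b \<in> carrier R \<and> c \<in> carrier R \<and> d \<in> carrier R \<and> a \<otimes> d \<ominus> b \<otimes> c = \<one>"
  by (simp add: SL2_def SL2_carrier_def)

lemma mult_SL2: "(a, b, c, d) \<otimes>\<^bsub>SL2 R\<^esub> (a', b', c', d') =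
    (a \<otimes> a' \<oplus> b \<otimes> c', a \<otimes> b' \<oplus> b \<otimes> d', c \<otimes> a' \<oplus> d \<otimes> c', c \<otimes> b' \<oplus> d \<otimes> d')"
  by (simp add: SL2_def SL2_mult_def)

lemma one_SL2: "\<one>\<^bsub>SL2 R\<^esub> = (\<one>, \<zero>, \<zero>, \<one>)"
  by (simp add: SL2_def)

lemma adj_SL2:
  assumes "(a, b, c, d) \<in> carrier (SL2 R)"
  shows "(d, \<ominus> b, \<ominus> c, a) \<in> carrier (SL2 R)"
    and "(d, \<ominus> b, \<ominus> c, a) \<otimes>\<^bsub>SL2 R\<^esub> (a, b, c, d) = \<one>\<^bsub>SL2 R\<^esub>"
proof -
  have car: "a \<in> carrier R" "b \<in> carrier R" "c \<in> carrier R" "d \<in> carrier R"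
    and det: "a \<otimes> d \<ominus> b \<otimes> c = \<one>" using assms by (auto simp: mem_SL2)
  have "d \<otimes> a \<ominus> \<ominus> b \<otimes> \<ominus> c = a \<otimes> d \<ominus> b \<otimes> c" using car by algebra
  then show "(d, \<ominus> b, \<ominus> c, a) \<in> carrier (SL2 R)" using car det by (simp add: mem_SL2)
  have "d \<otimes> a \<oplus> \<ominus> b \<otimes> c = a \<otimes> d \<ominus> b \<otimes> c" "d \<otimes> b \<oplus> \<ominus> b \<otimes> d = \<zero>"
    "\<ominus> c \<otimes> a \<oplus> a \<otimes> c = \<zero>" "\<ominus> c \<otimes> b \<oplus> a \<otimes> d = a \<otimes> d \<ominus> b \<otimes> c"
    using car by algebra+
  then show "(d, \<ominus> b, \<ominus> c, a) \<otimes>\<^bsub>SL2 R\<^esub> (a, b, c, d) = \<one>\<^bsub>SL2 R\<^esub>"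
    using det by (simp add: mult_SL2 one_SL2)
qed

lemma group_SL2: "group (SL2 R)"
proof (rule groupI)
  fix x y assume "x \<in> carrier (SL2 R)" "y \<in> carrier (SL2 R)"
  then show "x \<otimes>\<^bsub>SL2 R\<^esub> y \<in> carrier (SL2 R)"
    by (cases x; cases y) (auto simp: mem_SL2 mult_SL2 SL2_det_mult)
next
  show "\<one>\<^bsub>SL2 R\<^esub> \<in> carrier (SL2 R)" by (simp add: one_SL2 mem_SL2 minus_eq)
next
  fix x y z assume "x \<in> carrier (SL2 R)" "y \<in> carrier (SL2 R)" "z \<in> carrier (SL2 R)"
  then show "x \<otimes>\<^bsub>SL2 R\<^esub> y \<otimes>\<^bsub>SL2 R\<^esub> z = x \<otimes>\<^bsub>SL2 R\<^esub> (y \<otimes>\<^bsub>SL2 R\<^esub> z)"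
    by (cases x; cases y; cases z) (simp add: mem_SL2 mult_SL2, algebra)
next
  fix x assume "x \<in> carrier (SL2 R)"
  then show "\<one>\<^bsub>SL2 R\<^esub> \<otimes>\<^bsub>SL2 R\<^esub> x = x"
    by (cases x) (simp add: mem_SL2 mult_SL2 one_SL2)
next
  fix x assume x: "x \<in> carrier (SL2 R)"
  obtain a b c d where "x = (a, b, c, d)" by (cases x)
  then show "\<exists>y\<in>carrier (SL2 R). y \<otimes>\<^bsub>SL2 R\<^esub> x = \<one>\<^bsub>SL2 R\<^esub>"
    using adj_SL2[of a b c d] x by blast
qed

lemma inv_SL2: "(a, b, c, d) \<in> carrier (SL2 R) \<Longrightarrow> inv\<^bsub>SL2 R\<^esub> (a, b, c, d) = (d, \<ominus> b, \<ominus> c, a)"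
  by (rule group.inv_equality[OF group_SL2]) (auto intro: adj_SL2)

definition SL2_borel :: "('a \<times> 'a \<times> 'a \<times> 'a) set" where
  "SL2_borel = {(a, b, c, d) \<in> carrier (SL2 R). c = \<zero>}"

text \<open>The preimage in SL(2) of the unipotent radical: it contains the scalars.\<close>
definition SL2_unip :: "('a \<times> 'a \<times> 'a \<times> 'a) set" where
  "SL2_unip = {(a, b, c, d) \<in> carrier (SL2 R). c = \<zero> \<and> a = d}"

lemma SL2_mult_closed:
  "x \<in> carrier (SL2 R) \<Longrightarrow> y \<in> carrier (SL2 R) \<Longrightarrow> x \<otimes>\<^bsub>SL2 R\<^esub> y \<in> carrier (SL2 R)"
  using monoid.m_closed[OF group.is_monoid[OF group_SL2]] .

lemma subgroup_SL2_borel: "subgroup SL2_borel (SL2 R)"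
  using group_SL2
proof (rule group.subgroupI)
  show "SL2_borel \<noteq> {}"
    using monoid.one_closed[OF group.is_monoid[OF group_SL2]] by (auto simp: SL2_borel_def one_SL2)
  show "SL2_borel \<subseteq> carrier (SL2 R)" by (auto simp: SL2_borel_def)
next
  fix x assume "x \<in> SL2_borel"
  then obtain a b d where x: "x = (a, b, \<zero>, d)" "(a, b, \<zero>, d) \<in> carrier (SL2 R)"
    by (auto simp: SL2_borel_def)
  show "inv\<^bsub>SL2 R\<^esub> x \<in> SL2_borel"
    using adj_SL2(1)[OF x(2)] inv_SL2[OF x(2)] by (simp add: x(1) SL2_borel_def)
next
  fix x y assume "x \<in> SL2_borel" "y \<in> SL2_borel"
  then show "x \<otimes>\<^bsub>SL2 R\<^esub> y \<in> SL2_borel"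
    using SL2_mult_closed[of x y] by (auto simp: SL2_borel_def mult_SL2) (auto simp: mem_SL2)
qed

lemma subgroup_SL2_unip: "subgroup SL2_unip (SL2 R)"
  using group_SL2
proof (rule group.subgroupI)
  show "SL2_unip \<noteq> {}"
    using monoid.one_closed[OF group.is_monoid[OF group_SL2]] by (auto simp: SL2_unip_def one_SL2)
  show "SL2_unip \<subseteq> carrier (SL2 R)" by (auto simp: SL2_unip_def)
next
  fix x assume "x \<in> SL2_unip"
  then obtain a b where x: "x = (a, b, \<zero>, a)" "(a, b, \<zero>, a) \<in> carrier (SL2 R)"
    by (auto simp: SL2_unip_def)
  show "inv\<^bsub>SL2 R\<^esub> x \<in> SL2_unip"
    using adj_SL2(1)[OF x(2)] inv_SL2[OF x(2)] by (simp add: x(1) SL2_unip_def)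
next
  fix x y assume "x \<in> SL2_unip" "y \<in> SL2_unip"
  then show "x \<otimes>\<^bsub>SL2 R\<^esub> y \<in> SL2_unip"
    using SL2_mult_closed[of x y] by (auto simp: SL2_unip_def mult_SL2) (auto simp: mem_SL2)
qed

lemma SL2_scalars_subset: "SL2_scalars R \<subseteq> SL2_unip"
  by (auto simp: SL2_scalars_def SL2_unip_def mem_SL2 minus_eq)

lemma SL2_unip_subset: "SL2_unip \<subseteq> SL2_borel"
  by (auto simp: SL2_unip_def SL2_borel_def)

lemma scalar_mult_SL2:
  assumes "h \<in> SL2_scalars R" "x \<in> carrier (SL2 R)"
  shows "h \<otimes>\<^bsub>SL2 R\<^esub> x = x \<otimes>\<^bsub>SL2 R\<^esub> h"
  using assms by (cases x) (auto simp: SL2_scalars_def mem_SL2 mult_SL2 m_comm)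

lemma normal_SL2_scalars: "SL2_scalars R \<lhd> SL2 R"
proof -
  interpret S: group "SL2 R" by (rule group_SL2)
  have car: "SL2_scalars R \<subseteq> carrier (SL2 R)"
    using SL2_scalars_subset by (auto simp: SL2_unip_def)
  have "subgroup (SL2_scalars R) (SL2 R)"
  proof (rule S.subgroupI[OF car])
    show "SL2_scalars R \<noteq> {}" by (auto simp: SL2_scalars_def)
  next
    fix x assume x: "x \<in> SL2_scalars R"
    then show "inv\<^bsub>SL2 R\<^esub> x \<in> SL2_scalars R"
      using car by (auto simp: SL2_scalars_def inv_SL2)
  next
    fix x y assume "x \<in> SL2_scalars R" "y \<in> SL2_scalars R"
    then obtain a b where ab: "a \<in> carrier R" "a \<otimes> a = \<one>" "x = (a, \<zero>, \<zero>, a)"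
        "b \<in> carrier R" "b \<otimes> b = \<one>" "y = (b, \<zero>, \<zero>, b)"
      by (auto simp: SL2_scalars_def)
    have "(a \<otimes> b) \<otimes> (a \<otimes> b) = (a \<otimes> a) \<otimes> (b \<otimes> b)" using ab(1,4) by algebra
    then show "x \<otimes>\<^bsub>SL2 R\<^esub> y \<in> SL2_scalars R"
      using ab by (auto simp: SL2_scalars_def mult_SL2)
  qed
  moreover have "x \<otimes>\<^bsub>SL2 R\<^esub> h \<otimes>\<^bsub>SL2 R\<^esub> inv\<^bsub>SL2 R\<^esub> x = h"
    if "x \<in> carrier (SL2 R)" "h \<in> SL2_scalars R" for x h
  proof -
    have "h \<in> carrier (SL2 R)" using that car by blast
    then show ?thesis using that by (simp add: scalar_mult_SL2[symmetric] S.m_assoc)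
  qed
  ultimately show ?thesis by (simp add: S.normal_inv_iff)
qed

text \<open>The commutator is upper triangular with diagonal entries d d' a a' and a a' d d', which
  agree.\<close>

lemma borel_SL2_comm:
  assumes "x \<in> SL2_borel" "y \<in> SL2_borel"
  shows "inv\<^bsub>SL2 R\<^esub> x \<otimes>\<^bsub>SL2 R\<^esub> inv\<^bsub>SL2 R\<^esub> y \<otimes>\<^bsub>SL2 R\<^esub> x \<otimes>\<^bsub>SL2 R\<^esub> y \<in> SL2_unip"
proof -
  obtain a b d where x: "x = (a, b, \<zero>, d)" "(a, b, \<zero>, d) \<in> carrier (SL2 R)"
    using assms by (auto simp: SL2_borel_def)
  obtain a' b' d' where y: "y = (a', b', \<zero>, d')" "(a', b', \<zero>, d') \<in> carrier (SL2 R)"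
    using assms by (auto simp: SL2_borel_def)
  have car: "a \<in> carrier R" "b \<in> carrier R" "d \<in> carrier R"
    "a' \<in> carrier R" "b' \<in> carrier R" "d' \<in> carrier R" using x y by (auto simp: mem_SL2)
  have "d \<otimes> d' \<otimes> a \<otimes> a' = a \<otimes> a' \<otimes> d \<otimes> d'" using car by algebra
  moreover have "inv\<^bsub>SL2 R\<^esub> x \<otimes>\<^bsub>SL2 R\<^esub> inv\<^bsub>SL2 R\<^esub> y \<otimes>\<^bsub>SL2 R\<^esub> x \<otimes>\<^bsub>SL2 R\<^esub> y \<in> carrier (SL2 R)"
    using assms group_SL2 subgroup.mem_carrier[OF subgroup_SL2_borel]
    by (simp add: SL2_mult_closed group.inv_closed)
  ultimately show ?thesis
    using car unfolding x(1) y(1) inv_SL2[OF x(2)] inv_SL2[OF y(2)] mult_SL2 by (simp add: SL2_unip_def)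
qed

text \<open>The lower left entry of \<open>x\<^sup>-\<^sup>1 b x\<close> for upper triangular \<open>b\<close>.\<close>
lemma conj_SL2_borel:
  assumes x: "x \<in> carrier (SL2 R)" "x = (a, b, c, d)" and u: "u \<in> SL2_borel" "u = (t, s, \<zero>, t')"
    and conj: "inv\<^bsub>SL2 R\<^esub> x \<otimes>\<^bsub>SL2 R\<^esub> u \<otimes>\<^bsub>SL2 R\<^esub> x \<in> SL2_borel"
  shows "c \<otimes> (a \<otimes> (t' \<ominus> t) \<ominus> c \<otimes> s) = \<zero>"
proof -
  have car: "a \<in> carrier R" "b \<in> carrier R" "c \<in> carrier R" "d \<in> carrier R"
    "t \<in> carrier R" "s \<in> carrier R" "t' \<in> carrier R"
    using x u by (auto simp: mem_SL2 SL2_borel_def)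
  have "(\<ominus> c \<otimes> t \<oplus> a \<otimes> \<zero>) \<otimes> a \<oplus> (\<ominus> c \<otimes> s \<oplus> a \<otimes> t') \<otimes> c = \<zero>"
    using conj unfolding x(2) u(2) inv_SL2[OF x(1)[unfolded x(2)]] mult_SL2 SL2_borel_def by simp
  moreover have "(\<ominus> c \<otimes> t \<oplus> a \<otimes> \<zero>) \<otimes> a \<oplus> (\<ominus> c \<otimes> s \<oplus> a \<otimes> t') \<otimes> c =
      c \<otimes> (a \<otimes> (t' \<ominus> t) \<ominus> c \<otimes> s)"
    using car by algebra
  ultimately show ?thesis by simp
qed

end

section \<open>Counting in SL(2) over a finite field and passage to PSL(2)\<close>

context field
begin

lemma units_inv:
  assumes "t \<in> carrier R" "t \<noteq> \<zero>"
  shows "inv t \<in> carrier R" "t \<otimes> inv t = \<one>" "inv t \<otimes> t = \<one>"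
  using assms Units_inv_closed Units_r_inv Units_l_inv field_Units by auto

text \<open>Otherwise 0 and 1 would form an additive subgroup of order 2, contrary to Lagrange's
  theorem.\<close>

lemma one_neq_minus_one:
  assumes "finite (carrier R)" "odd (card (carrier R))"
  shows "\<one> \<noteq> \<ominus> \<one>"
proof
  assume "\<one> = \<ominus> \<one>"
  then have two: "\<one> \<oplus> \<one> = \<zero>" using r_neg[of \<one>] by simp
  have "inv\<^bsub>add_monoid R\<^esub> \<one> = \<one>"
    using group.inv_equality[OF a_group, of \<one> \<one>] two by simp
  moreover have "inv\<^bsub>add_monoid R\<^esub> \<zero> = \<zero>"
    using group.inv_equality[OF a_group, of \<zero> \<zero>] by simp
  ultimately have "subgroup {\<zero>, \<one>} (add_monoid R)"
    using two by (intro group.subgroupI[OF a_group]) auto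
  then have "card (rcosets\<^bsub>add_monoid R\<^esub> {\<zero>, \<one>}) * card {\<zero>, \<one>} = order (add_monoid R)"
    by (rule group.lagrange[OF a_group])
  moreover have "card {\<zero>, \<one>} = 2" "order (add_monoid R) = card (carrier R)"
    by (simp_all add: order_def)
  ultimately have "2 dvd card (carrier R)" by (metis dvd_triv_right)
  then show False using assms(2) by simp
qed

lemma square_one:
  assumes a: "a \<in> carrier R" "a \<otimes> a = \<one>"
  shows "a = \<one> \<or> a = \<ominus> \<one>"
proof -
  have "(a \<ominus> \<one>) \<otimes> (a \<oplus> \<one>) = a \<otimes> a \<ominus> \<one>" using a(1) by algebra
  also have "\<dots> = \<zero>" using a(2) by (simp add: minus_eq r_neg)
  finally have "a \<ominus> \<one> = \<zero> \<or> a \<oplus> \<one> = \<zero>" using a(1) by (intro integral) auto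
  then show ?thesis
  proof
    assume "a \<ominus> \<one> = \<zero>"
    then show ?thesis using a(1) by (metis r_right_minus_eq one_closed)
  next
    assume "a \<oplus> \<one> = \<zero>"
    then show ?thesis using a(1) by (metis minus_equality one_closed)
  qed
qed

lemma SL2_scalars_eq: "SL2_scalars R = {(\<one>, \<zero>, \<zero>, \<one>), (\<ominus> \<one>, \<zero>, \<zero>, \<ominus> \<one>)}"
proof -
  have "\<ominus> \<one> \<otimes> \<ominus> \<one> = \<one>" by algebra
  then show ?thesis using square_one by (auto simp: SL2_scalars_def)
qed

lemma mem_SL2_unip:
  "(a, b, c, d) \<in> SL2_unip \<longleftrightarrow> c = \<zero> \<and> d = a \<and> b \<in> carrier R \<and> (a = \<one> \<or> a = \<ominus> \<one>)"
proof -
  have "\<ominus> \<one> \<otimes> \<ominus> \<one> = \<one>" by algebra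
  then show ?thesis by (auto simp: SL2_unip_def mem_SL2 minus_eq dest: square_one)
qed

lemma SL2_borel_eq: "SL2_borel = (\<lambda>(t, s). (t, s, \<zero>, inv t)) ` ((carrier R - {\<zero>}) \<times> carrier R)"
proof (intro subset_antisym subsetI)
  fix x assume "x \<in> SL2_borel"
  then obtain t s d where x: "x = (t, s, \<zero>, d)" "t \<in> carrier R" "s \<in> carrier R" "d \<in> carrier R"
      "t \<otimes> d = \<one>"
    by (auto simp: SL2_borel_def mem_SL2 minus_eq)
  have "t \<noteq> \<zero>" using x by auto
  moreover have "d = inv t" using x comm_inv_char by simp
  ultimately show "x \<in> (\<lambda>(t, s). (t, s, \<zero>, inv t)) ` ((carrier R - {\<zero>}) \<times> carrier R)"
    using x by auto
qed (auto simp: SL2_borel_def mem_SL2 minus_eq units_inv)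

text \<open>When c is nonzero, the determinant condition determines b, so a, d and c are free
  coordinates for counting.\<close>

lemma SL2_big_cell:
  "carrier (SL2 R) - SL2_borel =
    (\<lambda>(a, c, d). (a, inv c \<otimes> (a \<otimes> d \<ominus> \<one>), c, d)) ` (carrier R \<times> (carrier R - {\<zero>}) \<times> carrier R)"
proof (intro subset_antisym subsetI)
  fix x assume "x \<in> carrier (SL2 R) - SL2_borel"
  then obtain a b c d where x: "x = (a, b, c, d)" "a \<in> carrier R" "b \<in> carrier R"
      "c \<in> carrier R" "d \<in> carrier R" "a \<otimes> d \<ominus> b \<otimes> c = \<one>" "c \<noteq> \<zero>"
    by (cases x) (auto simp: SL2_borel_def mem_SL2)
  have "a \<otimes> d \<ominus> (a \<otimes> d \<ominus> b \<otimes> c) = b \<otimes> c" using x(2-5) by algebra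
  then have "inv c \<otimes> (a \<otimes> d \<ominus> \<one>) = inv c \<otimes> (b \<otimes> c)" using x(6) by simp
  also have "\<dots> = b \<otimes> (inv c \<otimes> c)" using x(3,4) units_inv(1)[OF x(4,7)] by algebra
  also have "\<dots> = b" using x units_inv by simp
  finally show "x \<in> (\<lambda>(a, c, d). (a, inv c \<otimes> (a \<otimes> d \<ominus> \<one>), c, d)) `
      (carrier R \<times> (carrier R - {\<zero>}) \<times> carrier R)"
    using x by (auto simp: image_iff intro!: bexI[of _ "(a, c, d)"])
next
  fix x assume "x \<in> (\<lambda>(a, c, d). (a, inv c \<otimes> (a \<otimes> d \<ominus> \<one>), c, d)) `
      (carrier R \<times> (carrier R - {\<zero>}) \<times> carrier R)"
  then obtain a c d where x: "x = (a, inv c \<otimes> (a \<otimes> d \<ominus> \<one>), c, d)" "a \<in> carrier R"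
      "c \<in> carrier R" "c \<noteq> \<zero>" "d \<in> carrier R" by auto
  have ic: "inv c \<in> carrier R" "inv c \<otimes> c = \<one>" using units_inv[OF x(3,4)] by auto
  have "a \<otimes> d \<ominus> (inv c \<otimes> (a \<otimes> d \<ominus> \<one>)) \<otimes> c = a \<otimes> d \<ominus> (inv c \<otimes> c) \<otimes> (a \<otimes> d \<ominus> \<one>)"
    using x(2,3,5) ic(1) by algebra
  also have "\<dots> = a \<otimes> d \<ominus> \<one> \<otimes> (a \<otimes> d \<ominus> \<one>)" by (simp only: ic(2))
  also have "\<dots> = \<one>" using x(2,5) by algebra
  finally show "x \<in> carrier (SL2 R) - SL2_borel"
    using x ic by (simp add: mem_SL2 SL2_borel_def)
qed

lemma card_SL2_borel: "card SL2_borel = (card (carrier R) - 1) * card (carrier R)"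
  unfolding SL2_borel_eq
  by (subst card_image) (auto simp: inj_on_def card_cartesian_product card_Diff_singleton)

lemma card_SL2:
  assumes fin: "finite (carrier R)" and q: "card (carrier R) = q"
  shows "card (carrier (SL2 R)) = q * (q - 1) * (q + 1)"
proof -
  have sub: "SL2_borel \<subseteq> carrier (SL2 R)" by (auto simp: SL2_borel_def)
  have "finite SL2_borel" unfolding SL2_borel_eq using fin by simp
  moreover have "finite (carrier (SL2 R) - SL2_borel)" unfolding SL2_big_cell using fin by simp
  moreover have "card (carrier (SL2 R) - SL2_borel) = q * ((q - 1) * q)"
    unfolding SL2_big_cell
    by (subst card_image) (auto simp: inj_on_def card_cartesian_product card_Diff_singleton q)
  moreover have "carrier (SL2 R) = SL2_borel \<union> (carrier (SL2 R) - SL2_borel)" using sub by blast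
  ultimately have "card (carrier (SL2 R)) = (q - 1) * q + q * ((q - 1) * q)"
    using card_Un_disjoint[of SL2_borel "carrier (SL2 R) - SL2_borel"] by (simp add: card_SL2_borel q)
  then show ?thesis by (simp add: algebra_simps)
qed

lemma card_SL2_unip:
  assumes "\<one> \<noteq> \<ominus> \<one>"
  shows "card SL2_unip = 2 * card (carrier R)"
proof -
  have "SL2_unip = (\<lambda>(t, s). (t, s, \<zero>, t)) ` ({\<one>, \<ominus> \<one>} \<times> carrier R)"
    by (auto simp: mem_SL2_unip image_iff)
  then have "card SL2_unip = card ({\<one>, \<ominus> \<one>} \<times> carrier R)"
    by (simp only:) (rule card_image, auto simp: inj_on_def)
  then show ?thesis using assms by (simp add: card_cartesian_product)
qed

text \<open>Outside the Borel subgroup c is nonzero, so an element common to two Borel subgroups is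
  determined by its diagonal.\<close>

lemma conj_SL2_borel_solve:
  assumes x: "x \<in> carrier (SL2 R)" "x \<notin> SL2_borel" "x = (a, b, c, d)"
    and u: "u \<in> SL2_borel" "u = (t, s, \<zero>, t')"
    and conj: "inv\<^bsub>SL2 R\<^esub> x \<otimes>\<^bsub>SL2 R\<^esub> u \<otimes>\<^bsub>SL2 R\<^esub> x \<in> SL2_borel"
  shows "s = inv c \<otimes> (a \<otimes> (t' \<ominus> t))"
proof -
  have car: "a \<in> carrier R" "c \<in> carrier R" "c \<noteq> \<zero>"
    "t \<in> carrier R" "s \<in> carrier R" "t' \<in> carrier R"
    using x u by (auto simp: mem_SL2 SL2_borel_def)
  have "a \<otimes> (t' \<ominus> t) \<ominus> c \<otimes> s = \<zero>"
    using integral[OF conj_SL2_borel[OF x(1,3) u conj]] car by auto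
  then have "a \<otimes> (t' \<ominus> t) = c \<otimes> s" using car by (simp add: r_right_minus_eq)
  moreover have "inv c \<otimes> (c \<otimes> s) = s"
    using car units_inv[OF car(2,3)] by (simp flip: m_assoc)
  ultimately show ?thesis by simp
qed

lemma card_SL2_borel_meet:
  assumes fin: "finite (carrier R)" and x: "x \<in> carrier (SL2 R)" "x \<notin> SL2_borel"
  shows "card {u \<in> SL2_borel. inv\<^bsub>SL2 R\<^esub> x \<otimes>\<^bsub>SL2 R\<^esub> u \<otimes>\<^bsub>SL2 R\<^esub> x \<in> SL2_borel} \<le> card (carrier R) - 1"
proof -
  let ?A = "{u \<in> SL2_borel. inv\<^bsub>SL2 R\<^esub> x \<otimes>\<^bsub>SL2 R\<^esub> u \<otimes>\<^bsub>SL2 R\<^esub> x \<in> SL2_borel}"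
  obtain a b c d where abcd: "x = (a, b, c, d)" by (cases x)
  have "?A \<subseteq> (\<lambda>t. (t, inv c \<otimes> (a \<otimes> (inv t \<ominus> t)), \<zero>, inv t)) ` (carrier R - {\<zero>})"
  proof
    fix u assume u: "u \<in> ?A"
    then obtain t s where ts: "u = (t, s, \<zero>, inv t)" "t \<in> carrier R - {\<zero>}"
      by (auto simp: SL2_borel_eq)
    have "s = inv c \<otimes> (a \<otimes> (inv t \<ominus> t))"
      using conj_SL2_borel_solve[OF x abcd _ ts(1)] u by simp
    then show "u \<in> (\<lambda>t. (t, inv c \<otimes> (a \<otimes> (inv t \<ominus> t)), \<zero>, inv t)) ` (carrier R - {\<zero>})"
      using ts by auto
  qed
  then have "card ?A \<le> card (carrier R - {\<zero>})"
    using fin by (intro surj_card_le) auto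
  then show ?thesis by (simp add: card_Diff_singleton)
qed

text \<open>Equal diagonal entries make the formula for the upper right entry vanish, which leaves a
  scalar.\<close>

lemma SL2_unip_meet:
  assumes x: "x \<in> carrier (SL2 R)" "x \<notin> SL2_borel" and u: "u \<in> SL2_unip"
    and conj: "inv\<^bsub>SL2 R\<^esub> x \<otimes>\<^bsub>SL2 R\<^esub> u \<otimes>\<^bsub>SL2 R\<^esub> x \<in> SL2_unip"
  shows "u \<in> SL2_scalars R"
proof -
  obtain a b c d where abcd: "x = (a, b, c, d)" by (cases x)
  obtain t s where ts: "u = (t, s, \<zero>, t)" "t = \<one> \<or> t = \<ominus> \<one>"
    using u by (cases u) (auto simp: mem_SL2_unip)
  have car: "t \<in> carrier R" "a \<in> carrier R" "c \<in> carrier R" "c \<noteq> \<zero>"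
    using ts x abcd by (auto simp: mem_SL2 SL2_borel_def)
  have "s = inv c \<otimes> (a \<otimes> (t \<ominus> t))"
    using conj_SL2_borel_solve[OF x abcd _ ts(1)] u conj SL2_unip_subset by blast
  then have "s = \<zero>" using car units_inv[OF car(3,4)] by (simp add: minus_eq r_neg)
  then show ?thesis using ts by (auto simp: SL2_scalars_eq)
qed

text \<open>All sets involved are saturated under the scalars, a group of order 2 since q is odd.
  Passing to the quotient therefore halves their sizes, and membership can be tested on
  representatives.\<close>

lemma borel_pair_PSL2:
  assumes fin: "finite (carrier R)" and q: "card (carrier R) = q" "odd q" "q \<ge> 5"
  shows "\<exists>B U. borel_pair (PSL2 R) B U q"
proof -
  define Z where "Z = SL2_scalars R"
  interpret S: group "SL2 R" by (rule group_SL2)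
  interpret Z: normal Z "SL2 R" unfolding Z_def by (rule normal_SL2_scalars)
  define h where "h x = Z #>\<^bsub>SL2 R\<^esub> x" for x
  interpret Q: group "PSL2 R" unfolding PSL2_def Z_def[symmetric] by (rule Z.factorgroup_is_group)
  interpret h: group_hom "SL2 R" "PSL2 R" h
  proof (intro group_hom.intro group_hom_axioms.intro S.is_group Q.is_group)
    show "h \<in> hom (SL2 R) (PSL2 R)"
      unfolding h_def[abs_def] PSL2_def Z_def[symmetric] by (rule Z.r_coset_hom_Mod)
  qed
  have pm: "\<one> \<noteq> \<ominus> \<one>" using one_neq_minus_one fin q by simp
  have cardZ: "card Z = 2" using pm by (simp add: Z_def SL2_scalars_eq)
  have finS: "finite (carrier (SL2 R))"
    using card_SL2[OF fin q(1)] q by (intro card_ge_0_finite) simp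
  have surj: "carrier (PSL2 R) = h ` carrier (SL2 R)"
    by (auto simp: PSL2_def Z_def h_def FactGroup_def RCOSETS_def)
  have Z_U: "Z \<subseteq> SL2_unip" unfolding Z_def by (rule SL2_scalars_subset)
  have sub: "SL2_unip \<subseteq> carrier (SL2 R)" "SL2_borel \<subseteq> carrier (SL2 R)"
    by (auto simp: SL2_unip_def SL2_borel_def)
  have sat_U: "z \<otimes>\<^bsub>SL2 R\<^esub> a \<in> SL2_unip" if "z \<in> Z" "a \<in> SL2_unip" for z a
    using that Z_U subgroup.m_closed[OF subgroup_SL2_unip] by blast
  have sat_B: "z \<otimes>\<^bsub>SL2 R\<^esub> a \<in> SL2_borel" if "z \<in> Z" "a \<in> SL2_borel" for z a
    using that Z_U SL2_unip_subset subgroup.m_closed[OF subgroup_SL2_borel] by blast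
  have card_h: "2 * card (h ` A) = card A"
    if "A \<subseteq> carrier (SL2 R)" "\<And>z a. z \<in> Z \<Longrightarrow> a \<in> A \<Longrightarrow> z \<otimes>\<^bsub>SL2 R\<^esub> a \<in> A" for A
    using Z.card_image_cosets[OF finS that] cardZ by (simp add: h_def[abs_def])
  have mem_U: "h x \<in> h ` SL2_unip \<longleftrightarrow> x \<in> SL2_unip" if "x \<in> carrier (SL2 R)" for x
    using Z.coset_image_mem_iff[OF sub(1) sat_U that] by (simp add: h_def[abs_def])
  have mem_B: "h x \<in> h ` SL2_borel \<longleftrightarrow> x \<in> SL2_borel" if "x \<in> carrier (SL2 R)" for x
    using Z.coset_image_mem_iff[OF sub(2) sat_B that] by (simp add: h_def[abs_def])
  have "borel_pair (PSL2 R) (h ` SL2_borel) (h ` SL2_unip) q"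
  proof (intro borel_pair.intro borel_pair_axioms.intro Q.is_group)
    show "finite (carrier (PSL2 R))" unfolding surj using finS by simp
    show "q \<ge> 5" using q by simp
    show "subgroup (h ` SL2_borel) (PSL2 R)" "subgroup (h ` SL2_unip) (PSL2 R)"
      using subgroup_SL2_borel subgroup_SL2_unip by (auto intro: h.subgroup_img_is_subgroup)
    show "h ` SL2_unip \<subseteq> h ` SL2_borel" using SL2_unip_subset by blast
    show "card (h ` SL2_unip) = q"
      using card_h[OF sub(1) sat_U] card_SL2_unip[OF pm] q by simp
    show "2 * card (h ` SL2_borel) = q * (q - 1)"
      using card_h[OF sub(2) sat_B] card_SL2_borel q by simp
    show "2 * card (carrier (PSL2 R)) = q * (q - 1) * (q + 1)"
      unfolding surj using card_h[of "carrier (SL2 R)"] card_SL2[OF fin q(1)] Z_U sub by auto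
  next
    fix a b assume "a \<in> h ` SL2_borel" "b \<in> h ` SL2_borel"
    then obtain x y where xy: "x \<in> SL2_borel" "a = h x" "y \<in> SL2_borel" "b = h y" by blast
    moreover from this sub have "x \<in> carrier (SL2 R)" "y \<in> carrier (SL2 R)" by blast+
    ultimately have "inv\<^bsub>PSL2 R\<^esub> a \<otimes>\<^bsub>PSL2 R\<^esub> inv\<^bsub>PSL2 R\<^esub> b \<otimes>\<^bsub>PSL2 R\<^esub> a \<otimes>\<^bsub>PSL2 R\<^esub> b =
        h (inv\<^bsub>SL2 R\<^esub> x \<otimes>\<^bsub>SL2 R\<^esub> inv\<^bsub>SL2 R\<^esub> y \<otimes>\<^bsub>SL2 R\<^esub> x \<otimes>\<^bsub>SL2 R\<^esub> y)"
      by simp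
    then show "inv\<^bsub>PSL2 R\<^esub> a \<otimes>\<^bsub>PSL2 R\<^esub> inv\<^bsub>PSL2 R\<^esub> b \<otimes>\<^bsub>PSL2 R\<^esub> a \<otimes>\<^bsub>PSL2 R\<^esub> b \<in> h ` SL2_unip"
      using borel_SL2_comm[OF xy(1,3)] by simp
  next
    fix y assume "y \<in> carrier (PSL2 R)" "y \<notin> h ` SL2_borel"
    then obtain x where x: "x \<in> carrier (SL2 R)" "y = h x" "x \<notin> SL2_borel"
      unfolding surj by blast
    let ?A = "{u \<in> SL2_borel. inv\<^bsub>SL2 R\<^esub> x \<otimes>\<^bsub>SL2 R\<^esub> u \<otimes>\<^bsub>SL2 R\<^esub> x \<in> SL2_borel}"
    have conj_h: "inv\<^bsub>PSL2 R\<^esub> y \<otimes>\<^bsub>PSL2 R\<^esub> h u \<otimes>\<^bsub>PSL2 R\<^esub> y = h (inv\<^bsub>SL2 R\<^esub> x \<otimes>\<^bsub>SL2 R\<^esub> u \<otimes>\<^bsub>SL2 R\<^esub> x)"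
      if "u \<in> carrier (SL2 R)" for u
      using that x by simp
    have closed: "inv\<^bsub>SL2 R\<^esub> x \<otimes>\<^bsub>SL2 R\<^esub> u \<otimes>\<^bsub>SL2 R\<^esub> x \<in> carrier (SL2 R)"
      if "u \<in> carrier (SL2 R)" for u using that x by simp
    \<comment> \<open>The intersection in the quotient is the image of the intersection upstairs,
      because the Borel subgroup contains the scalars.\<close>
    have "{b \<in> h ` SL2_borel. inv\<^bsub>PSL2 R\<^esub> y \<otimes>\<^bsub>PSL2 R\<^esub> b \<otimes>\<^bsub>PSL2 R\<^esub> y \<in> h ` SL2_borel} = h ` ?A"
    proof (intro subset_antisym subsetI)
      fix b assume "b \<in> {b \<in> h ` SL2_borel. inv\<^bsub>PSL2 R\<^esub> y \<otimes>\<^bsub>PSL2 R\<^esub> b \<otimes>\<^bsub>PSL2 R\<^esub> y \<in> h ` SL2_borel}"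
      then obtain u where u: "u \<in> SL2_borel" "b = h u" "inv\<^bsub>PSL2 R\<^esub> y \<otimes>\<^bsub>PSL2 R\<^esub> h u \<otimes>\<^bsub>PSL2 R\<^esub> y \<in> h ` SL2_borel"
        by blast
      have uc: "u \<in> carrier (SL2 R)" using u(1) sub by blast
      have "u \<in> ?A" using u(1,3) conj_h[OF uc] mem_B[OF closed[OF uc]] by simp
      then show "b \<in> h ` ?A" using u(2) by blast
    next
      fix b assume "b \<in> h ` ?A"
      then obtain u where u: "u \<in> ?A" "b = h u" by (rule imageE)
      then have uc: "u \<in> carrier (SL2 R)" using sub by blast
      show "b \<in> {b \<in> h ` SL2_borel. inv\<^bsub>PSL2 R\<^esub> y \<otimes>\<^bsub>PSL2 R\<^esub> b \<otimes>\<^bsub>PSL2 R\<^esub> y \<in> h ` SL2_borel}"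
        using u conj_h[OF uc] by auto
    qed
    \<comment> \<open>Scalars are central, so they pass through the conjugation by x and preserve
      \<open>?A\<close>.\<close>
    moreover have "2 * card (h ` ?A) = card ?A"
    proof (rule card_h)
      show "?A \<subseteq> carrier (SL2 R)" using sub by blast
    next
      fix z u assume z: "z \<in> Z" and u: "u \<in> ?A"
      have zc: "z \<in> carrier (SL2 R)" and uc: "u \<in> carrier (SL2 R)" using z u Z_U sub by auto
      have "inv\<^bsub>SL2 R\<^esub> x \<otimes>\<^bsub>SL2 R\<^esub> (z \<otimes>\<^bsub>SL2 R\<^esub> u) \<otimes>\<^bsub>SL2 R\<^esub> x =
          (inv\<^bsub>SL2 R\<^esub> x \<otimes>\<^bsub>SL2 R\<^esub> z) \<otimes>\<^bsub>SL2 R\<^esub> u \<otimes>\<^bsub>SL2 R\<^esub> x"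
        using x zc uc by (simp add: S.m_assoc)
      also have "inv\<^bsub>SL2 R\<^esub> x \<otimes>\<^bsub>SL2 R\<^esub> z = z \<otimes>\<^bsub>SL2 R\<^esub> inv\<^bsub>SL2 R\<^esub> x"
        using scalar_mult_SL2[of z "inv\<^bsub>SL2 R\<^esub> x"] z x by (simp add: Z_def)
      also have "z \<otimes>\<^bsub>SL2 R\<^esub> inv\<^bsub>SL2 R\<^esub> x \<otimes>\<^bsub>SL2 R\<^esub> u \<otimes>\<^bsub>SL2 R\<^esub> x =
          z \<otimes>\<^bsub>SL2 R\<^esub> (inv\<^bsub>SL2 R\<^esub> x \<otimes>\<^bsub>SL2 R\<^esub> u \<otimes>\<^bsub>SL2 R\<^esub> x)"
        using x zc uc by (simp add: S.m_assoc)
      finally show "z \<otimes>\<^bsub>SL2 R\<^esub> u \<in> ?A" using sat_B z u by simp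
    qed
    moreover have "card ?A \<le> q - 1" using card_SL2_borel_meet[OF fin x(1,3)] q by simp
    ultimately show "2 * card {b \<in> h ` SL2_borel. inv\<^bsub>PSL2 R\<^esub> y \<otimes>\<^bsub>PSL2 R\<^esub> b \<otimes>\<^bsub>PSL2 R\<^esub> y \<in> h ` SL2_borel} \<le> q - 1"
      by simp
  next
    fix y b assume y: "y \<in> carrier (PSL2 R)" "y \<notin> h ` SL2_borel" and b: "b \<in> h ` SL2_unip"
      and conj: "inv\<^bsub>PSL2 R\<^esub> y \<otimes>\<^bsub>PSL2 R\<^esub> b \<otimes>\<^bsub>PSL2 R\<^esub> y \<in> h ` SL2_unip"
    from y obtain x where x: "x \<in> carrier (SL2 R)" "y = h x" "x \<notin> SL2_borel"
      unfolding surj by blast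
    from b obtain u where u: "u \<in> SL2_unip" "b = h u" by blast
    have uc: "u \<in> carrier (SL2 R)" using u sub by blast
    have "h (inv\<^bsub>SL2 R\<^esub> x \<otimes>\<^bsub>SL2 R\<^esub> u \<otimes>\<^bsub>SL2 R\<^esub> x) \<in> h ` SL2_unip"
      using conj x u uc by simp
    moreover have "inv\<^bsub>SL2 R\<^esub> x \<otimes>\<^bsub>SL2 R\<^esub> u \<otimes>\<^bsub>SL2 R\<^esub> x \<in> carrier (SL2 R)"
      using x uc by simp
    ultimately have "inv\<^bsub>SL2 R\<^esub> x \<otimes>\<^bsub>SL2 R\<^esub> u \<otimes>\<^bsub>SL2 R\<^esub> x \<in> SL2_unip"
      using mem_U by blast
    then have "u \<in> Z" using SL2_unip_meet[OF x(1,3) u(1)] by (simp add: Z_def)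
    then have "h u = Z" using S.coset_join2[OF uc Z.subgroup_axioms] by (simp add: h_def)
    then show "b = \<one>\<^bsub>PSL2 R\<^esub>" by (simp add: u(2) PSL2_def Z_def FactGroup_def)
  qed
  then show ?thesis by blast
qed

end

section \<open>Numerical bounds\<close>

text \<open>If R \<le> s, the right-hand side is at most s^2 - 1. Applied with s = sqrt n after
  cancelling n in the estimate of the defect.\<close>

lemma real_lt_of_square_le:
  fixes s R :: real
  assumes "0 \<le> s" "s\<^sup>2 \<le> (s + 1) * (R - 1)"
  shows "s < R"
proof (rule ccontr)
  assume "\<not> s < R"
  then have "(s + 1) * (R - 1) \<le> (s + 1) * (s - 1)" using assms(1) by (intro mult_left_mono) auto
  also have "\<dots> = s\<^sup>2 - 1" by (simp add: algebra_simps power2_eq_square)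
  finally show False using assms(2) by simp
qed

lemma one_plus_power_ge:
  fixes x :: real
  assumes "0 \<le> x" "k \<ge> 1"
  shows "x ^ k + 1 \<le> (x + 1) ^ k"
proof -
  obtain j where j: "k = Suc j" using assms(2) by (cases k) auto
  have "x ^ j \<le> (x + 1) ^ j" using assms(1) by (intro power_mono) auto
  then have "x * x ^ j \<le> x * (x + 1) ^ j" using assms(1) by (rule mult_left_mono)
  moreover have "1 \<le> (x + 1) ^ j" using assms(1) by simp
  ultimately show ?thesis by (simp add: j algebra_simps)
qed

text \<open>In each of the three cases of the main argument the defect \<open>g - n\<^sup>2\<close> exceeds \<open>n\<^sup>3\<^sup>/\<^sup>2 + n\<close>.\<close>
locale degree_bounds =
  fixes q s n h g :: real and k :: nat
  assumes q: "q \<ge> 5" and k: "k \<ge> 1" and h: "h \<ge> 1" and s: "s \<ge> 1" "s\<^sup>2 = n"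
    and g: "g = h * (q * (q\<^sup>2 - 1) / 2) ^ k"
begin

lemma s_powers: "n\<^sup>2 + n * s + n = s ^ 4 + s ^ 3 + s\<^sup>2"
  unfolding s(2)[symmetric] by (simp add: power2_eq_square power3_eq_cube power4_eq_xxxx)

text \<open>60 is the value at q = 5, the order of PSL_2(5).\<close>

lemma base_ge: "60 \<le> q * (q\<^sup>2 - 1) / 2"
proof -
  have "5 * 5 \<le> q * q" using q by (intro mult_mono) auto
  then have "5 * 24 \<le> q * (q\<^sup>2 - 1)" using q by (intro mult_mono) (auto simp: power2_eq_square)
  then show ?thesis by simp
qed

lemma g_ge_60: "60 ^ k \<le> g"
proof -
  have "60 ^ k \<le> (q * (q\<^sup>2 - 1) / 2) ^ k" using base_ge by (intro power_mono) auto
  also have "\<dots> \<le> h * (q * (q\<^sup>2 - 1) / 2) ^ k"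
    using h base_ge by (intro mult_right_mono[of 1 h, simplified]) auto
  finally show ?thesis by (simp add: g)
qed

text \<open>The hypothesis gives g \<ge> (5/3) n^2. A defect of at most n^(3/2) + n is then possible
  only for very small n, where g would be below 60.\<close>

lemma fixed_borel:
  assumes "n\<^sup>2 \<le> h * ((q + 1)\<^sup>2) ^ k"
  shows "n\<^sup>2 + n * s + n < g"
proof (rule ccontr)
  assume "\<not> ?thesis"
  then have contr: "g \<le> s ^ 4 + s ^ 3 + s\<^sup>2" using s_powers by simp
  \<comment> \<open>The constant 5/3 is the value at q = 5 of q(q-1)/(2(q+1)), the ratio of
    |PSL_2(q)| to (q+1)^2.\<close>
  have "0 \<le> (3 * q + 2) * (q - 5)" using q by simp
  then have "10 * (q + 1) \<le> 3 * (q * (q - 1))" by (simp add: algebra_simps)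
  then have "(10 * (q + 1)) * (q + 1) \<le> (3 * (q * (q - 1))) * (q + 1)"
    using q by (intro mult_right_mono) auto
  then have base: "5 / 3 * (q + 1)\<^sup>2 \<le> q * (q\<^sup>2 - 1) / 2"
    by (simp add: algebra_simps power2_eq_square)
  have "5 / 3 \<le> (5 / 3 :: real) ^ k" using k by (intro self_le_power) auto
  then have "5 / 3 * ((q + 1)\<^sup>2) ^ k \<le> (5 / 3) ^ k * ((q + 1)\<^sup>2) ^ k"
    by (intro mult_right_mono) auto
  also have "\<dots> \<le> (q * (q\<^sup>2 - 1) / 2) ^ k"
    unfolding power_mult_distrib[symmetric] using base by (intro power_mono) auto
  finally have "h * (5 / 3 * ((q + 1)\<^sup>2) ^ k) \<le> g"
    unfolding g using h by (intro mult_left_mono) auto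
  then have "5 / 3 * n\<^sup>2 \<le> g" using assms by simp
  moreover have "s ^ 4 = n\<^sup>2" unfolding s(2)[symmetric] by simp
  ultimately have "2 / 3 * n\<^sup>2 \<le> s ^ 3 + s\<^sup>2" using contr by linarith
  then have "s\<^sup>2 * (2 / 3 * s\<^sup>2) \<le> s\<^sup>2 * (s + 1)"
    unfolding s(2)[symmetric] by (simp add: algebra_simps power2_eq_square power3_eq_cube)
  then have *: "2 / 3 * s\<^sup>2 \<le> s + 1" using s(1) by (simp add: mult_le_cancel_left)
  \<comment> \<open>11/5 lies just above the positive root of (2/3) s^2 = s + 1.\<close>
  have s_lt: "s < 11 / 5"
  proof (rule ccontr)
    assume "\<not> s < 11 / 5"
    then have "11 / 5 * s \<le> s\<^sup>2" by (simp add: power2_eq_square)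
    with * \<open>\<not> s < 11 / 5\<close> show False by linarith
  qed
  have "s ^ 4 \<le> (11 / 5) ^ 4" "s ^ 3 \<le> (11 / 5) ^ 3" "s ^ 2 \<le> (11 / 5) ^ 2"
    using s_lt s(1) by (auto intro!: power_mono)
  then have "g < 60" using contr by (simp add: power_divide)
  moreover have "60 \<le> (60 :: real) ^ k" using k by (intro self_le_power) auto
  ultimately show False using g_ge_60 by simp
qed

text \<open>With D = |B|^k, where B is the Borel subgroup of one factor, \<open>n_le\<close> turns a
  small defect into D \<le> s^2 + s + 1, while \<open>gap\<close> bounds the right-hand side by (s +
  1) R with s < R. The contradiction is (R + 1) R \<le> D.\<close>

lemma no_fixed_borel:
  assumes gap: "(q ^ k * n)\<^sup>2 \<le> ((q * (q\<^sup>2 - 1) / 2) ^ k - (q ^ k)\<^sup>2) * (g - n\<^sup>2)"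
    and n_le: "n \<le> h * (q + 1) ^ k"
  shows "n\<^sup>2 + n * s + n < g"
proof (rule ccontr)
  assume "\<not> ?thesis"
  then have contr: "g \<le> s ^ 4 + s ^ 3 + s\<^sup>2" using s_powers by simp
  \<comment> \<open>\<rho> is |PSL_2(q)| divided by the square q^2 of the Steinberg degree.\<close>
  define \<rho> where "\<rho> = (q\<^sup>2 - 1) / (2 * q)"
  define R where "R = \<rho> ^ k"
  have qpos: "q > 0" using q by simp
  have "5 * q \<le> q * q" using q by (intro mult_right_mono) auto
  then have "2 * q \<le> q * q - 1" using q by linarith
  then have \<rho>: "\<rho> \<ge> 1" using qpos by (simp add: \<rho>_def power2_eq_square)
  have R: "R \<ge> 1" using \<rho> by (simp add: R_def)
  have base: "q * (q\<^sup>2 - 1) / 2 = q\<^sup>2 * \<rho>" using qpos by (simp add: \<rho>_def power2_eq_square)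
  have "(q ^ k)\<^sup>2 * n\<^sup>2 \<le> (q ^ k)\<^sup>2 * ((R - 1) * (g - n\<^sup>2))"
    using gap unfolding base by (simp add: R_def power_mult_distrib algebra_simps power_mult[symmetric] mult.commute)
  then have "n\<^sup>2 \<le> (R - 1) * (g - n\<^sup>2)" using qpos by (simp add: mult_le_cancel_left)
  also have "\<dots> \<le> (R - 1) * (s ^ 3 + s\<^sup>2)"
    using contr R by (intro mult_left_mono) (auto simp flip: s(2))
  finally have "s\<^sup>2 * s\<^sup>2 \<le> s\<^sup>2 * ((s + 1) * (R - 1))"
    unfolding s(2)[symmetric] by (simp add: algebra_simps power2_eq_square power3_eq_cube)
  then have *: "s\<^sup>2 \<le> (s + 1) * (R - 1)" by (rule mult_left_le_imp_le) (use s(1) in simp)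
  then have sR: "s < R" using s(1) by (intro real_lt_of_square_le) auto
  define D where "D = (q * (q - 1) / 2) ^ k"
  have "(q * (q\<^sup>2 - 1) / 2) ^ k = D * (q + 1) ^ k"
    unfolding D_def power_mult_distrib[symmetric]
    by (rule arg_cong[where f="\<lambda>x. x ^ k"]) (simp add: algebra_simps power2_eq_square)
  then have "g = D * (h * (q + 1) ^ k)" by (simp add: g)
  moreover have "D * n \<le> D * (h * (q + 1) ^ k)" using n_le q by (intro mult_left_mono) (auto simp: D_def)
  ultimately have "s\<^sup>2 * D \<le> s\<^sup>2 * (s\<^sup>2 + s + 1)"
    using contr s(2) by (simp add: algebra_simps power2_eq_square power3_eq_cube power4_eq_xxxx)
  then have "D \<le> s\<^sup>2 + s + 1" using s(1) by (simp add: mult_le_cancel_left)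
  also have "\<dots> \<le> (s + 1) * R" using * by (simp add: algebra_simps)
  also have "\<dots> < (R + 1) * R" using sR R by (intro mult_strict_right_mono) auto
  finally have DR: "D < (R + 1) * R" .
  have "(R + 1) * R \<le> (\<rho> + 1) ^ k * \<rho> ^ k"
    unfolding R_def using one_plus_power_ge[OF _ k, of \<rho>] \<rho> by (intro mult_right_mono) auto
  also have "\<dots> \<le> D"
    unfolding D_def power_mult_distrib[symmetric]
  proof (rule power_mono)
    \<comment> \<open>The cubic is the cofactor of q - 1 in 2 q^3 (q-1) - (q^2-1)(q^2 + 2q - 1),
      whose sign decides the comparison of bases.\<close>
    have "5 * (q * q) \<le> q * (q * q)" "5 * q \<le> q * q" using q by (auto intro!: mult_right_mono)
    then have "0 \<le> q * (q * q) - 3 * (q * q) - q + 1" using q by linarith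
    then have "0 \<le> (q - 1) * (q * (q * q) - 3 * (q * q) - q + 1)" using q by simp
    then have "(q\<^sup>2 - 1) * (q\<^sup>2 + 2 * q - 1) \<le> 2 * q\<^sup>2 * (q * (q - 1))"
      by (simp add: algebra_simps power2_eq_square)
    moreover have "(\<rho> + 1) * \<rho> = ((q\<^sup>2 - 1) * (q\<^sup>2 + 2 * q - 1)) / (4 * q\<^sup>2)"
      using qpos by (simp add: \<rho>_def field_simps power2_eq_square)
    moreover have "q * (q - 1) / 2 = (2 * q\<^sup>2 * (q * (q - 1))) / (4 * q\<^sup>2)"
      using qpos by (simp add: field_simps power2_eq_square)
    ultimately show "(\<rho> + 1) * \<rho> \<le> q * (q - 1) / 2"
      using qpos by (simp only:) (rule divide_right_mono, auto)
  qed (use \<rho> in auto)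
  finally show False using DR by simp
qed

text \<open>Since 2q(q+1) is less than 2(q+1)^2, a small defect forces s < R = 2^k. Each of the
  three powers of s that bound g is then at most 16^k, too little for g \<ge> 60^k.\<close>

lemma no_fixed_unipotent:
  assumes gap: "((q + 1) ^ k * n)\<^sup>2 \<le> ((2 * q * (q + 1)) ^ k - ((q + 1) ^ k)\<^sup>2) * (g - n\<^sup>2)"
    and g_ge: "n\<^sup>2 \<le> g"
  shows "n\<^sup>2 + n * s + n < g"
proof (rule ccontr)
  assume "\<not> ?thesis"
  then have contr: "g \<le> s ^ 4 + s ^ 3 + s\<^sup>2" using s_powers by simp
  define R :: real where "R = 2 ^ k"
  have R: "R \<ge> 1" by (simp add: R_def)
  have "(2 * q * (q + 1)) ^ k \<le> (2 * (q + 1)\<^sup>2) ^ k"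
    using q by (intro power_mono) (auto simp: power2_eq_square algebra_simps)
  also have "\<dots> = R * ((q + 1) ^ k)\<^sup>2"
    by (simp add: R_def power_mult_distrib power_mult[symmetric] mult.commute)
  finally have "((2 * q * (q + 1)) ^ k - ((q + 1) ^ k)\<^sup>2) * (g - n\<^sup>2) \<le>
      (R * ((q + 1) ^ k)\<^sup>2 - ((q + 1) ^ k)\<^sup>2) * (g - n\<^sup>2)"
    using g_ge by (intro mult_right_mono) auto
  with gap have "((q + 1) ^ k)\<^sup>2 * n\<^sup>2 \<le> ((q + 1) ^ k)\<^sup>2 * ((R - 1) * (g - n\<^sup>2))"
    by (simp add: power_mult_distrib algebra_simps)
  then have "n\<^sup>2 \<le> (R - 1) * (g - n\<^sup>2)" using q by (simp add: mult_le_cancel_left)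
  also have "\<dots> \<le> (R - 1) * (s ^ 3 + s\<^sup>2)"
    using contr R by (intro mult_left_mono) (auto simp flip: s(2))
  finally have "s\<^sup>2 * s\<^sup>2 \<le> s\<^sup>2 * ((s + 1) * (R - 1))"
    unfolding s(2)[symmetric] by (simp add: algebra_simps power2_eq_square power3_eq_cube)
  then have "s\<^sup>2 \<le> (s + 1) * (R - 1)" by (rule mult_left_le_imp_le) (use s(1) in simp)
  then have sR: "s < R" using s(1) by (intro real_lt_of_square_le) auto
  have "s ^ 4 < R ^ 4" "s ^ 3 \<le> R ^ 4" "s\<^sup>2 \<le> R ^ 4"
  proof -
    show "s ^ 4 < R ^ 4" using sR s(1) by (intro power_strict_mono) auto
    have "s ^ 3 \<le> R ^ 3" "s\<^sup>2 \<le> R\<^sup>2" using sR s(1) by (auto intro!: power_mono)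
    moreover have "R ^ 3 \<le> R ^ 4" "R\<^sup>2 \<le> R ^ 4" using R by (auto intro!: power_increasing)
    ultimately show "s ^ 3 \<le> R ^ 4" "s\<^sup>2 \<le> R ^ 4" by linarith+
  qed
  then have "g < 3 * R ^ 4" using contr by linarith
  also have "R ^ 4 = 16 ^ k" by (simp add: R_def power_mult[symmetric] mult.commute[of k]) (simp add: power_mult)
  finally have "g < 3 * 16 ^ k" .
  moreover have "3 * 16 ^ k \<le> (60 :: real) ^ k"
  proof -
    have "3 \<le> (60 / 16 :: real) ^ 1" by simp
    also have "\<dots> \<le> (60 / 16) ^ k" using k by (intro power_increasing) auto
    finally have "3 * 16 ^ k \<le> (60 / 16 :: real) ^ k * 16 ^ k" by (intro mult_right_mono) auto
    then show ?thesis by (simp flip: power_mult_distrib)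
  qed
  ultimately show False using g_ge_60 by simp
qed

end

text \<open>Dividing the defect bound by n gives the first claim. It implies n < (e-1)^2, and
  inserting this into g = n(n + e) leaves a polynomial below e^4 - e^3.\<close>

lemma large_defect_imp_bounds:
  fixes n g :: real
  assumes n: "n \<ge> 1" and g: "n\<^sup>2 + n * sqrt n + n < g"
  defines "e \<equiv> g / n - n"
  shows "e > sqrt n + 1 \<and> g < e ^ 4 - e ^ 3"
proof
  have "n * (n + sqrt n + 1) < g" using g by (simp add: algebra_simps power2_eq_square)
  then have "n + sqrt n + 1 < g / n" using n by (simp add: pos_less_divide_eq mult.commute)
  then show e: "e > sqrt n + 1" by (simp add: e_def)
  have s: "sqrt n \<ge> 1" using n by simp
  with e have e_gt: "e > 2" by linarith
  have "(sqrt n)\<^sup>2 < (e - 1)\<^sup>2" using e s by (intro power_strict_mono) auto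
  then have nlt: "n < (e - 1)\<^sup>2" using n by simp
  have "g = n * (n + e)" using n by (simp add: e_def field_simps)
  also have "\<dots> < (e - 1)\<^sup>2 * ((e - 1)\<^sup>2 + e)"
    using nlt n e_gt by (intro mult_strict_mono) auto
  also have "\<dots> = e ^ 4 - e ^ 3 - (e - 1) * (2 * e\<^sup>2 - 2 * e + 1)"
    by (simp add: power2_eq_square power3_eq_cube power4_eq_xxxx algebra_simps)
  also have "\<dots> \<le> e ^ 4 - e ^ 3"
  proof -
    have "2 * e\<^sup>2 - 2 * e + 1 = e\<^sup>2 + (e - 1)\<^sup>2"
      by (simp add: power2_eq_square algebra_simps)
    then have "0 \<le> 2 * e\<^sup>2 - 2 * e + 1" by (simp only:) (rule add_nonneg_nonneg, simp_all)
    then have "0 \<le> (e - 1) * (2 * e\<^sup>2 - 2 * e + 1)"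
      using e_gt by (intro mult_nonneg_nonneg) auto
    then show ?thesis by simp
  qed
  finally show "g < e ^ 4 - e ^ 3" .
qed

section \<open>The unipotent subgroup inside its Borel subgroup\<close>

context borel_pair
begin

text \<open>Elements of B normalize U because commutators lie in U; an element outside B that
  normalized U would make U trivial by \<open>U_meet\<close>.\<close>

lemma normalizer_U:
  assumes x: "x \<in> carrier P"
  shows "x \<in> B \<longleftrightarrow> (\<forall>u\<in>U. x \<otimes> u \<otimes> inv x \<in> U)"
proof
  assume xB: "x \<in> B"
  show "\<forall>u\<in>U. x \<otimes> u \<otimes> inv x \<in> U"
  proof
    fix u assume u: "u \<in> U"
    have uc: "u \<in> carrier P" using u U_carrier by blast
    \<comment> \<open>The commutator hypothesis at x^-1 and u^-1 reads x u x^-1 u^-1.\<close>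
    have "inv (inv x) \<otimes> inv (inv u) \<otimes> inv x \<otimes> inv u \<in> U"
      using xB u U_B subgroup.m_inv_closed[OF B_sub] by (intro comm) auto
    then have "(x \<otimes> u \<otimes> inv x \<otimes> inv u) \<otimes> u \<in> U"
      using x uc subgroup.m_closed[OF U_sub _ u] by simp
    then show "x \<otimes> u \<otimes> inv x \<in> U" using x uc by (simp add: m_assoc)
  qed
next
  assume norm: "\<forall>u\<in>U. x \<otimes> u \<otimes> inv x \<in> U"
  show "x \<in> B"
  proof (rule ccontr)
    assume "x \<notin> B"
    then have "inv x \<notin> B" using subgroup.m_inv_closed[OF B_sub, of "inv x"] x by auto
    then have "u = \<one>" if "u \<in> U" for u using U_meet[of "inv x" u] norm x that by simp
    then have "U \<subseteq> {\<one>}" by blast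
    then have "card U \<le> card {\<one>}" by (intro card_mono) auto
    then show False using card_U q_ge by simp
  qed
qed

text \<open>The quotient of B by U has order (q-1)/2, coprime to q, so the image of b is
  trivial.\<close>

lemma B_elements_of_q_power_order:
  assumes b: "b \<in> B" and pow: "b [^] (q ^ j) = \<one>"
  shows "b \<in> U"
proof -
  let ?B = "P\<lparr>carrier := B\<rparr>"
  interpret B: group ?B using B_sub is_group by (rule subgroup.subgroup_is_group)
  have U_sub': "subgroup U ?B" using U_sub B_sub U_B by (intro subgroup_incl)
  have "U \<lhd> ?B"
  proof (rule B.normal_invI[OF U_sub'])
    fix u x assume "u \<in> U" "x \<in> carrier ?B"
    then show "x \<otimes>\<^bsub>?B\<^esub> u \<otimes>\<^bsub>?B\<^esub> inv\<^bsub>?B\<^esub> x \<in> U"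
      using normalizer_U[of x] B_carrier B_sub by (auto simp: m_inv_consistent)
  qed
  then interpret U: normal U ?B .
  let ?h = "\<lambda>a. U #>\<^bsub>?B\<^esub> a"
  interpret Q: group "?B Mod U" by (rule U.factorgroup_is_group)
  interpret h: group_hom ?B "?B Mod U" ?h
    by (intro group_hom.intro group_hom_axioms.intro B.is_group Q.is_group U.r_coset_hom_Mod)
  have "order (?B Mod U) * q = card B"
    using B.lagrange[OF U_sub'] by (simp add: order_def FactGroup_def card_U)
  then have "q * (2 * order (?B Mod U)) = q * (q - 1)" using card_B by (simp only: mult_ac)
  then have c: "2 * order (?B Mod U) = q - 1" using q_ge by (simp only: mult_cancel1) simp
  have "coprime q (q - 1)" using q_ge coprime_diff_one_right_nat[of q] by simp
  then have "coprime q (order (?B Mod U))" unfolding c[symmetric] by simp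
  then have cop: "coprime (q ^ j) (order (?B Mod U))" by simp
  have hb: "?h b \<in> carrier (?B Mod U)" using h.hom_closed[of b] b by simp
  have "b [^]\<^bsub>?B\<^esub> (q ^ j) = \<one>\<^bsub>?B\<^esub>" using pow by (simp flip: nat_pow_consistent)
  then have "?h b [^]\<^bsub>?B Mod U\<^esub> (q ^ j) = \<one>\<^bsub>?B Mod U\<^esub>"
    using h.hom_nat_pow[of b "q ^ j"] h.hom_one b by simp
  then have "Q.ord (?h b) dvd q ^ j" using Q.pow_eq_id[OF hb] by blast
  moreover have "Q.ord (?h b) dvd order (?B Mod U)" using hb by (rule Q.ord_dvd_group_order)
  ultimately have "is_unit (Q.ord (?h b))" using cop by (rule coprime_common_divisor[rotated 1])
  then have "?h b = \<one>\<^bsub>?B Mod U\<^esub>" using hb Q.ord_eq_1 by auto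
  then have "U #>\<^bsub>?B\<^esub> b = U" by (simp add: FactGroup_def)
  then show ?thesis using b by (intro B.coset_join1[OF _ _ U_sub']) auto
qed

end

section \<open>Proof of the theorem\<close>

text \<open>Shows that the set of degrees is nonempty, as needed for its maximum to be
  attained.\<close>

lemma trivial_rep_irreducible:
  shows "irreducible_complex_rep G 1 (\<lambda>_. 1\<^sub>m 1)"
  unfolding irreducible_complex_rep_def
proof (intro conjI allI impI)
  show "complex_rep G 1 (\<lambda>_. 1\<^sub>m 1)" by (simp add: complex_rep_def)
  fix W assume "invariant_subspace G 1 (\<lambda>_. 1\<^sub>m 1) W"
  then have W: "W \<subseteq> carrier_vec 1" "0\<^sub>v 1 \<in> W" "\<And>c v. v \<in> W \<Longrightarrow> c \<cdot>\<^sub>v v \<in> W"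
    by (auto simp: invariant_subspace_def)
  show "W = {0\<^sub>v 1} \<or> W = carrier_vec 1"
  proof (cases "W = {0\<^sub>v 1}")
    case False
    then obtain w where w: "w \<in> W" "w \<noteq> 0\<^sub>v 1" using W(2) by blast
    have wc: "w \<in> carrier_vec 1" using w W(1) by blast
    have w0: "w $ 0 \<noteq> 0"
    proof
      assume "w $ 0 = 0"
      then have "w = 0\<^sub>v 1" using wc by (intro eq_vecI) auto
      then show False using w by simp
    qed
    have "v \<in> W" if v: "v \<in> carrier_vec 1" for v
    proof -
      have "v = (v $ 0 / w $ 0) \<cdot>\<^sub>v w" using v wc w0 by (intro eq_vecI) auto
      then show ?thesis using W(3)[OF w(1)] by metis
    qed
    then show ?thesis using W(1) by blast
  qed simp
qed simp

lemma irr_degrees_bounded: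
  assumes "group G" "finite (carrier G)" "n \<in> irr_degrees G"
  shows "n\<^sup>2 \<le> order G"
proof -
  obtain \<rho> where "irreducible_complex_rep G n \<rho>" using assms(3) by (auto simp: irr_degrees_def)
  then interpret irreducible_coeffs G n "\<lambda>g i j. \<rho> g $$ (i, j)"
    by (rule irreducible_coeffsI[OF assms(1,2)])
  show ?thesis by (rule degree_square_le)
qed

lemma b_max_mem:
  assumes "group G" "finite (carrier G)"
  shows "b_max G \<in> irr_degrees G"
  unfolding b_max_def
proof (rule Max_in)
  have "n \<le> order G" if "n \<in> irr_degrees G" for n
    using irr_degrees_bounded[OF assms that] power2_nat_le_imp_le by blast
  then show "finite (irr_degrees G)" by (meson finite_nat_set_iff_bounded_le)
  show "irr_degrees G \<noteq> {}" using trivial_rep_irreducible[of G] by (auto simp: irr_degrees_def)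
qed

lemma (in irreducible_coeffs) degree_defect:
  fixes P :: "('b, 'd) monoid_scheme" and k :: nat
  assumes pair: "borel_pair P B U q"
    and q: "Factorial_Ring.prime (p::nat)" "m > 0" "q = p ^ m" and k: "k \<ge> 1"
    and N: "N \<lhd> G" and iso: "G\<lparr>carrier := N\<rparr> \<cong> product_group {..<k} (\<lambda>_. P)"
  shows "(real n)\<^sup>2 + real n * sqrt (real n) + real n < real (order G)"
proof -
  interpret P: borel_pair P B U q by fact
  define M where "M = product_group {..<k} (\<lambda>_. P)"
  interpret M: group M unfolding M_def using P.is_group by simp
  have N_sub: "subgroup N G" using N by (simp add: normal_def)
  have NG: "group (G\<lparr>carrier := N\<rparr>)" using N_sub is_group by (rule subgroup.subgroup_is_group)
  \<comment> \<open>The isomorphism is taken from the direct power into G, so that elements of N are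
    given by coordinates.\<close>
  obtain \<iota> where \<iota>: "\<iota> \<in> hom M (G\<lparr>carrier := N\<rparr>)" "bij_betw \<iota> (carrier M) N"
    using group.iso_sym[OF NG iso] by (auto simp: is_iso_def iso_def M_def)
  have \<iota>_G: "\<iota> \<in> hom M G"
    using \<iota>(1) subgroup.subset[OF N_sub] by (auto simp: hom_def Pi_iff)
  have inj: "inj_on \<iota> (carrier M)" and img: "\<iota> ` carrier M = N"
    using \<iota>(2) by (auto simp: bij_betw_def)
  interpret \<iota>: group_hom M G \<iota> by unfold_locales fact
  have carM: "carrier M = (\<Pi>\<^sub>E i\<in>{..<k}. carrier P)" by (simp add: M_def)
  define pw where "pw H = (\<Pi>\<^sub>E i\<in>{..<k}. H)" for H :: "'b set"
  have pw_mem: "x \<in> pw H \<longleftrightarrow> x \<in> carrier M \<and> (\<forall>i<k. x i \<in> H)" if "H \<subseteq> carrier P" for x H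
    using that by (auto simp: pw_def carM PiE_iff)
  have pw_sub: "subgroup (pw H) M" if "subgroup H P" for H
    unfolding pw_def M_def using that P.is_group by (subst PiE_subgroup_product_group) auto
  define Bh where "Bh = \<iota> ` pw B"
  define Uh where "Uh = \<iota> ` pw U"
  have Bh: "subgroup Bh G" and Uh: "subgroup Uh G"
    unfolding Bh_def Uh_def using pw_sub P.B_sub P.U_sub by (auto intro: \<iota>.subgroup_img_is_subgroup)
  have pw_car: "pw B \<subseteq> carrier M" "pw U \<subseteq> carrier M" "pw U \<subseteq> pw B"
    using pw_mem[OF P.B_carrier] pw_mem[OF P.U_carrier] P.U_B by auto
  have subs: "Uh \<subseteq> Bh" "Bh \<subseteq> N"
    using pw_car img by (auto simp: Bh_def Uh_def)
  have card_pw: "card (pw H) = card H ^ k" for H by (simp add: pw_def card_PiE)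
  have card_Bh: "card Bh = card B ^ k" and card_Uh: "card Uh = q ^ k"
    unfolding Bh_def Uh_def using inj_on_subset[OF inj pw_car(1)] inj_on_subset[OF inj pw_car(2)]
    by (simp_all add: card_image card_pw P.card_U)
  have card_N: "card N = card (carrier P) ^ k"
    using bij_betw_same_card[OF \<iota>(2)] card_pw[of "carrier P"] by (simp add: carM pw_def)
  have card_N_B: "card N = card Bh * (q + 1) ^ k"
  proof -
    have "real (card (carrier P)) = real (card B * (q + 1))" using P.real_card_P by (simp add: algebra_simps)
    then have "card (carrier P) = card B * (q + 1)" using of_nat_eq_iff by blast
    then show ?thesis by (simp only: card_N card_Bh power_mult_distrib)
  qed

  have mem_Bh: "\<iota> x \<in> Bh \<longleftrightarrow> x \<in> pw B" and mem_Uh: "\<iota> x \<in> Uh \<longleftrightarrow> x \<in> pw U" if "x \<in> carrier M" for x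
    unfolding Bh_def Uh_def using inj_on_image_mem_iff[OF inj that] pw_car by auto
  have mult_M: "(x \<otimes>\<^bsub>M\<^esub> y) i = x i \<otimes>\<^bsub>P\<^esub> y i" if "i < k" for x y i using that by (simp add: M_def)
  have inv_M: "(inv\<^bsub>M\<^esub> x) i = inv\<^bsub>P\<^esub> x i" if "i < k" "x \<in> carrier M" for x i
    using that P.is_group by (simp add: M_def)
  have pow_M: "(x [^]\<^bsub>M\<^esub> j) i = x i [^]\<^bsub>P\<^esub> j" if "i < k" for x i and j :: nat
    by (induction j) (use that in \<open>simp_all add: mult_M\<close>, simp add: M_def that)
  \<comment> \<open>Checked in each coordinate; the exponent p^(m k) is q^k.\<close>
  have p_elements: "b \<in> Uh" if b: "b \<in> Bh" and pow: "b [^] (p ^ (m * k)) = \<one>" for b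
  proof -
    obtain x where x: "x \<in> pw B" "b = \<iota> x" using b by (auto simp: Bh_def)
    have xM: "x \<in> carrier M" using x pw_car by auto
    have "\<iota> (x [^]\<^bsub>M\<^esub> (p ^ (m * k))) = \<iota> \<one>\<^bsub>M\<^esub>"
      using pow \<iota>.hom_nat_pow[OF xM, of "p ^ (m * k)"] by (simp add: x(2))
    then have one: "x [^]\<^bsub>M\<^esub> (p ^ (m * k)) = \<one>\<^bsub>M\<^esub>"
      by (rule inj_onD[OF inj]) (use xM in auto)
    have "x i \<in> U" if i: "i < k" for i
    proof (rule P.B_elements_of_q_power_order)
      show "x i \<in> B" using x(1) i pw_mem[OF P.B_carrier] by blast
      have "x i [^]\<^bsub>P\<^esub> (p ^ (m * k)) = \<one>\<^bsub>P\<^esub>"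
        using arg_cong[OF one, of "\<lambda>f. f i"] i by (simp add: pow_M) (simp add: M_def)
      then show "x i [^]\<^bsub>P\<^esub> (q ^ k) = \<one>\<^bsub>P\<^esub>" by (simp add: q(3) power_mult)
    qed
    then have "x \<in> pw U" using xM pw_mem[OF P.U_carrier] by blast
    then show ?thesis by (simp add: x(2) Uh_def)
  qed
  have normalizer: "y \<in> Bh \<longleftrightarrow> (\<forall>u\<in>Uh. y \<otimes> u \<otimes> inv y \<in> Uh)" if "y \<in> N" for y
  proof -
    have "y \<in> \<iota> ` carrier M" using that img by simp
    then obtain x where x: "y = \<iota> x" "x \<in> carrier M" by (rule imageE)
    have conj: "\<iota> x \<otimes> \<iota> u \<otimes> inv (\<iota> x) \<in> Uh \<longleftrightarrow> (\<forall>i<k. x i \<otimes>\<^bsub>P\<^esub> u i \<otimes>\<^bsub>P\<^esub> inv\<^bsub>P\<^esub> x i \<in> U)"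
      if "u \<in> carrier M" for u
    proof -
      have c: "x \<otimes>\<^bsub>M\<^esub> u \<otimes>\<^bsub>M\<^esub> inv\<^bsub>M\<^esub> x \<in> carrier M" using x that by simp
      have "\<iota> x \<otimes> \<iota> u \<otimes> inv (\<iota> x) = \<iota> (x \<otimes>\<^bsub>M\<^esub> u \<otimes>\<^bsub>M\<^esub> inv\<^bsub>M\<^esub> x)" using x that by simp
      also have "\<dots> \<in> Uh \<longleftrightarrow> (\<forall>i<k. (x \<otimes>\<^bsub>M\<^esub> u \<otimes>\<^bsub>M\<^esub> inv\<^bsub>M\<^esub> x) i \<in> U)"
        by (simp only: mem_Uh[OF c] pw_mem[OF P.U_carrier] c simp_thms)
      finally show ?thesis using x by (simp add: mult_M inv_M)
    qed
    have x_car: "x i \<in> carrier P" if "i < k" for i using x(2) that by (auto simp: carM)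
    have "(\<forall>u\<in>Uh. y \<otimes> u \<otimes> inv y \<in> Uh) \<longleftrightarrow>
        (\<forall>u\<in>pw U. \<iota> x \<otimes> \<iota> u \<otimes> inv (\<iota> x) \<in> Uh)"
      by (simp add: Uh_def x(1))
    also have "\<dots> \<longleftrightarrow> (\<forall>u\<in>pw U. \<forall>i<k. x i \<otimes>\<^bsub>P\<^esub> u i \<otimes>\<^bsub>P\<^esub> inv\<^bsub>P\<^esub> x i \<in> U)"
      by (intro ball_cong refl conj) (use pw_car(2) in blast)
    also have "\<dots> \<longleftrightarrow> (\<forall>i<k. \<forall>u\<in>U. x i \<otimes>\<^bsub>P\<^esub> u \<otimes>\<^bsub>P\<^esub> inv\<^bsub>P\<^esub> x i \<in> U)"
    proof (intro iffI allI impI ballI)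
      fix i u assume all: "\<forall>u\<in>pw U. \<forall>i<k. x i \<otimes>\<^bsub>P\<^esub> u i \<otimes>\<^bsub>P\<^esub> inv\<^bsub>P\<^esub> x i \<in> U" and i: "i < k" and u: "u \<in> U"
      \<comment> \<open>The constant tuple u tests the condition at coordinate i.\<close>
      have "(\<lambda>j\<in>{..<k}. u) \<in> pw U" using u by (auto simp: pw_def)
      then show "x i \<otimes>\<^bsub>P\<^esub> u \<otimes>\<^bsub>P\<^esub> inv\<^bsub>P\<^esub> x i \<in> U" using all i by fastforce
    next
      fix u i assume "\<forall>i<k. \<forall>u\<in>U. x i \<otimes>\<^bsub>P\<^esub> u \<otimes>\<^bsub>P\<^esub> inv\<^bsub>P\<^esub> x i \<in> U" "u \<in> pw U" "i < k"
      then show "x i \<otimes>\<^bsub>P\<^esub> u i \<otimes>\<^bsub>P\<^esub> inv\<^bsub>P\<^esub> x i \<in> U" by (auto simp: pw_def)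
    qed
    also have "\<dots> \<longleftrightarrow> (\<forall>i<k. x i \<in> B)" using P.normalizer_U x_car by blast
    also have "\<dots> \<longleftrightarrow> y \<in> Bh" by (simp add: x(1) mem_Bh[OF x(2)] pw_mem[OF P.B_carrier] x(2))
    finally show ?thesis by simp
  qed
  define K where "K = {g \<in> carrier G. \<forall>b\<in>Bh. g \<otimes> b \<otimes> inv g \<in> Bh}"
  have frattini: "order G * card Bh \<le> card N * card K"
    unfolding K_def order_def
  proof (rule frattini_count[OF fin N Bh Uh subs q(1) _ card_N_B _ p_elements normalizer])
    show "card Uh = p ^ (m * k)" by (simp add: card_Uh q(3) power_mult)
    show "\<not> p dvd (q + 1) ^ k"
    proof
      assume "p dvd (q + 1) ^ k"
      then have "p dvd q + 1" using q(1) prime_dvd_power by blast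
      moreover have "p dvd q" using q(2,3) by simp
      ultimately have "p dvd 1" by (metis dvd_add_right_iff)
      then show False using q(1) by simp
    qed
  qed

  define h where "h = real (order G) / real (card N)"
  have card_N_pos: "card N > 0"
    using finite_subset[OF subgroup.subset[OF N_sub] fin] subgroup.one_closed[OF N_sub]
    by (auto simp: card_gt_0_iff)
  have card_Bh_pos: "card Bh > 0" using card_N_pos card_N_B by (auto intro: Nat.gr0I)
  have "card N \<le> order G"
    unfolding order_def by (rule card_mono[OF fin subgroup.subset[OF N_sub]])
  then have h1: "h \<ge> 1" using card_N_pos by (simp add: h_def)
  have g_h: "real (order G) = h * real (card N)" using card_N_pos by (simp add: h_def)
  have N_Bh: "real (card N) = real (card Bh) * (real q + 1) ^ k"
    by (simp add: card_N_B add.commute)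
  have card_P': "real (card (carrier P)) = real q * ((real q)\<^sup>2 - 1) / 2"
    unfolding P.real_card_P P.real_card_B by (simp add: algebra_simps power2_eq_square)
  interpret bd: degree_bounds "real q" "sqrt (real n)" "real n" h "real (order G)" k
  proof
    show "real q \<ge> 5" using P.q_ge by simp
    show "sqrt (real n) \<ge> 1" using n_pos by simp
    show "real (order G) = h * (real q * ((real q)\<^sup>2 - 1) / 2) ^ k"
      unfolding g_h by (simp add: card_N card_P')
  qed (use k h1 in auto)
  show ?thesis
  proof (cases "\<exists>v i0. i0 < n \<and> v i0 \<noteq> 0 \<and> (\<forall>b\<in>Bh. \<forall>i<n. act b v i = v i)")
    case True
    then obtain v i0 where v: "i0 < n" "v i0 \<noteq> 0" "\<And>b i. b \<in> Bh \<Longrightarrow> i < n \<Longrightarrow> act b v i = v i"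
      by blast
    have "n\<^sup>2 * (card Bh * card K) \<le> (order G)\<^sup>2"
      by (rule degree_sq_le_fixed_vector[OF Bh v]) (auto simp: K_def)
    then have sq: "real (n\<^sup>2 * (card Bh * card K)) \<le> real ((order G)\<^sup>2)" by (rule of_nat_mono)
    have "real (order G * card Bh) \<le> real (card N * card K)" using frattini by (rule of_nat_mono)
    \<comment> \<open>Multiplying the Frattini bound by n^2 |Bh| produces n^2 |Bh| |K|, which the
      fixed-vector bound replaces by |G|^2. The unknown |K| disappears and |G| |Bh|^2
      cancels.\<close>
    then have "(real n)\<^sup>2 * real (card Bh) * (real (order G) * real (card Bh)) \<le>
        (real n)\<^sup>2 * real (card Bh) * (real (card N) * real (card K))"
      by (intro mult_left_mono) auto
    also have "\<dots> \<le> real (card N) * (real (order G))\<^sup>2"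
      using mult_left_mono[OF sq, of "real (card N)"] by (simp add: mult_ac)
    also have "\<dots> = real (order G) * (real (card N) * (h * real (card N)))"
      unfolding g_h[symmetric] by (simp add: power2_eq_square)
    also have "real (card N) * (h * real (card N)) = (real (card Bh))\<^sup>2 * (h * ((real q + 1)\<^sup>2) ^ k)"
      by (simp add: N_Bh power2_eq_square power_mult_distrib mult_ac)
    finally have "(real (order G) * (real (card Bh))\<^sup>2) * (real n)\<^sup>2 \<le>
        (real (order G) * (real (card Bh))\<^sup>2) * (h * ((real q + 1)\<^sup>2) ^ k)"
      by (simp add: power2_eq_square mult_ac)
    then have "(real n)\<^sup>2 \<le> h * ((real q + 1)\<^sup>2) ^ k"
      by (rule mult_left_le_imp_le) (use order_pos card_Bh_pos in simp)
    then show ?thesis by (rule bd.fixed_borel)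
  next
    case no_B: False
    have "(P.st \<one>\<^bsub>P\<^esub> ^ k * real n)\<^sup>2 \<le>
        ((\<Sum>x\<in>carrier P. (P.st x)\<^sup>2) ^ k - (P.st \<one>\<^bsub>P\<^esub> ^ k)\<^sup>2) * (real (order G) - (real n)\<^sup>2)"
    \<comment> \<open>The Boolean in \<open>J\<close> separates the two parts of the Steinberg
      character: conjugates of B with sign +1, and left cosets with sign -1 for the constant
      1.\<close>
    proof (rule degree_gap_product[OF P.is_group P.finite_P P.B_sub,
          where k=k and \<iota>=\<iota> and f=P.st and J="carrier P \<times> {True, False}"
            and a="\<lambda>j. inv\<^bsub>P\<^esub> (fst j)" and c="\<lambda>j. if snd j then fst j else \<one>\<^bsub>P\<^esub>"
            and w="\<lambda>j. (if snd j then 1 else -1) / real (card B)"])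
      show "P.st x = (\<Sum>j\<in>carrier P \<times> {True, False}. (if snd j then 1 else - 1) / real (card B) *
          indicator B (inv\<^bsub>P\<^esub> fst j \<otimes>\<^bsub>P\<^esub> x \<otimes>\<^bsub>P\<^esub> (if snd j then fst j else \<one>\<^bsub>P\<^esub>)))"
        if "x \<in> carrier P" for x
        using P.st_expand[OF that] by (simp add: case_prod_beta)
      show "v i = 0" if "\<And>h i. h \<in> (\<Pi>\<^sub>E i\<in>{..<k}. B) \<Longrightarrow> i < n \<Longrightarrow> act (\<iota> h) v i = v i" "i < n" for v i
        using no_B that unfolding Bh_def pw_def by blast
    qed (use \<iota>_G inj P.finite_P in \<open>auto simp: M_def\<close>)
    also have "\<dots> \<le> (real (card (carrier P)) ^ k - (P.st \<one>\<^bsub>P\<^esub> ^ k)\<^sup>2) * (real (order G) - (real n)\<^sup>2)"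
    proof (rule mult_right_mono)
      show "0 \<le> real (order G) - (real n)\<^sup>2"
        using degree_square_le by (simp flip: of_nat_power)
      have "(\<Sum>x\<in>carrier P. (P.st x)\<^sup>2) ^ k \<le> real (card (carrier P)) ^ k"
        using P.sum_st_sq by (intro power_mono sum_nonneg) auto
      then show "(\<Sum>x\<in>carrier P. (P.st x)\<^sup>2) ^ k - (P.st \<one>\<^bsub>P\<^esub> ^ k)\<^sup>2 \<le>
          real (card (carrier P)) ^ k - (P.st \<one>\<^bsub>P\<^esub> ^ k)\<^sup>2" by simp
    qed
    finally have gap_st: "(real q ^ k * real n)\<^sup>2 \<le>
        ((real q * ((real q)\<^sup>2 - 1) / 2) ^ k - (real q ^ k)\<^sup>2) * (real (order G) - (real n)\<^sup>2)"
      by (simp only: P.st_one card_P')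
    show ?thesis
    proof (cases "\<exists>v i0. i0 < n \<and> v i0 \<noteq> 0 \<and> (\<forall>u\<in>Uh. \<forall>i<n. act u v i = v i)")
      case True
      then obtain v i0 where v: "i0 < n" "v i0 \<noteq> 0" "\<And>u i. u \<in> Uh \<Longrightarrow> i < n \<Longrightarrow> act u v i = v i"
        by blast
      have comm: "inv a \<otimes> inv b \<otimes> a \<otimes> b \<in> Uh" if ab: "a \<in> Bh" "b \<in> Bh" for a b
      proof -
        obtain x y where xy: "x \<in> pw B" "a = \<iota> x" "y \<in> pw B" "b = \<iota> y"
          using ab by (auto simp: Bh_def)
        have c: "x \<in> carrier M" "y \<in> carrier M" using xy pw_car by auto
        have "(inv\<^bsub>M\<^esub> x \<otimes>\<^bsub>M\<^esub> inv\<^bsub>M\<^esub> y \<otimes>\<^bsub>M\<^esub> x \<otimes>\<^bsub>M\<^esub> y) i \<in> U" if i: "i < k" for i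
          using i c xy(1,3) P.comm[of "x i" "y i"] pw_mem[OF P.B_carrier]
          by (simp add: mult_M inv_M)
        then have "inv\<^bsub>M\<^esub> x \<otimes>\<^bsub>M\<^esub> inv\<^bsub>M\<^esub> y \<otimes>\<^bsub>M\<^esub> x \<otimes>\<^bsub>M\<^esub> y \<in> pw U"
          using c pw_mem[OF P.U_carrier] by simp
        then have "\<iota> (inv\<^bsub>M\<^esub> x \<otimes>\<^bsub>M\<^esub> inv\<^bsub>M\<^esub> y \<otimes>\<^bsub>M\<^esub> x \<otimes>\<^bsub>M\<^esub> y) \<in> Uh" by (simp add: Uh_def)
        then show ?thesis using c by (simp add: xy)
      qed
      obtain w i1 where w: "i1 < n" "w i1 \<noteq> 0" "\<And>b. b \<in> Bh \<Longrightarrow> \<exists>c. \<forall>i<n. act b w i = c * w i"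
        using eigenvector_exists[OF Bh subs(1) comm v] by blast
      have "n * card Bh \<le> order G"
        by (rule degree_le_eigenvector[OF subgroup.subset[OF Bh] w])
      then have "real (n * card Bh) \<le> real (order G)" by (rule of_nat_mono)
      then have "real (card Bh) * real n \<le> real (card Bh) * (h * (real q + 1) ^ k)"
        unfolding g_h N_Bh by (simp add: mult_ac)
      then have "real n \<le> h * (real q + 1) ^ k"
        by (rule mult_left_le_imp_le) (use card_Bh_pos in simp)
      with gap_st show ?thesis by (rule bd.no_fixed_borel)
    next
      case no_U: False
      have "(P.unip \<one>\<^bsub>P\<^esub> ^ k * real n)\<^sup>2 \<le>
          ((\<Sum>x\<in>carrier P. (P.unip x)\<^sup>2) ^ k - (P.unip \<one>\<^bsub>P\<^esub> ^ k)\<^sup>2) * (real (order G) - (real n)\<^sup>2)"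
      proof (rule degree_gap_product[OF P.is_group P.finite_P P.U_sub,
            where k=k and \<iota>=\<iota> and f=P.unip and J="carrier P"
              and a="\<lambda>j. inv\<^bsub>P\<^esub> j" and c="\<lambda>j. j" and w="\<lambda>j. 1 / real (card B)"])
        show "v i = 0" if "\<And>h i. h \<in> (\<Pi>\<^sub>E i\<in>{..<k}. U) \<Longrightarrow> i < n \<Longrightarrow> act (\<iota> h) v i = v i" "i < n" for v i
          using no_U that unfolding Uh_def pw_def by blast
      qed (use \<iota>_G inj P.finite_P P.unip_expand in \<open>auto simp: M_def\<close>)
      also have "\<dots> \<le> ((2 * real q * (real q + 1)) ^ k - (P.unip \<one>\<^bsub>P\<^esub> ^ k)\<^sup>2) * (real (order G) - (real n)\<^sup>2)"
      proof (rule mult_right_mono)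
        show "0 \<le> real (order G) - (real n)\<^sup>2"
          using degree_square_le by (simp flip: of_nat_power)
        have "(\<Sum>x\<in>carrier P. (P.unip x)\<^sup>2) ^ k \<le> (2 * real q * (real q + 1)) ^ k"
          using P.sum_unip_sq by (intro power_mono sum_nonneg) auto
        then show "(\<Sum>x\<in>carrier P. (P.unip x)\<^sup>2) ^ k - (P.unip \<one>\<^bsub>P\<^esub> ^ k)\<^sup>2 \<le>
            (2 * real q * (real q + 1)) ^ k - (P.unip \<one>\<^bsub>P\<^esub> ^ k)\<^sup>2" by simp
      qed
      finally have "((real q + 1) ^ k * real n)\<^sup>2 \<le>
          ((2 * real q * (real q + 1)) ^ k - ((real q + 1) ^ k)\<^sup>2) * (real (order G) - (real n)\<^sup>2)"
        by (simp only: P.unip_one)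
      moreover have "(real n)\<^sup>2 \<le> real (order G)" using degree_square_le by (simp flip: of_nat_power)
      ultimately show ?thesis by (rule bd.no_fixed_unipotent)
    qed
  qed
qed

theorem theorem6p3:
  fixes G :: "'a monoid" and N :: "'a set" and F :: "'b ring" and q k :: nat
  assumes "group G" and "finite (carrier G)"
    and "\<exists>p m. Factorial_Ring.prime (p::nat) \<and> m > 0 \<and> q = p ^ m" and "odd q" and "q \<ge> 5"
    and "field F" and "card (carrier F) = q"
    and "minimal_normal N G"
    and "G\<lparr>carrier := N\<rparr> \<cong> product_group {..<k} (\<lambda>_. PSL2 F)"
    and "card (carrier (G Mod N)) < q ^ k"
  shows "let b = real (b_max G); e = real (order G) / b - b
         in e > sqrt b + 1 \<and> real (order G) < e ^ 4 - e ^ 3"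
proof -
  interpret field F by fact
  have finF: "finite (carrier F)" using assms(5,7) by (intro card_ge_0_finite) simp
  obtain B U where pair: "borel_pair (PSL2 F) B U q"
    using borel_pair_PSL2[OF finF assms(7,4,5)] by blast
  obtain p m where pm: "Factorial_Ring.prime p" "m > 0" "q = p ^ m" using assms(3) by blast
  have N: "N \<lhd> G" "N \<noteq> {\<one>\<^bsub>G\<^esub>}" using assms(8) by (auto simp: minimal_normal_def)
  have k: "k \<ge> 1"
  proof (rule ccontr)
    assume "\<not> k \<ge> 1"
    then have "k = 0" by simp
    \<comment> \<open>A direct product of no factors has one element, whereas N is
      nontrivial.\<close>
    have "card N = card (carrier (product_group {..<k} (\<lambda>_. PSL2 F)))"
      using assms(9) by (auto simp: is_iso_def iso_def dest: bij_betw_same_card)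
    then have "card N = 1" using \<open>k = 0\<close> by simp
    moreover have "\<one>\<^bsub>G\<^esub> \<in> N" using N(1) by (simp add: normal_def subgroup.one_closed)
    ultimately show False using N(2) by (auto simp: card_1_singleton_iff)
  qed
  obtain \<rho> where \<rho>: "irreducible_complex_rep G (b_max G) \<rho>"
    using b_max_mem[OF assms(1,2)] by (auto simp: irr_degrees_def)
  interpret irreducible_coeffs G "b_max G" "\<lambda>g i j. \<rho> g $$ (i, j)"
    by (rule irreducible_coeffsI[OF assms(1,2) \<rho>])
  have "real (b_max G) \<ge> 1" using n_pos by simp
  from large_defect_imp_bounds[OF this degree_defect[OF pair pm k N(1) assms(9)]]
  show ?thesis unfolding Let_def .
qed

end
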